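(* Let $G$ be a probability distribution on $[0,1]$. Let $\mathcal{T}=(\tau_k)_{k\in\mathbb{Z}}$ be an i.i.d. sequence of positive integrable random variables with distribution $F$, corresponding to a stationary renewal process $T$ on $\mathbb{R}$, and let $\Phi_G$ and $\Psi_G$ be the exchange operator and the neighbour-dependent shift operator with division distribution $G$. Then $\Phi_G(\mathcal{T})\stackrel{D}{=}\mathcal{T}$, and thus $\Psi_G(T)\stackrel{D}{=}T$, if and only if one of the following alternatives is true: (i) $F=\Gamma(\alpha,\gamma)$ and $G=\mathrm{B}(r\alpha,(1-r)\alpha)$ for some constants $\alpha>0$, $\gamma>0$ and $r\in(0,1)$; (ii) $F=\delta_s$ for some $s\in(0,\infty)$ and $G=\delta_b$ for some $b\in[0,1]$.
   Context: $\stackrel{D}{=}$ denotes equality in distribution (of sequences, respectively of point processes), and $\delta_x$ is the degenerate distribution concentrated at $x$. $\Gamma(\alpha,\gamma)$ is the Gamma distribution with shape $\alpha$ and rate $\gamma$, with density $\frac{\gamma^\alpha}{\Gamma(\alpha)}x^{\alpha-1}e^{-\gamma x}$, $x>0$. $\mathrm{B}(\alpha,\beta)$ is the Beta distribution with density $\frac{\Gamma(\alpha+\beta)}{\Gamma(\alpha)\Gamma(\beta)}x^{\alpha-1}(1-x)^{\beta-1}$, $x\in(0,1)$. Exchange operator: given a sequence $\mathcal{T}=(\tau_k)_{k\in\mathbb{Z}}$ of non-negative random variables, take an i.i.d. sequence $(b_k)_{k\in\mathbb{Z}}$ of $G$-distributed random variables independent of $\mathcal{T}$ and set $\Phi_G\mathcal{T}=(\tau'_k)_{k\in\mathbb{Z}}$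 with $\tau'_k=(1-b_k)\tau_k+b_{k+1}\tau_{k+1}$. Neighbour-dependent shift operator: for a countable subset $T$ of $\mathbb{R}$ without accumulation points, let $\mathcal{I}(T)$ be the set of intervals between consecutive points of $T$. Set $\Psi_GT=\bigcup_{I\in\mathcal{I}(T)}\{c(I)\}$, where $c(I)=x+b_I(y-x)$ for $I=(x,y)$ and the $b_I$ are random variables with distribution $G$, drawn independently of each other and of $T$. Correspondence: stationary point processes on $\mathbb{R}$ correspond one-to-one in distribution, via the Palm distribution, to stationary sequences of positive random variables with finite mean. Under the Palm version there is a point $T_0=0$ at the origin, and $\tau_k=T_k-T_{k-1}$ are the consecutive interpoint distances. The stationary renewal process corresponding to $F$ is the stationary point process whose Palm interpoint sequence is i.i.d. with distribution $F$.
   Formalization: The formal theorem also assumes that F is a point mass or that G is neither δ_0 nor δ_1; for G = δ_0 or δ_1 and non-degenerate F the invariance holds trivially while (i) and (ii) both fail. *)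

theory Defs
  imports "HOL-Probability.Probability"
begin

definition gamma_distribution :: "real \<Rightarrow> real \<Rightarrow> real measure" where
  "gamma_distribution \<alpha> \<gamma> = density lborel (\<lambda>x. ennreal
     (if 0 < x then \<gamma> powr \<alpha> / Gamma \<alpha> * x powr (\<alpha> - 1) * exp (- \<gamma> * x) else 0))"

definition beta_distribution :: "real \<Rightarrow> real \<Rightarrow> real measure" where
  "beta_distribution \<alpha> \<beta> = density lborel (\<lambda>x. ennreal
     (if 0 < x \<and> x < 1
      then Gamma (\<alpha> + \<beta>) / (Gamma \<alpha> * Gamma \<beta>) * x powr (\<alpha> - 1) * (1 - x) powr (\<beta> - 1) else 0))"

definition iid :: "'a measure \<Rightarrow> ('i \<Rightarrow> 'a \<Rightarrow> real) \<Rightarrow> real measure \<Rightarrow> bool" where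
  "iid M X F \<longleftrightarrow> prob_space.indep_vars M (\<lambda>_. borel) X UNIV \<and> (\<forall>i. distr M borel (X i) = F)"

text \<open>
  The library's \<open>indep_var\<close> requires both random elements to have values in the same type;
  this is the same notion without that restriction.
\<close>
definition independent_elements ::
  "'a measure \<Rightarrow> 'b measure \<Rightarrow> ('a \<Rightarrow> 'b) \<Rightarrow> 'c measure \<Rightarrow> ('a \<Rightarrow> 'c) \<Rightarrow> bool" where
  "independent_elements M S X S' Y \<longleftrightarrow> X \<in> M \<rightarrow>\<^sub>M S \<and> Y \<in> M \<rightarrow>\<^sub>M S' \<and>
     prob_space.indep_set M {X -` A \<inter> space M |A. A \<in> sets S} {Y -` B \<inter> space M |B. B \<in> sets S'}"

definition seq_space :: "(int \<Rightarrow> real) measure" where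
  "seq_space = PiM UNIV (\<lambda>_. borel)"

definition trajectory :: "(int \<Rightarrow> 'a \<Rightarrow> real) \<Rightarrow> 'a \<Rightarrow> int \<Rightarrow> real" where
  "trajectory X = (\<lambda>\<omega> k. X k \<omega>)"

definition exchange :: "(int \<Rightarrow> 'a \<Rightarrow> real) \<Rightarrow> (int \<Rightarrow> 'a \<Rightarrow> real) \<Rightarrow> int \<Rightarrow> 'a \<Rightarrow> real" where
  "exchange b \<tau> k \<omega> = (1 - b k \<omega>) * \<tau> k \<omega> + b (k + 1) \<omega> * \<tau> (k + 1) \<omega>"

definition configs :: "real set measure" where
  "configs = (let \<Omega> = {T. countable T \<and> (\<forall>x. \<not> x islimpt T)} in
     sigma \<Omega> {{T \<in> \<Omega>. card (T \<inter> B) = n} |B n. B \<in> sets borel \<and> bounded B})"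

text \<open>
  On a configuration the index below is injective and increasing, consecutive points have
  consecutive indices, and the largest point that is at most 0 (if any) has index 0. Hence
  \<open>nth_point T k\<close> is the usual enumeration
  \<open>\<dots> < T\<^sub>0 \<le> 0 < T\<^sub>1 < \<dots>\<close>, with \<open>T\<^sub>0 = 0\<close> whenever \<open>0 \<in> T\<close>.
\<close>
definition point_index :: "real set \<Rightarrow> real \<Rightarrow> int" where
  "point_index T x = (if 0 < x then int (card (T \<inter> {0<..x})) else - int (card (T \<inter> {x<..0})))"

definition nth_point :: "real set \<Rightarrow> int \<Rightarrow> real" where
  "nth_point T k = (THE x. x \<in> T \<and> point_index T x = k)"

definition interpoint :: "int \<Rightarrow> real set \<Rightarrow> real" where
  "interpoint k T = nth_point T k - nth_point T (k - 1)"

definition intervals :: "real set \<Rightarrow> (real \<times> real) set" where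
  "intervals T = {(x, y). x \<in> T \<and> y \<in> T \<and> x < y \<and> T \<inter> {x<..<y} = {}}"

text \<open>
  A random family of marks on the intervals of a random configuration is realised by a sequence
  of marks, the interval carrying the index of its right end point. As the index is a function of
  the configuration alone, marks that are i.i.d. and independent of the configuration remain so
  after this relabelling.
\<close>
definition neighbour_shift :: "(int \<Rightarrow> real) \<Rightarrow> real set \<Rightarrow> real set" where
  "neighbour_shift b T = (\<Union>(x, y) \<in> intervals T. {x + b (point_index T y) * (y - x)})"

definition stationary_process :: "'a measure \<Rightarrow> ('a \<Rightarrow> real set) \<Rightarrow> bool" where
  "stationary_process M T \<longleftrightarrow> T \<in> M \<rightarrow>\<^sub>M configs \<and>
     (\<forall>t. distr M configs (\<lambda>\<omega>. (\<lambda>x. x + t) ` T \<omega>) = distr M configs T)"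

definition intensity :: "'a measure \<Rightarrow> ('a \<Rightarrow> real set) \<Rightarrow> ennreal" where
  "intensity M T = (\<integral>\<^sup>+ \<omega>. of_nat (card (T \<omega> \<inter> {0<..1})) \<partial>M)"

text \<open>
  \<open>P\<close> is the law of the configuration seen from a typical point; it is determined by this
  condition if the intensity is positive and finite.
\<close>
definition palm_distribution ::
  "'a measure \<Rightarrow> ('a \<Rightarrow> real set) \<Rightarrow> real set measure \<Rightarrow> bool" where
  "palm_distribution M T P \<longleftrightarrow> sets P = sets configs \<and>
     (\<forall>A \<in> sets configs. intensity M T * emeasure P A =
        (\<integral>\<^sup>+ \<omega>. of_nat (card {x \<in> T \<omega> \<inter> {0<..1}. (\<lambda>y. y - x) ` T \<omega> \<in> A}) \<partial>M))"

text \<open>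
  Non-emptiness is required because the Palm distribution does not see the event that the
  configuration is empty; without it the correspondence would not be one-to-one.
\<close>
definition stationary_renewal_process ::
  "'a measure \<Rightarrow> ('a \<Rightarrow> real set) \<Rightarrow> real measure \<Rightarrow> bool" where
  "stationary_renewal_process M T F \<longleftrightarrow>
     stationary_process M T \<and> (AE \<omega> in M. T \<omega> \<noteq> {}) \<and>
     0 < intensity M T \<and> intensity M T < \<infinity> \<and>
     (\<exists>P. prob_space P \<and> palm_distribution M T P \<and> iid P interpoint F)"

end

theory Submission
  imports Defs
begin

text \<open>
  Cut each interval, of length \<open>\<tau> k\<close>, into its left part \<open>Y k = b k * \<tau> k\<close> and its right part
  \<open>X k = (1 - b k) * \<tau> k\<close>. The pairs \<open>(Y k, X k)\<close> are independent copies of a single pair, whose law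
  is \<open>parts_law F G\<close>, and the exchange operator only recombines parts: the new gap is
  \<open>X k + Y (k + 1)\<close>.

  If the two parts of an interval are independent, moving the sequence \<open>Y\<close> by one place does not
  change the joint law of \<open>X\<close> and \<open>Y\<close>, so the new gaps \<open>X k + Y (k + 1)\<close> have the law of the old gaps
  \<open>X k + Y k\<close> (\<open>exchange_invariant_if_parts_independent\<close>). Conversely, the consecutive new gaps
  \<open>X 0 + Y 1\<close> and \<open>X 1 + Y 2\<close> are coupled only through the pair \<open>(Y 1, X 1)\<close>; if they are independent,
  their joint Laplace transform shows that the transform of this pair factorises
  (\<open>parts_independent_if_exchange_invariant\<close>). Invariance under exchange thus means that
  \<open>b * \<tau>\<close> and \<open>(1 - b) * \<tau>\<close> are independent, where \<open>b\<close> is independent of \<open>\<tau>\<close>. By the argument of Lukacs,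
  comparing moments of \<open>b\<close> up to order two turns this into a differential equation for the logarithmic
  derivative of the Laplace transform of \<open>F\<close>, whose solutions are the gamma and the degenerate laws
  (\<open>lukacs\<close>). In the gamma case \<open>G\<close> is the law of \<open>Y / (Y + X)\<close> for independent gamma variables, a beta
  law (\<open>parts_law_gamma_beta\<close>).

  For the point process, the Palm inversion formula (\<open>inversion_renewal\<close>) writes the expectation of
  \<open>f T\<close> as the intensity times the expectation of the integral of \<open>f\<close> over all choices of the origin in
  one gap of the renewal configuration with i.i.d. gaps. Moving every point of a configuration to the
  division point of its interval and integrating over the same window gives an integral over a window
  that starts and ends at old points; since the pair of gaps and marks is invariant under a change of
  the index, the window may be moved so that it starts and ends at consecutive division points
  (\<open>shifted_integral\<close>). So the shifted process satisfies the inversion formula with the exchanged gaps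
  in place of the original ones. Equality of the gap laws therefore gives equality of the processes,
  and test functions divided by the length of the gap at the origin recover the gap law from the law
  of the process (\<open>shift_invariant_iff_exchange_invariant\<close>).
\<close>

section \<open>Measures determined by their Laplace transforms\<close>

text \<open>
  On the unit interval the partial sums of the exponential series approximate the characteristic
  function uniformly in the law, with an error that depends only on the frequency. Equal moments
  thus give equal characteristic functions.
\<close>

lemma distribution_determined_by_moments:
  fixes M1 M2 :: "real measure"
  assumes "real_distribution M1" "real_distribution M2"
    and "AE x in M1. x \<in> {0..1}" "AE x in M2. x \<in> {0..1}"
    and mom: "\<And>n. (\<integral>x. x ^ n \<partial>M1) = (\<integral>x. x ^ n \<partial>M2)"
  shows "M1 = M2"
proof (rule Levy_uniqueness[OF assms(1,2)], rule ext)
  fix t :: real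
  define S where "S n = (\<Sum>k \<le> n. ((\<i> * t)^k / fact k) * complex_of_real (\<integral>x. x ^ k \<partial>M1))" for n
  have bound: "cmod (char M t - S n) \<le> 2 * \<bar>t\<bar> ^ n / fact n"
    if M: "real_distribution M" "AE x in M. x \<in> {0..1}" and m: "\<And>n. (\<integral>x. x ^ n \<partial>M1) = (\<integral>x. x ^ n \<partial>M)"
    for M n
  proof -
    interpret real_distribution M by fact
    have int: "integrable M (\<lambda>x. x ^ k)" for k
      by (rule integrable_const_bound[where B=1])
         (auto intro: eventually_mono[OF M(2)] simp: power_abs power_le_one)
    have "cmod (char M t - S n) \<le> (2*\<bar>t\<bar>^n / fact n) * expectation (\<lambda>x. \<bar>x\<bar>^n)"
      unfolding S_def m by (rule char_approx1) (rule int)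
    also have "\<dots> \<le> (2*\<bar>t\<bar>^n / fact n) * expectation (\<lambda>x. 1)"
      by (intro mult_left_mono integral_mono_AE)
         (use integrable_abs[OF int[of n]] in \<open>auto intro: eventually_mono[OF M(2)] simp: power_abs power_le_one\<close>)
    also have "(2*\<bar>t\<bar>^n / fact n) * expectation (\<lambda>x. 1) = 2*\<bar>t\<bar>^n / fact n" using prob_space by simp
    finally show ?thesis by simp
  qed
  have "cmod (char M1 t - char M2 t) \<le> 4 * (\<bar>t\<bar> ^ n / fact n)" for n
  proof -
    have "cmod (char M1 t - char M2 t) \<le> cmod (char M1 t - S n) + cmod (char M2 t - S n)"
      by (metis norm_minus_commute norm_triangle_sub norm_diff_triangle_le order_refl add.commute)
    also have "\<dots> \<le> 2 * \<bar>t\<bar> ^ n / fact n + 2 * \<bar>t\<bar> ^ n / fact n"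
      by (intro add_mono bound assms) (simp_all add: mom)
    finally show ?thesis by simp
  qed
  moreover have "(\<lambda>n. 4 * (\<bar>t\<bar> ^ n / fact n)) \<longlonglongrightarrow> 4 * 0"
    using summable_LIMSEQ_zero[OF summable_exp[of "\<bar>t\<bar>"]] by (intro tendsto_mult tendsto_const) (simp add: divide_inverse mult.commute)
  ultimately have "cmod (char M1 t - char M2 t) \<le> 0"
    by (intro LIMSEQ_le_const[where X="\<lambda>n. 4 * (\<bar>t\<bar> ^ n / fact n)"]) auto
  then show "char M1 t = char M2 t" by simp
qed

text \<open>
  The values of the Laplace transform at the natural numbers are the moments of \<open>exp (- x)\<close>, which
  lies in the unit interval.
\<close>

lemma prob_determined_by_laplace:
  fixes M1 M2 :: "real measure"
  assumes p: "prob_space M1" "prob_space M2" and s: "sets M1 = sets borel" "sets M2 = sets borel"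
    and AE: "AE x in M1. 0 \<le> x" "AE x in M2. 0 \<le> x"
    and eq: "\<And>n::nat. (\<integral>\<^sup>+x. ennreal (exp (- (real n * x))) \<partial>M1) = (\<integral>\<^sup>+x. ennreal (exp (- (real n * x))) \<partial>M2)"
  shows "M1 = M2"
proof -
  let ?e = "\<lambda>x::real. exp (- x)"
  have D: "real_distribution (distr M borel ?e)" "AE x in distr M borel ?e. x \<in> {0..1}"
    "(\<integral>x. x ^ n \<partial>distr M borel ?e) = enn2real (\<integral>\<^sup>+x. ennreal (exp (- (real n * x))) \<partial>M)"
    if "prob_space M" "sets M = sets borel" "AE x in M. 0 \<le> x" for M n
  proof -
    interpret prob_space M by fact
    note [measurable_cong] = that(2)
    show "real_distribution (distr M borel ?e)"
      by (intro real_distribution_distr) measurable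
    show "AE x in distr M borel ?e. x \<in> {0..1}"
      by (subst AE_distr_iff) (use that(3) in auto)
    have "(\<integral>x. x ^ n \<partial>distr M borel ?e) = (\<integral>x. exp (- (real n * x)) \<partial>M)"
      by (subst integral_distr) (auto simp: exp_of_nat_mult[symmetric])
    also have "\<dots> = enn2real (\<integral>\<^sup>+x. ennreal (exp (- (real n * x))) \<partial>M)"
      by (subst integral_eq_nn_integral) auto
    finally show "(\<integral>x. x ^ n \<partial>distr M borel ?e) = \<dots>" .
  qed
  have e: "distr M1 borel ?e = distr M2 borel ?e"
    by (intro distribution_determined_by_moments D assms) (simp add: D assms)
  have "M = distr (distr M borel ?e) borel (\<lambda>y. - ln y)" if "sets M = sets borel" for M :: "real measure"
  proof -
    note [measurable_cong] = that
    have "distr (distr M borel ?e) borel (\<lambda>y. - ln y) = distr M borel (\<lambda>x. x)"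
      by (subst distr_distr) (auto simp: o_def)
    also have "\<dots> = distr M M (\<lambda>x. x)" by (rule distr_cong) (auto simp: that)
    finally show ?thesis by simp
  qed
  then show ?thesis using e s by metis
qed

text \<open>
  The value at 0 is the total mass, so that normalising reduces the claim to probability measures.
\<close>

lemma finite_measure_determined_by_laplace:
  fixes M1 M2 :: "real measure"
  assumes p: "finite_measure M1" "finite_measure M2" and s: "sets M1 = sets borel" "sets M2 = sets borel"
    and AE: "AE x in M1. 0 \<le> x" "AE x in M2. 0 \<le> x"
    and eq: "\<And>n::nat. (\<integral>\<^sup>+x. ennreal (exp (- (real n * x))) \<partial>M1) = (\<integral>\<^sup>+x. ennreal (exp (- (real n * x))) \<partial>M2)"
  shows "M1 = M2"
proof -
  have sp: "space M1 = UNIV" "space M2 = UNIV" using s[THEN sets_eq_imp_space_eq] by auto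
  define m where "m = emeasure M1 UNIV"
  have m: "m = emeasure M2 UNIV" using eq[of 0] by (simp add: sp m_def)
  have fin: "m < \<infinity>" using p(1) finite_measure.emeasure_finite[of M1 UNIV] by (auto simp: m_def top.not_eq_extremum)
  show ?thesis
  proof (cases "m = 0")
    case True
    have "emeasure M1 A = 0" "emeasure M2 A = 0" if "A \<in> sets borel" for A
      using emeasure_mono[of A UNIV M1] emeasure_mono[of A UNIV M2] True m that s
      by (auto simp: m_def)
    then show ?thesis by (intro measure_eqI) (auto simp: s)
  next
    case False
    define c where "c = 1 / m"
    have c: "c * m = 1" using False fin
      by (simp add: c_def ennreal_divide_times)
    have sc: "prob_space (scale_measure c M)" "AE x in scale_measure c M. 0 \<le> x"
      if "emeasure M UNIV = m" "space M = UNIV" "AE x in M. 0 \<le> x" for M :: "real measure"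
    proof -
      show "prob_space (scale_measure c M)"
        by (rule prob_spaceI) (simp add: that c space_scale_measure)
      from that(3) show "AE x in scale_measure c M. 0 \<le> x"
        by (auto simp: eventually_ae_filter null_sets_def space_scale_measure)
    qed
    note [measurable_cong] = s
    have "scale_measure c M1 = scale_measure c M2"
      by (rule prob_determined_by_laplace)
         (auto intro!: sc assms simp: m sp m_def[symmetric] s,
          (subst (1 2) nn_integral_scale_measure, auto simp: eq)+)
    then have "scale_measure m (scale_measure c M1) = scale_measure m (scale_measure c M2)" by simp
    moreover have "m * c = 1" using c by (simp add: mult.commute)
    ultimately show ?thesis by simp
  qed
qed


text \<open>
  Two applications of the result in one dimension: for a fixed exponent \<open>j\<close> of the second coordinate,
  the measures weighted by \<open>exp (- j * x)\<close> have the same first marginal; so, for a fixed Borel set \<open>A\<close>,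
  the second marginals of the restrictions to \<open>A\<close> have the same Laplace transform.
\<close>

lemma finite_measure_determined_by_joint_laplace:
  fixes P Q :: "(real \<times> real) measure"
  assumes p: "finite_measure P" "finite_measure Q"
    and s: "sets P = sets (borel \<Otimes>\<^sub>M borel)" "sets Q = sets (borel \<Otimes>\<^sub>M borel)"
    and AE: "AE (y, x) in P. 0 \<le> y \<and> 0 \<le> x" "AE (y, x) in Q. 0 \<le> y \<and> 0 \<le> x"
    and eq: "\<And>i j::nat. (\<integral>\<^sup>+(y, x). ennreal (exp (- (real i * y + real j * x))) \<partial>P)
                = (\<integral>\<^sup>+(y, x). ennreal (exp (- (real i * y + real j * x))) \<partial>Q)"
  shows "P = Q"
proof -
  let ?g = "\<lambda>j z. ennreal (exp (- (real j * snd z)))"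
  have first: "distr (density M (?g j)) borel fst = (distr (density M (?g j)) borel fst :: real measure)
      \<and> finite_measure (distr (density M (?g j)) borel fst)
      \<and> (AE x in distr (density M (?g j)) borel fst. 0 \<le> x)
      \<and> (\<integral>\<^sup>+x. ennreal (exp (- (real i * x))) \<partial>distr (density M (?g j)) borel fst)
          = (\<integral>\<^sup>+(y, x). ennreal (exp (- (real i * y + real j * x))) \<partial>M)"
    if "finite_measure M" "sets M = sets (borel \<Otimes>\<^sub>M borel)" "AE (y, x) in M. 0 \<le> y \<and> 0 \<le> x"
    for M :: "(real \<times> real) measure" and i j
  proof (intro conjI)
    interpret finite_measure M by fact
    note [measurable_cong] = that(2)
    have "(\<integral>\<^sup>+z. ?g j z \<partial>M) \<le> (\<integral>\<^sup>+z. 1 \<partial>M)"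
      by (rule nn_integral_mono_AE) (use that(3) in \<open>auto elim!: eventually_mono\<close>)
    also have "\<dots> < \<infinity>" by (simp add: emeasure_finite less_top[symmetric])
    finally have "(\<integral>\<^sup>+z. ?g j z \<partial>M) \<noteq> \<infinity>" by simp
    then have "finite_measure (density M (?g j))"
      by (intro finite_measureI) (simp add: emeasure_density cong: nn_integral_cong)
    then show "finite_measure (distr (density M (?g j)) borel fst)"
      by (rule finite_measure.finite_measure_distr) simp
    show "AE x in distr (density M (?g j)) borel fst. 0 \<le> x"
      by (subst AE_distr_iff) (use that(3) in \<open>auto simp: AE_density elim!: eventually_mono\<close>)
    show "(\<integral>\<^sup>+x. ennreal (exp (- (real i * x))) \<partial>distr (density M (?g j)) borel fst)
          = (\<integral>\<^sup>+(y, x). ennreal (exp (- (real i * y + real j * x))) \<partial>M)"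
      by (subst nn_integral_distr)
         (auto simp: nn_integral_density ennreal_mult'[symmetric] exp_add[symmetric] algebra_simps
            intro!: nn_integral_cong)
  qed simp
  have fst_eq: "distr (density P (?g j)) borel fst = distr (density Q (?g j)) borel fst" for j
    by (rule finite_measure_determined_by_laplace)
       (use first[OF p(1) s(1) AE(1)] first[OF p(2) s(2) AE(2)] eq in auto)
  have rect: "(\<integral>\<^sup>+z. ?g j z * indicator A (fst z) \<partial>M) = emeasure (distr (density M (?g j)) borel fst) A"
    if "sets M = sets (borel \<Otimes>\<^sub>M borel)" "A \<in> sets borel" for M A j
  proof -
    note [measurable_cong] = that(1)
    note [measurable] = that(2)
    show ?thesis
      by (subst emeasure_distr) (auto simp: emeasure_density intro!: nn_integral_cong split: split_indicator
        intro: measurable_sets)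
  qed
  have second: "finite_measure (distr (density M (\<lambda>z. indicator A (fst z))) borel snd)
      \<and> (AE x in distr (density M (\<lambda>z. indicator A (fst z))) borel snd. 0 \<le> x)
      \<and> (\<integral>\<^sup>+x. ennreal (exp (- (real j * x))) \<partial>distr (density M (\<lambda>z. indicator A (fst z))) borel snd)
          = (\<integral>\<^sup>+z. ?g j z * indicator A (fst z) \<partial>M)
      \<and> (\<forall>B\<in>sets borel. emeasure (distr (density M (\<lambda>z. indicator A (fst z))) borel snd) B = emeasure M (A \<times> B))"
    if "finite_measure M" "sets M = sets (borel \<Otimes>\<^sub>M borel)" "AE (y, x) in M. 0 \<le> y \<and> 0 \<le> x" "A \<in> sets borel"
    for M :: "(real \<times> real) measure" and A j
  proof (intro conjI ballI)
    interpret finite_measure M by fact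
    note [measurable_cong] = that(2)
    note [measurable] = that(4)
    have "(\<integral>\<^sup>+z. indicator A (fst z) \<partial>M) \<le> (\<integral>\<^sup>+z. 1 \<partial>M)"
      by (rule nn_integral_mono) (auto split: split_indicator)
    also have "\<dots> < \<infinity>" by (simp add: emeasure_finite less_top[symmetric])
    finally have "(\<integral>\<^sup>+z. indicator A (fst z) \<partial>M) \<noteq> \<infinity>" by simp
    then have "finite_measure (density M (\<lambda>z. indicator A (fst z)))"
      by (intro finite_measureI) (simp add: emeasure_density cong: nn_integral_cong)
    then show "finite_measure (distr (density M (\<lambda>z. indicator A (fst z))) borel snd)"
      by (rule finite_measure.finite_measure_distr) simp
    show "AE x in distr (density M (\<lambda>z. indicator A (fst z))) borel snd. 0 \<le> x"
      by (subst AE_distr_iff) (use that(3) in \<open>auto simp: AE_density elim!: eventually_mono\<close>)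
    show "(\<integral>\<^sup>+x. ennreal (exp (- (real j * x))) \<partial>distr (density M (\<lambda>z. indicator A (fst z))) borel snd)
          = (\<integral>\<^sup>+z. ?g j z * indicator A (fst z) \<partial>M)"
      by (subst nn_integral_distr) (auto simp: nn_integral_density mult.commute)
    fix B :: "real set" assume [measurable]: "B \<in> sets borel"
    have "emeasure (distr (density M (\<lambda>z. indicator A (fst z))) borel snd) B
        = (\<integral>\<^sup>+z. indicator A (fst z) * indicator B (snd z) \<partial>M)"
      by (subst emeasure_distr)
         (auto simp: emeasure_density intro!: nn_integral_cong split: split_indicator intro: measurable_sets)
    also have "\<dots> = (\<integral>\<^sup>+z. indicator (A \<times> B) z \<partial>M)"
      by (intro nn_integral_cong) (auto split: split_indicator)
    also have "\<dots> = emeasure M (A \<times> B)"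
      by (rule nn_integral_indicator) (simp add: that(2))
    finally show "emeasure (distr (density M (\<lambda>z. indicator A (fst z))) borel snd) B = emeasure M (A \<times> B)" .
  qed
  have rectangles: "emeasure P (A \<times> B) = emeasure Q (A \<times> B)" if "A \<in> sets borel" "B \<in> sets borel" for A B
  proof -
    have "distr (density P (\<lambda>z. indicator A (fst z))) borel snd = distr (density Q (\<lambda>z. indicator A (fst z))) borel snd"
      by (rule finite_measure_determined_by_laplace)
         (use second[OF p(1) s(1) AE(1)] second[OF p(2) s(2) AE(2)] rect[OF s(1)] rect[OF s(2)] fst_eq that in auto)
    then show ?thesis
      using second[OF p(1) s(1) AE(1)] second[OF p(2) s(2) AE(2)] that by metis
  qed
  show ?thesis
  proof (rule measure_eqI_generator_eq[OF Int_stable_pair_measure_generator[of borel borel],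
        where \<Omega>=UNIV and A="\<lambda>_. UNIV"])
    show "sets P = sigma_sets UNIV {a \<times> b |a b. a \<in> sets (borel :: real measure) \<and> b \<in> sets (borel :: real measure)}"
      "sets Q = sigma_sets UNIV {a \<times> b |a b. a \<in> sets (borel :: real measure) \<and> b \<in> sets (borel :: real measure)}"
      by (simp_all add: s sets_pair_measure)
    show "range (\<lambda>_::nat. UNIV) \<subseteq> {a \<times> b |a b. a \<in> sets (borel :: real measure) \<and> b \<in> sets (borel :: real measure)}"
      by auto (metis UNIV_Times_UNIV sets.top space_borel)
    show "emeasure P UNIV \<noteq> \<infinity>" using p(1) by (simp add: finite_measure.emeasure_finite)
  qed (use rectangles in auto)
qed

section \<open>Infinite products of a probability measure\<close>

lemma measurable_PiM_UNIV:
  assumes "\<And>i. (\<lambda>\<omega>. f \<omega> i) \<in> N \<rightarrow>\<^sub>M M i"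
  shows "f \<in> N \<rightarrow>\<^sub>M PiM UNIV M"
  by (rule measurable_PiM_single') (use assms measurable_space[OF assms] in auto)

lemma (in product_prob_space) nn_integral_prod_of_coordinates:
  assumes J: "finite J" "J \<subseteq> I" and f: "\<And>i. i \<in> J \<Longrightarrow> f i \<in> borel_measurable (M i)"
  shows "(\<integral>\<^sup>+\<omega>. (\<Prod>i\<in>J. f i (\<omega> i)) \<partial>PiM I M) = (\<Prod>i\<in>J. \<integral>\<^sup>+x. f i x \<partial>M i)"
proof -
  have "(\<Prod>i\<in>J. \<integral>\<^sup>+x. f i x \<partial>M i) = (\<integral>\<^sup>+\<omega>. (\<Prod>i\<in>J. f i (\<omega> i)) \<partial>PiM J M)"
    by (rule product_nn_integral_prod[symmetric]) (use assms in auto)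
  also have "\<dots> = (\<integral>\<^sup>+\<omega>. (\<Prod>i\<in>J. f i (\<omega> i)) \<partial>distr (PiM I M) (PiM J M) (\<lambda>x. restrict x J))"
    by (simp only: distr_PiM_restrict_finite[OF J])
  also have "\<dots> = (\<integral>\<^sup>+\<omega>. (\<Prod>i\<in>J. f i (\<omega> i)) \<partial>PiM I M)"
    using J(2) by (subst nn_integral_distr)
      (auto intro!: nn_integral_cong prod.cong borel_measurable_prod_ennreal measurable_restrict_subset
         measurable_compose[OF _ f])
  finally show ?thesis ..
qed

lemma distr_PiM_coordinatewise:
  fixes A :: "'a measure" and B :: "'b measure"
  assumes A: "prob_space A" and [measurable]: "f \<in> A \<rightarrow>\<^sub>M B"
  shows "distr (PiM UNIV (\<lambda>_::'i. A)) (PiM UNIV (\<lambda>_::'i. B)) (\<lambda>\<omega> i. f (\<omega> i)) = PiM UNIV (\<lambda>_. distr A B f)"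
proof -
  interpret A: product_prob_space "\<lambda>_::'i. A" UNIV
    by (rule product_prob_spaceI) (rule A)
  interpret B: product_prob_space "\<lambda>_::'i. distr A B f" UNIV
    by (rule product_prob_spaceI) (rule prob_space.prob_space_distr[OF A], simp)
  have [measurable]: "(\<lambda>\<omega> i. f (\<omega> i)) \<in> PiM UNIV (\<lambda>_::'i. A) \<rightarrow>\<^sub>M PiM UNIV (\<lambda>_::'i. B)"
    by (rule measurable_PiM_UNIV) simp
  show ?thesis
  proof (rule B.PiM_eq)
    show "sets (distr (PiM UNIV (\<lambda>_::'i. A)) (PiM UNIV (\<lambda>_::'i. B)) (\<lambda>\<omega> i. f (\<omega> i)))
        = sets (PiM UNIV (\<lambda>_::'i. distr A B f))"
      by (auto intro!: sets_PiM_cong)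
  next
    fix J :: "'i set" and F assume J: "finite J" "J \<subseteq> UNIV" and F: "\<And>j. j \<in> J \<Longrightarrow> F j \<in> sets (distr A B f)"
    have e: "prod_emb UNIV (\<lambda>_::'i. distr A B f) J (Pi\<^sub>E J F) = prod_emb UNIV (\<lambda>_::'i. B) J (Pi\<^sub>E J F)"
      by (simp add: prod_emb_def)
    have "(\<lambda>\<omega> i. f (\<omega> i)) -` prod_emb UNIV (\<lambda>_::'i. B) J (Pi\<^sub>E J F) \<inter> space (PiM UNIV (\<lambda>_::'i. A))
      = prod_emb UNIV (\<lambda>_::'i. A) J (Pi\<^sub>E J (\<lambda>j. f -` F j \<inter> space A))"
      by (auto simp: prod_emb_def space_PiM PiE_iff dest: measurable_space[OF assms(2)])
    then show "emeasure (distr (PiM UNIV (\<lambda>_::'i. A)) (PiM UNIV (\<lambda>_::'i. B)) (\<lambda>\<omega> i. f (\<omega> i)))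
        (prod_emb UNIV (\<lambda>_::'i. distr A B f) J (Pi\<^sub>E J F)) = (\<Prod>j\<in>J. emeasure (distr A B f) (F j))"
      unfolding e using J F
      by (subst emeasure_distr) (auto simp: A.emeasure_PiM_emb emeasure_distr intro!: sets_PiM_I)
  qed
qed

text \<open>
  Two independent i.i.d. sequences are the coordinates of one i.i.d. sequence of pairs. The boxes that
  generate the product over pairs are not products of boxes; Fubini integrates the second sequence
  out of every coordinate separately.
\<close>

lemma distr_zip_PiM:
  fixes A :: "'a measure" and B :: "'b measure"
  assumes A: "prob_space A" and B: "prob_space B"
  shows "distr (PiM UNIV (\<lambda>_::'i. A) \<Otimes>\<^sub>M PiM UNIV (\<lambda>_::'i. B)) (PiM UNIV (\<lambda>_::'i. A \<Otimes>\<^sub>M B))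
      (\<lambda>(x, y) i. (x i, y i)) = PiM UNIV (\<lambda>_. A \<Otimes>\<^sub>M B)"
proof -
  interpret A: product_prob_space "\<lambda>_::'i. A" UNIV
    by (rule product_prob_spaceI) (rule A)
  interpret B: product_prob_space "\<lambda>_::'i. B" UNIV
    by (rule product_prob_spaceI) (rule B)
  have sB: "sigma_finite_measure B" by (rule prob_space_imp_sigma_finite[OF B])
  interpret pp: pair_prob_space A B by (simp add: pair_prob_space_def pair_sigma_finite_def A B prob_space_imp_sigma_finite)
  interpret C: product_prob_space "\<lambda>_::'i. A \<Otimes>\<^sub>M B" UNIV
    by (rule product_prob_spaceI) unfold_locales
  let ?A = "PiM UNIV (\<lambda>_::'i. A)" and ?B = "PiM UNIV (\<lambda>_::'i. B)"
  have [measurable]: "(\<lambda>(x, y) i. (x i, y i)) \<in> ?A \<Otimes>\<^sub>M ?B \<rightarrow>\<^sub>M PiM UNIV (\<lambda>_::'i. A \<Otimes>\<^sub>M B)"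
    by (rule measurable_PiM_UNIV) (simp add: split_beta')
  show ?thesis
  proof (rule C.PiM_eq)
    fix J :: "'i set" and F :: "'i \<Rightarrow> ('a \<times> 'b) set" assume J: "finite J" "J \<subseteq> UNIV" and F: "\<And>j. j \<in> J \<Longrightarrow> F j \<in> sets (A \<Otimes>\<^sub>M B)"
    have F': "\<And>j. j \<in> J \<Longrightarrow> indicator (F j) \<in> borel_measurable (A \<Otimes>\<^sub>M B)"
      using F by (intro borel_measurable_indicator)
    let ?E = "prod_emb UNIV (\<lambda>_::'i. A \<Otimes>\<^sub>M B) J (Pi\<^sub>E J F)"
    have E: "?E \<in> sets (PiM UNIV (\<lambda>_::'i. A \<Otimes>\<^sub>M B))"
      using J F by (intro sets_PiM_I) auto
    note [measurable] = E
    have "emeasure (distr (?A \<Otimes>\<^sub>M ?B) (PiM UNIV (\<lambda>_::'i. A \<Otimes>\<^sub>M B)) (\<lambda>(x, y) i. (x i, y i))) ?E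
      = (\<integral>\<^sup>+z. indicator ?E z \<partial>distr (?A \<Otimes>\<^sub>M ?B) (PiM UNIV (\<lambda>_::'i. A \<Otimes>\<^sub>M B)) (\<lambda>(x, y) i. (x i, y i)))"
      by (rule nn_integral_indicator[symmetric]) simp
    also have "\<dots> = (\<integral>\<^sup>+z. indicator ?E (case z of (x, y) \<Rightarrow> \<lambda>i. (x i, y i)) \<partial>(?A \<Otimes>\<^sub>M ?B))"
      by (subst nn_integral_distr) auto
    also have "\<dots> = (\<integral>\<^sup>+x. \<integral>\<^sup>+y. indicator ?E (\<lambda>i. (x i, y i)) \<partial>?B \<partial>?A)"
      by (subst B.nn_integral_fst[symmetric]) (auto simp: split_beta')
    also have "\<dots> = (\<integral>\<^sup>+x. \<integral>\<^sup>+y. (\<Prod>j\<in>J. indicator (F j) (x j, y j)) \<partial>?B \<partial>?A)"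
      using J by (intro nn_integral_cong)
        (auto simp: prod_emb_def space_PiM PiE_iff space_pair_measure split: split_indicator intro!: prod_zero)
    also have "\<dots> = (\<integral>\<^sup>+x. (\<Prod>j\<in>J. \<integral>\<^sup>+y. indicator (F j) (x j, y) \<partial>B) \<partial>?A)"
    proof (intro nn_integral_cong)
      fix x assume x: "x \<in> space ?A"
      show "(\<integral>\<^sup>+y. (\<Prod>j\<in>J. indicator (F j) (x j, y j)) \<partial>?B) = (\<Prod>j\<in>J. \<integral>\<^sup>+y. indicator (F j) (x j, y) \<partial>B)"
        by (rule B.nn_integral_prod_of_coordinates[where f="\<lambda>j y. indicator (F j) (x j, y)"])
           (use J x in \<open>auto simp: space_PiM intro!: measurable_compose[OF _ F'] measurable_Pair1'\<close>)
    qed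
    also have "\<dots> = (\<Prod>j\<in>J. \<integral>\<^sup>+x. \<integral>\<^sup>+y. indicator (F j) (x, y) \<partial>B \<partial>A)"
      by (rule A.nn_integral_prod_of_coordinates[where f="\<lambda>j x. \<integral>\<^sup>+y. indicator (F j) (x, y) \<partial>B"])
         (use J F' in \<open>auto intro!: sigma_finite_measure.borel_measurable_nn_integral[OF sB]\<close>)
    also have "\<dots> = (\<Prod>j\<in>J. emeasure (A \<Otimes>\<^sub>M B) (F j))"
      using F by (intro prod.cong) (auto simp: sigma_finite_measure.emeasure_pair_measure[OF sB])
    finally show "emeasure (distr (?A \<Otimes>\<^sub>M ?B) (PiM UNIV (\<lambda>_::'i. A \<Otimes>\<^sub>M B)) (\<lambda>(x, y) i. (x i, y i))) ?E
       = (\<Prod>j\<in>J. emeasure (A \<Otimes>\<^sub>M B) (F j))" .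
  qed simp
qed

lemma distr_PiM_shift:
  fixes A :: "'a measure" and m :: int
  assumes "prob_space A"
  shows "distr (PiM UNIV (\<lambda>_. A)) (PiM UNIV (\<lambda>_. A)) (\<lambda>\<omega> k. \<omega> (k + m)) = PiM UNIV (\<lambda>_. A)"
  using distr_PiM_reindex[of UNIV "\<lambda>_. A" "\<lambda>k::int. k + m" UNIV] assms
  by (simp add: restrict_UNIV)

section \<open>Exchange invariance and independence of the two parts\<close>

text \<open>
  The exchange operator on sequences instead of random variables, as a map of the pair of gaps
  and marks.
\<close>

definition exchanged :: "(int \<Rightarrow> real) \<times> (int \<Rightarrow> real) \<Rightarrow> int \<Rightarrow> real" where
  "exchanged = (\<lambda>(t, b) k. (1 - b k) * t k + b (k + 1) * t (k + 1))"

text \<open>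
  The joint law of the left part \<open>b * t\<close> and the right part \<open>(1 - b) * t\<close> of one interval.
\<close>

definition parts_law :: "real measure \<Rightarrow> real measure \<Rightarrow> (real \<times> real) measure" where
  "parts_law F G = distr (F \<Otimes>\<^sub>M G) (borel \<Otimes>\<^sub>M borel) (\<lambda>(t, b). (b * t, (1 - b) * t))"

lemma measurable_seq_component: "(\<lambda>\<omega>. \<omega> k) \<in> borel_measurable seq_space"
  unfolding seq_space_def by simp

lemma measurable_exchanged[measurable]: "exchanged \<in> seq_space \<Otimes>\<^sub>M seq_space \<rightarrow>\<^sub>M seq_space"
proof -
  have "exchanged \<in> PiM UNIV (\<lambda>_. borel) \<Otimes>\<^sub>M PiM UNIV (\<lambda>_. borel) \<rightarrow>\<^sub>M PiM UNIV (\<lambda>_. borel)"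
    unfolding exchanged_def by (rule measurable_PiM_UNIV) (simp add: split_beta')
  then show ?thesis by (simp add: seq_space_def)
qed

locale division =
  fixes F G :: "real measure"
  assumes F: "prob_space F" "sets F = sets borel" "AE t in F. 0 < t"
    and G: "prob_space G" "sets G = sets borel" "AE x in G. x \<in> {0..1}"
begin

sublocale F: prob_space F by (rule F)
sublocale G: prob_space G by (rule G)
sublocale FG: pair_prob_space F G ..

lemmas sets_FG[measurable_cong] = F(2) G(2)

lemma space_F[simp]: "space F = UNIV" and space_G[simp]: "space G = UNIV"
  using F(2) G(2) by (auto dest: sets_eq_imp_space_eq)

abbreviation "taus \<equiv> PiM UNIV (\<lambda>_::int. F)"
abbreviation "bs \<equiv> PiM UNIV (\<lambda>_::int. G)"

lemma sets_taus[measurable_cong]: "sets taus = sets seq_space"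
  unfolding seq_space_def by (intro sets_PiM_cong) (auto simp: F)

lemma sets_bs[measurable_cong]: "sets bs = sets seq_space"
  unfolding seq_space_def by (intro sets_PiM_cong) (auto simp: G)


lemma AE_FG: "AE z in F \<Otimes>\<^sub>M G. 0 < fst z \<and> snd z \<in> {0..1}"
proof -
  have "AE t in F. AE b in G. 0 < t \<and> b \<in> {0..1}"
    using F(3)
  proof eventually_elim
    case (elim t)
    show ?case using G(3) by eventually_elim (use elim in auto)
  qed
  then show ?thesis
    by (subst FG.AE_pair_iff[symmetric]) auto
qed

lemma parts_law_prob: "prob_space (parts_law F G)"
  unfolding parts_law_def by (rule FG.prob_space_distr) simp

lemma sets_parts_law[simp, measurable_cong]: "sets (parts_law F G) = sets (borel \<Otimes>\<^sub>M borel)"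
  by (simp add: parts_law_def)

lemma AE_parts_law: "AE (y, x) in parts_law F G. 0 \<le> y \<and> 0 \<le> x"
  unfolding parts_law_def
  by (subst AE_distr_iff) (auto intro!: eventually_mono[OF AE_FG] simp: split_beta')

text \<open>
  The new gap \<open>k\<close> consists of the right part of the interval \<open>k\<close> and the left part of the interval
  \<open>k + 1\<close>.
\<close>

lemma distr_exchanged:
  "distr (taus \<Otimes>\<^sub>M bs) seq_space exchanged
    = distr (PiM UNIV (\<lambda>_. parts_law F G)) seq_space (\<lambda>\<omega> k. snd (\<omega> k) + fst (\<omega> (k + 1)))"
proof -
  have *: "(\<lambda>\<omega> k. snd (\<omega> k) + fst (\<omega> (k + 1))) \<in> PiM UNIV (\<lambda>_. borel \<Otimes>\<^sub>M borel) \<rightarrow>\<^sub>M seq_space"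
    unfolding seq_space_def by (rule measurable_PiM_UNIV) (simp add: split_beta')
  have z: "(\<lambda>(x, y) i. (x i, y i)) \<in> taus \<Otimes>\<^sub>M bs \<rightarrow>\<^sub>M PiM UNIV (\<lambda>_. F \<Otimes>\<^sub>M G)"
    by (rule measurable_PiM_UNIV) (simp add: split_beta')
  have s: "(\<lambda>\<omega> i. (\<lambda>(t, b). (b * t, (1 - b) * t)) (\<omega> i))
      \<in> PiM UNIV (\<lambda>_::int. F \<Otimes>\<^sub>M G) \<rightarrow>\<^sub>M PiM UNIV (\<lambda>_. borel \<Otimes>\<^sub>M borel)"
    by (rule measurable_PiM_UNIV) (simp add: split_beta')
  have "PiM UNIV (\<lambda>_::int. parts_law F G) = distr (PiM UNIV (\<lambda>_. F \<Otimes>\<^sub>M G)) (PiM UNIV (\<lambda>_. borel \<Otimes>\<^sub>M borel))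
      (\<lambda>\<omega> i. (\<lambda>(t, b). (b * t, (1 - b) * t)) (\<omega> i))"
    unfolding parts_law_def
    by (rule distr_PiM_coordinatewise[symmetric]) (unfold_locales, simp)
  also have "PiM UNIV (\<lambda>_::int. F \<Otimes>\<^sub>M G) = distr (taus \<Otimes>\<^sub>M bs) (PiM UNIV (\<lambda>_. F \<Otimes>\<^sub>M G)) (\<lambda>(x, y) i. (x i, y i))"
    by (rule distr_zip_PiM[symmetric]) (unfold_locales)
  finally show ?thesis
    using * s z
    by (simp add: distr_distr o_def)
       (auto intro!: distr_cong simp: exchanged_def fun_eq_iff)
qed

lemma distr_parts_sum: "distr (parts_law F G) borel (\<lambda>z. fst z + snd z) = F"
proof -
  have "distr (parts_law F G) borel (\<lambda>z. fst z + snd z) = distr (F \<Otimes>\<^sub>M G) F fst"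
    unfolding parts_law_def
    by (subst distr_distr) (auto intro!: distr_cong simp: F(2) algebra_simps)
  also have "\<dots> = F" by (rule G.distr_pair_fst)
  finally show ?thesis .
qed

text \<open>
  Independent parts may be shifted against each other: replacing the left parts \<open>y k\<close> by \<open>y (k + 1)\<close>
  does not change the law of the pair of sequences, and turns the sums of the parts of each interval
  into the exchanged gaps.
\<close>

lemma exchange_invariant_if_parts_independent:
  assumes L: "parts_law F G = A \<Otimes>\<^sub>M B" and A: "prob_space A" "sets A = sets borel"
    and B: "prob_space B" "sets B = sets borel"
  shows "distr (taus \<Otimes>\<^sub>M bs) seq_space exchanged = taus"
proof -
  let ?A = "PiM UNIV (\<lambda>_::int. A)" and ?B = "PiM UNIV (\<lambda>_::int. B)"
  have s[measurable_cong]: "sets ?A = sets seq_space" "sets ?B = sets seq_space"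
    unfolding seq_space_def by (auto intro!: sets_PiM_cong A B)
  interpret A: prob_space ?A by (intro prob_space_PiM A)
  interpret B: prob_space ?B by (intro prob_space_PiM B)
  have *: "(\<lambda>\<omega> k. snd (\<omega> k) + fst (\<omega> (k + m))) \<in> PiM UNIV (\<lambda>_::int. A \<Otimes>\<^sub>M B) \<rightarrow>\<^sub>M seq_space" for m
  proof -
    note [measurable_cong] = A(2) B(2)
    show ?thesis unfolding seq_space_def by (rule measurable_PiM_UNIV) (simp add: split_beta')
  qed
  have z: "(\<lambda>(x, y) i. (x i, y i)) \<in> ?A \<Otimes>\<^sub>M ?B \<rightarrow>\<^sub>M PiM UNIV (\<lambda>_. A \<Otimes>\<^sub>M B)"
    by (rule measurable_PiM_UNIV) (simp add: split_beta')
  have zip: "PiM UNIV (\<lambda>_::int. A \<Otimes>\<^sub>M B) = distr (?A \<Otimes>\<^sub>M ?B) (PiM UNIV (\<lambda>_. A \<Otimes>\<^sub>M B)) (\<lambda>(x, y) i. (x i, y i))"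
    by (rule distr_zip_PiM[symmetric]) (rule A B)+
  have unzip: "distr (PiM UNIV (\<lambda>_::int. A \<Otimes>\<^sub>M B)) seq_space (\<lambda>\<omega> k. snd (\<omega> k) + fst (\<omega> (k + m)))
     = distr (?A \<Otimes>\<^sub>M ?B) seq_space (\<lambda>(y, x) k. x k + y (k + m))" for m
    by (subst zip, subst distr_distr[OF * z]) (auto intro!: distr_cong)
  have sh: "(\<lambda>\<omega> k. \<omega> (k + 1)) \<in> ?A \<rightarrow>\<^sub>M ?A"
    by (rule measurable_PiM_UNIV) (simp add: split_beta')
  have plus: "(\<lambda>(y, x) k. x k + y k) \<in> ?A \<Otimes>\<^sub>M ?B \<rightarrow>\<^sub>M seq_space"
    unfolding measurable_cong_sets[OF sets_pair_measure_cong[OF s] refl] unfolding seq_space_def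
    by (rule measurable_PiM_UNIV) (simp add: split_beta')
  have "?A \<Otimes>\<^sub>M ?B = distr ?A ?A (\<lambda>\<omega> k. \<omega> (k + 1)) \<Otimes>\<^sub>M distr ?B ?B (\<lambda>\<omega>. \<omega>)"
    by (simp add: distr_PiM_shift[OF A(1)])
  also have "\<dots> = distr (?A \<Otimes>\<^sub>M ?B) (?A \<Otimes>\<^sub>M ?B) (\<lambda>(y, x). (\<lambda>k. y (k + 1), x))"
    using pair_measure_distr[OF sh measurable_ident_sets[OF refl], of ?B]
    by (simp add: B.sigma_finite_measure_axioms id_def)
  finally have shifted: "?A \<Otimes>\<^sub>M ?B = \<dots>" .
  have "distr (?A \<Otimes>\<^sub>M ?B) seq_space (\<lambda>(y, x) k. x k + y (k + 0))
     = distr (distr (?A \<Otimes>\<^sub>M ?B) (?A \<Otimes>\<^sub>M ?B) (\<lambda>(y, x). (\<lambda>k. y (k + 1), x))) seq_space (\<lambda>(y, x) k. x k + y k)"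
    by (simp add: shifted[symmetric])
  also have "\<dots> = distr (?A \<Otimes>\<^sub>M ?B) seq_space (\<lambda>(y, x) k. x k + y (k + 1))"
    using sh by (subst distr_distr[OF plus]) (auto intro!: distr_cong simp: split_beta')
  finally have "distr (taus \<Otimes>\<^sub>M bs) seq_space exchanged
    = distr (PiM UNIV (\<lambda>_::int. A \<Otimes>\<^sub>M B)) seq_space (\<lambda>\<omega> k. snd (\<omega> k) + fst (\<omega> (k + 0)))"
    unfolding distr_exchanged L unzip by simp
  also have "\<dots> = distr (PiM UNIV (\<lambda>_::int. parts_law F G)) seq_space (\<lambda>\<omega> k. (\<lambda>z. fst z + snd z) (\<omega> k))"
    by (simp add: L add.commute)
  also have "\<dots> = PiM UNIV (\<lambda>_. distr (parts_law F G) borel (\<lambda>z. fst z + snd z))"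
    unfolding seq_space_def
    by (rule distr_PiM_coordinatewise) (simp_all add: parts_law_prob)
  finally show ?thesis unfolding distr_parts_sum .
qed

text \<open>
  Write \<open>\<psi>\<close>, \<open>\<phi>\<close>, \<open>\<Lambda>\<close> and \<open>\<Phi>\<close> for the Laplace transforms of the left part, the right part, the pair and
  the whole interval. The transform of the new gaps 0 and 1 is \<open>\<phi> i * \<Lambda> i j * \<psi> j\<close> because these gaps
  involve one part of the intervals 0 and 2 and both parts of the interval 1; by invariance it is
  \<open>\<Phi> i * \<Phi> j\<close>. The case \<open>j = 0\<close> reads \<open>\<Phi> i = \<phi> i * \<psi> i\<close>, and cancelling leaves \<open>\<Lambda> i j = \<psi> i * \<phi> j\<close>.
\<close>

lemma parts_independent_if_exchange_invariant:
  assumes inv: "distr (taus \<Otimes>\<^sub>M bs) seq_space exchanged = taus"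
  shows "parts_law F G = distr (parts_law F G) borel fst \<Otimes>\<^sub>M distr (parts_law F G) borel snd"
proof -
  let ?L = "parts_law F G"
  let ?e = "\<lambda>(n::nat) x::real. ennreal (exp (- (real n * x)))"
  have eF: "?e i \<in> borel_measurable F" for i
    unfolding measurable_cong_sets[OF F(2) refl] by measurable
  interpret L: prob_space ?L by (rule parts_law_prob)
  interpret W: product_prob_space "\<lambda>_::int. ?L" UNIV
    by (rule product_prob_spaceI) (rule parts_law_prob)
  interpret R: product_prob_space "\<lambda>_::int. F" UNIV
    by (rule product_prob_spaceI) (rule F)
  define \<psi> where "\<psi> i = (\<integral>\<^sup>+z. ?e i (fst z) \<partial>?L)" for i
  define \<phi> where "\<phi> i = (\<integral>\<^sup>+z. ?e i (snd z) \<partial>?L)" for i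
  define \<Phi> where "\<Phi> i = (\<integral>\<^sup>+t. ?e i t \<partial>F)" for i
  define \<Lambda> where "\<Lambda> i j = (\<integral>\<^sup>+z. ?e i (fst z) * ?e j (snd z) \<partial>?L)" for i j
  note [measurable] = measurable_seq_component[of 0] measurable_seq_component[of 1]
  have c[measurable]: "(\<lambda>\<omega> k. snd (\<omega> k) + fst (\<omega> (k + 1))) \<in> PiM UNIV (\<lambda>_::int. ?L) \<rightarrow>\<^sub>M seq_space"
    unfolding seq_space_def by (rule measurable_PiM_UNIV) (simp add: split_beta')
  have key: "\<phi> i * (\<Lambda> i j * \<psi> j) = \<Phi> i * \<Phi> j" for i j
  proof -
    define f where "f k = (if k = (0::int) then (\<lambda>z. ?e i (snd z)) else if k = 1 then (\<lambda>z. ?e i (fst z) * ?e j (snd z))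
        else (\<lambda>z. ?e j (fst z)))" for k
    have "\<Phi> i * \<Phi> j = (\<Prod>k\<in>{0,1::int}. \<integral>\<^sup>+t. (if k = 0 then ?e i else ?e j) t \<partial>F)"
      by (simp add: \<Phi>_def)
    also have "\<dots> = (\<integral>\<^sup>+t. (\<Prod>k\<in>{0,1}. (if k = 0 then ?e i else ?e j) (t k)) \<partial>taus)"
      by (rule R.nn_integral_prod_of_coordinates[symmetric]) (use eF in auto)
    also have "\<dots> = (\<integral>\<^sup>+t. ?e i (t 0) * ?e j (t 1) \<partial>taus)" by simp
    also have "\<dots> = (\<integral>\<^sup>+t. ?e i (t 0) * ?e j (t 1) \<partial>distr (PiM UNIV (\<lambda>_. ?L)) seq_space (\<lambda>\<omega> k. snd (\<omega> k) + fst (\<omega> (k + 1))))"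
      by (simp only: inv[unfolded distr_exchanged])
    also have "\<dots> = (\<integral>\<^sup>+\<omega>. (\<Prod>k\<in>{0,1,2}. f k (\<omega> k)) \<partial>PiM UNIV (\<lambda>_. ?L))"
      by (subst nn_integral_distr)
         (auto simp: f_def ennreal_mult'[symmetric] exp_add[symmetric] algebra_simps intro!: nn_integral_cong)
    also have "\<dots> = (\<Prod>k\<in>{0,1,2}. \<integral>\<^sup>+z. f k z \<partial>?L)"
      by (rule W.nn_integral_prod_of_coordinates) (auto simp: f_def)
    also have "\<dots> = \<phi> i * (\<Lambda> i j * \<psi> j)"
      by (simp add: f_def \<phi>_def \<psi>_def \<Lambda>_def)
    finally show ?thesis ..
  qed
  have one: "\<psi> 0 = 1" "\<Phi> 0 = 1" using L.emeasure_space_1 F.emeasure_space_1 by (simp_all add: \<psi>_def \<Phi>_def)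
  have factor: "\<Phi> i = \<phi> i * \<psi> i" for i
    using key[of i 0] by (simp add: one) (simp add: \<Lambda>_def \<psi>_def)
  have bounds: "0 < \<psi> i" "\<psi> i \<noteq> \<top>" "0 < \<phi> i" "\<phi> i \<noteq> \<top>" for i
  proof -
    have *: "0 < (\<integral>\<^sup>+z. ?e i (h z) \<partial>?L) \<and> (\<integral>\<^sup>+z. ?e i (h z) \<partial>?L) \<noteq> \<top>"
      if [measurable]: "h \<in> borel_measurable ?L" and "AE z in ?L. 0 \<le> h z" for h
    proof
      have "(\<integral>\<^sup>+z. ?e i (h z) \<partial>?L) \<noteq> 0"
        using L.AE_False by (subst nn_integral_0_iff_AE) auto
      then show "0 < (\<integral>\<^sup>+z. ?e i (h z) \<partial>?L)" by (simp add: zero_less_iff_neq_zero)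
      have "(\<integral>\<^sup>+z. ?e i (h z) \<partial>?L) \<le> (\<integral>\<^sup>+z. 1 \<partial>?L)"
        by (rule nn_integral_mono_AE) (use that(2) in \<open>auto elim!: eventually_mono\<close>)
      also have "\<dots> = 1" using L.emeasure_space_1 by simp
      finally show "(\<integral>\<^sup>+z. ?e i (h z) \<partial>?L) \<noteq> \<top>" by (auto simp: top_unique)
    qed
    show "0 < \<psi> i" "\<psi> i \<noteq> \<top>" "0 < \<phi> i" "\<phi> i \<noteq> \<top>"
      using *[of fst] *[of snd] AE_parts_law by (auto simp: \<psi>_def \<phi>_def split_beta' elim!: eventually_mono)
  qed
  have \<Lambda>: "\<Lambda> i j = \<psi> i * \<phi> j" for i j
  proof -
    have "(\<phi> i * \<psi> j) * \<Lambda> i j = (\<phi> i * \<psi> j) * (\<psi> i * \<phi> j)"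
      using key[of i j] by (simp add: factor ac_simps)
    then show ?thesis
      using bounds[of i] bounds[of j] ennreal_mult_cancel_left[of "\<phi> i * \<psi> j"]
      by (auto simp: ennreal_mult_eq_top_iff)
  qed
  let ?A = "distr ?L borel fst" and ?B = "distr ?L borel snd"
  interpret A: prob_space ?A by (rule L.prob_space_distr) simp
  interpret B: prob_space ?B by (rule L.prob_space_distr) simp
  interpret AB: pair_prob_space ?A ?B ..
  show ?thesis
  proof (rule finite_measure_determined_by_joint_laplace)
    show "AE (y, x) in ?A \<Otimes>\<^sub>M ?B. 0 \<le> y \<and> 0 \<le> x"
    proof -
      have a: "AE y in ?A. 0 \<le> y" "AE x in ?B. 0 \<le> x"
        using AE_parts_law by (auto simp: AE_distr_iff split_beta' elim!: eventually_mono)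
      have "AE y in ?A. AE x in ?B. 0 \<le> y \<and> 0 \<le> x"
        using a(1)
      proof eventually_elim
        case (elim y) show ?case using a(2) by eventually_elim (use elim in auto)
      qed
      moreover have "{z \<in> space (?A \<Otimes>\<^sub>M ?B). 0 \<le> fst z \<and> 0 \<le> snd z} \<in> sets (?A \<Otimes>\<^sub>M ?B)"
        by measurable
      ultimately show ?thesis
        using AB.AE_pair_measure[of "\<lambda>z. 0 \<le> fst z \<and> 0 \<le> snd z"] by (simp add: split_beta')
    qed
    fix i j :: nat
    have "(\<integral>\<^sup>+(y, x). ennreal (exp (- (real i * y + real j * x))) \<partial>?L) = \<Lambda> i j"
      unfolding \<Lambda>_def
      by (intro nn_integral_cong) (auto simp: ennreal_mult'[symmetric] exp_add[symmetric])
    moreover have "(\<integral>\<^sup>+(y, x). ennreal (exp (- (real i * y + real j * x))) \<partial>(?A \<Otimes>\<^sub>M ?B))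
        = (\<integral>\<^sup>+y. \<integral>\<^sup>+x. ?e i y * ?e j x \<partial>?B \<partial>?A)"
      by (subst B.nn_integral_fst[symmetric])
         (auto simp: ennreal_mult'[symmetric] exp_add[symmetric] intro!: nn_integral_cong)
    moreover have "\<dots> = (\<integral>\<^sup>+y. ?e i y \<partial>?A) * (\<integral>\<^sup>+x. ?e j x \<partial>?B)"
      by (simp add: nn_integral_cmult nn_integral_multc)
    moreover have "\<dots> = \<psi> i * \<phi> j"
      by (simp add: nn_integral_distr \<psi>_def \<phi>_def)
    ultimately show "(\<integral>\<^sup>+(y, x). ennreal (exp (- (real i * y + real j * x))) \<partial>?L)
        = (\<integral>\<^sup>+(y, x). ennreal (exp (- (real i * y + real j * x))) \<partial>(?A \<Otimes>\<^sub>M ?B))"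
      by (simp add: \<Lambda>)
  qed (use AE_parts_law in \<open>auto intro: L.finite_measure_axioms AB.finite_measure_axioms\<close>)
qed

end

section \<open>Derivatives of Laplace transforms\<close>

text \<open>
  Up to the sign \<open>(-1) ^ n\<close>, the \<open>n\<close>-th derivative of the Laplace transform of \<open>H\<close>.
\<close>

definition laplace_moment :: "real measure \<Rightarrow> nat \<Rightarrow> real \<Rightarrow> real" where
  "laplace_moment H n \<theta> = (\<integral>x. x ^ n * exp (- (\<theta> * x)) \<partial>H)"

lemma power_times_exp_le:
  fixes a x :: real
  assumes "0 < a" "0 \<le> x"
  shows "x ^ n * exp (- (a * x)) \<le> fact n / a ^ n"
proof -
  have "(a * x) ^ n / fact n \<le> exp (a * x)"
    using sum_le_suminf[OF summable_exp[of "a * x"], of "{n}"] assms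
    by (simp add: exp_def divide_inverse mult.commute scaleR_conv_of_real)
  then show ?thesis
    using assms by (simp add: exp_minus field_simps power_mult_distrib)
qed

text \<open>
  A quadratic bound for the remainder of the linear approximation, weak in its constant but valid for
  both signs of \<open>u\<close>.
\<close>

lemma exp_remainder_bounds:
  fixes u :: real
  shows "0 \<le> exp (- u) - 1 + u" "exp (- u) - 1 + u \<le> u\<^sup>2 * exp \<bar>u\<bar>"
proof -
  show "0 \<le> exp (- u) - 1 + u" using exp_ge_add_one_self[of "- u"] by simp
  have le: "1 - exp (- w) \<le> w" for w :: real using exp_ge_add_one_self[of "- w"] by simp
  have "exp (- u) * (1 + u) \<le> exp (- u) * exp u"
    by (intro mult_left_mono) (auto simp: exp_ge_add_one_self)
  then have "exp (- u) - 1 + u \<le> u * (1 - exp (- u))"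
    by (simp add: exp_minus_inverse algebra_simps)
  also have "\<dots> \<le> \<bar>u\<bar> * (\<bar>u\<bar> * exp \<bar>u\<bar>)"
  proof (cases "0 \<le> u")
    case True
    have "1 - exp (- u) \<le> u * 1" using le[of u] by simp
    also have "\<dots> \<le> u * exp u" using True by (intro mult_left_mono) auto
    finally show ?thesis using True by (simp add: mult_left_mono)
  next
    case False
    have "exp (- u) - 1 = exp (- u) * (1 - exp u)" by (simp add: algebra_simps exp_minus_inverse)
    also have "\<dots> \<le> exp (- u) * (- u)" using le[of "- u"] by (intro mult_left_mono) auto
    finally have "(- u) * (exp (- u) - 1) \<le> (- u) * (exp (- u) * (- u))"
      using False by (intro mult_left_mono) auto
    then show ?thesis using False by (simp add: algebra_simps)
  qed
  also have "\<dots> = u\<^sup>2 * exp \<bar>u\<bar>" by (simp add: power2_eq_square)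
  finally show "exp (- u) - 1 + u \<le> u\<^sup>2 * exp \<bar>u\<bar>" .
qed

locale nonneg_prob =
  fixes H :: "real measure"
  assumes H: "prob_space H" "sets H = sets borel" "AE x in H. 0 \<le> x"
begin

sublocale prob_space H by (rule H)

lemmas sets_H[measurable_cong] = H(2)

lemma integrable_laplace_moment:
  assumes "0 < \<theta>"
  shows "integrable H (\<lambda>x. x ^ n * exp (- (\<theta> * x)))"
  by (rule integrable_const_bound[where B="fact n / \<theta> ^ n"])
     (auto intro!: eventually_mono[OF H(3)] power_times_exp_le[OF assms] simp: abs_mult)

lemma laplace_moment_eq:
  "ennreal (laplace_moment H n \<theta>) = (\<integral>\<^sup>+x. ennreal (x ^ n * exp (- (\<theta> * x))) \<partial>H)" if "0 < \<theta>"
  unfolding laplace_moment_def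
  by (rule nn_integral_eq_integral[symmetric])
     (auto intro: integrable_laplace_moment[OF that] eventually_mono[OF H(3)])

lemma laplace_moment_0_pos: "0 < \<theta> \<Longrightarrow> 0 < laplace_moment H 0 \<theta>"
proof -
  assume \<theta>: "0 < \<theta>"
  have "integral\<^sup>L H (\<lambda>x. x ^ 0 * exp (- (\<theta> * x))) \<noteq> 0"
    by (subst integral_nonneg_eq_0_iff_AE[OF integrable_laplace_moment[OF \<theta>]]) (auto simp: AE_False)
  moreover have "0 \<le> integral\<^sup>L H (\<lambda>x. x ^ 0 * exp (- (\<theta> * x)))" by simp
  ultimately show ?thesis unfolding laplace_moment_def by linarith
qed

lemma laplace_moment_0_le: "0 < \<theta> \<Longrightarrow> laplace_moment H 0 \<theta> \<le> 1"
proof -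
  assume \<theta>: "0 < \<theta>"
  have "laplace_moment H 0 \<theta> \<le> (\<integral>x. 1 \<partial>H)"
    unfolding laplace_moment_def
    by (rule integral_mono_AE[OF integrable_laplace_moment[OF \<theta>]])
       (auto intro!: eventually_mono[OF H(3)] simp: \<theta> less_imp_le)
  then show ?thesis by (simp add: prob_space)
qed

text \<open>
  The integrand of the difference quotient differs from its limit by at most a constant times \<open>\<bar>h\<bar>\<close>,
  uniformly in \<open>x\<close>: for \<open>\<bar>h\<bar> < \<theta> / 2\<close> half of the exponential decay is left to absorb the powers
  of \<open>x\<close>.
\<close>

lemma laplace_moment_deriv:
  assumes \<theta>: "0 < \<theta>"
  shows "(laplace_moment H n has_real_derivative - laplace_moment H (Suc n) \<theta>) (at \<theta>)"
proof -
  define C where "C = fact (n + 2) / (\<theta> / 2) ^ (n + 2)"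
  let ?r = "\<lambda>h x. x ^ n * exp (- (\<theta> * x)) * (exp (- (h * x)) - 1 + h * x)"
  have r: "0 \<le> ?r h x \<and> ?r h x \<le> h\<^sup>2 * C" if h: "\<bar>h\<bar> < \<theta> / 2" and x: "0 \<le> x" for h x
  proof
    show "0 \<le> ?r h x" using x exp_remainder_bounds(1)[of "h * x"] by simp
    have "?r h x \<le> x ^ n * exp (- (\<theta> * x)) * ((h * x)\<^sup>2 * exp \<bar>h * x\<bar>)"
      using x exp_remainder_bounds(2)[of "h * x"] by (intro mult_left_mono) auto
    also have "\<dots> = h\<^sup>2 * (x ^ (n + 2) * (exp (- (\<theta> * x)) * exp (\<bar>h\<bar> * x)))"
      using x by (simp add: power_mult_distrib power_add abs_mult power2_eq_square)
    also have "\<dots> \<le> h\<^sup>2 * (x ^ (n + 2) * exp (- ((\<theta> / 2) * x)))"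
    proof -
      have "\<bar>h\<bar> * x \<le> (\<theta> / 2) * x" using h x by (intro mult_right_mono) auto
      then have "exp (- (\<theta> * x)) * exp (\<bar>h\<bar> * x) \<le> exp (- ((\<theta> / 2) * x))"
        by (simp add: exp_add[symmetric])
      then show ?thesis using x by (intro mult_left_mono) auto
    qed
    also have "\<dots> \<le> h\<^sup>2 * C"
      unfolding C_def using power_times_exp_le[of "\<theta> / 2" x "n + 2"] \<theta> x by (intro mult_left_mono) auto
    finally show "?r h x \<le> h\<^sup>2 * C" .
  qed
  have diff: "\<bar>(laplace_moment H n (\<theta> + h) - laplace_moment H n \<theta>) / h - (- laplace_moment H (Suc n) \<theta>)\<bar> \<le> \<bar>h\<bar> * C"
    if h: "\<bar>h\<bar> < \<theta> / 2" "h \<noteq> 0" for h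
  proof -
    have pos: "0 < \<theta> + h" using h \<theta> by auto
    have "laplace_moment H n (\<theta> + h) - laplace_moment H n \<theta> + h * laplace_moment H (Suc n) \<theta>
        = (\<integral>x. (x ^ n * exp (- ((\<theta> + h) * x)) - x ^ n * exp (- (\<theta> * x)) + h * (x ^ Suc n * exp (- (\<theta> * x)))) \<partial>H)"
      unfolding laplace_moment_def
      using integrable_laplace_moment[OF pos, of n] integrable_laplace_moment[OF \<theta>, of n]
        integrable_laplace_moment[OF \<theta>, of "Suc n"]
      by (subst Bochner_Integration.integral_add Bochner_Integration.integral_diff; simp)+
    also have "\<dots> = (\<integral>x. ?r h x \<partial>H)"
      by (intro Bochner_Integration.integral_cong refl) (simp add: algebra_simps exp_add[symmetric] distrib_right)
    finally have e: "laplace_moment H n (\<theta> + h) - laplace_moment H n \<theta> + h * laplace_moment H (Suc n) \<theta> = (\<integral>x. ?r h x \<partial>H)" .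
    have i: "integrable H (?r h)"
      by (rule integrable_const_bound[where B="h\<^sup>2 * C"])
         (auto intro!: eventually_mono[OF H(3)] simp: abs_of_nonneg r[OF h(1)])
    have "0 \<le> (\<integral>x. ?r h x \<partial>H)"
      by (rule integral_nonneg_AE) (use r[OF h(1)] in \<open>auto intro!: eventually_mono[OF H(3)]\<close>)
    moreover have "(\<integral>x. ?r h x \<partial>H) \<le> (\<integral>x. h\<^sup>2 * C \<partial>H)"
      by (rule integral_mono_AE[OF i]) (use r[OF h(1)] in \<open>auto intro!: eventually_mono[OF H(3)]\<close>)
    ultimately have "\<bar>laplace_moment H n (\<theta> + h) - laplace_moment H n \<theta> + h * laplace_moment H (Suc n) \<theta>\<bar> \<le> h\<^sup>2 * C"
      by (simp add: e prob_space)
    moreover have "(laplace_moment H n (\<theta> + h) - laplace_moment H n \<theta>) / h - (- laplace_moment H (Suc n) \<theta>)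
       = (laplace_moment H n (\<theta> + h) - laplace_moment H n \<theta> + h * laplace_moment H (Suc n) \<theta>) / h"
      using h(2) by (simp add: field_simps)
    ultimately show ?thesis
      using h(2) by (simp add: abs_divide divide_le_eq) (simp add: power2_eq_square abs_mult[symmetric] ac_simps)
  qed
  have "((\<lambda>h. (laplace_moment H n (\<theta> + h) - laplace_moment H n \<theta>) / h - (- laplace_moment H (Suc n) \<theta>)) \<longlongrightarrow> 0) (at 0)"
  proof (rule Lim_null_comparison)
    show "\<forall>\<^sub>F h in at 0. norm ((laplace_moment H n (\<theta> + h) - laplace_moment H n \<theta>) / h - (- laplace_moment H (Suc n) \<theta>)) \<le> \<bar>h\<bar> * C"
      unfolding eventually_at using diff \<theta> by (intro exI[of _ "\<theta> / 2"]) (auto simp: dist_real_def)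
    show "((\<lambda>h. \<bar>h\<bar> * C) \<longlongrightarrow> 0) (at 0)"
      by (rule tendsto_eq_intros refl | simp)+
  qed
  then show ?thesis
    unfolding DERIV_def by (simp add: LIM_zero_iff[symmetric, of _ "- laplace_moment H (Suc n) \<theta>"] del: minus_diff_eq diff_minus_eq_add)
qed

text \<open>
  This is the initial condition for the differential equations below, which hold for positive
  arguments only.
\<close>

lemma laplace_moment_0_limit: "(\<lambda>n. laplace_moment H 0 (1 / real (Suc n))) \<longlonglongrightarrow> 1"
proof -
  have "(\<lambda>n. \<integral>x. x ^ 0 * exp (- (1 / real (Suc n) * x)) \<partial>H) \<longlonglongrightarrow> (\<integral>x. 1 \<partial>H)"
  proof (rule integral_dominated_convergence[where w="\<lambda>_. 1"])
    show "AE x in H. (\<lambda>n. x ^ 0 * exp (- (1 / real (Suc n) * x))) \<longlonglongrightarrow> 1"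
    proof (intro always_eventually allI)
      fix x :: real
      have "(\<lambda>n. exp (- (1 / real (Suc n) * x))) \<longlonglongrightarrow> exp (- (0 * x))"
        by (intro tendsto_intros LIMSEQ_Suc[OF lim_1_over_n])
      then show "(\<lambda>n. x ^ 0 * exp (- (1 / real (Suc n) * x))) \<longlonglongrightarrow> 1" by simp
    qed
    show "AE x in H. norm (x ^ 0 * exp (- (1 / real (Suc n) * x))) \<le> 1" for n
      by (auto intro!: eventually_mono[OF H(3)])
  qed auto
  then show ?thesis by (simp add: laplace_moment_def prob_space)
qed

end

lemma eq_if_laplace_moment_0_eq:
  assumes "nonneg_prob A" "nonneg_prob B"
    and eq: "\<And>\<theta>. 0 < \<theta> \<Longrightarrow> laplace_moment A 0 \<theta> = laplace_moment B 0 \<theta>"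
  shows "A = B"
proof -
  interpret A: nonneg_prob A by fact
  interpret B: nonneg_prob B by fact
  show ?thesis
  proof (rule prob_determined_by_laplace)
    fix n :: nat
    show "(\<integral>\<^sup>+x. ennreal (exp (- (real n * x))) \<partial>A) = (\<integral>\<^sup>+x. ennreal (exp (- (real n * x))) \<partial>B)"
    proof (cases "n = 0")
      case True then show ?thesis by (simp add: A.emeasure_space_1 B.emeasure_space_1)
    next
      case False
      then show ?thesis
        using A.laplace_moment_eq[of "real n" 0] B.laplace_moment_eq[of "real n" 0] eq[of "real n"] by simp
    qed
  qed (rule A.H B.H)+
qed

section \<open>The theorem of Lukacs\<close>

lemma constant_on_positive_if_derivative_0:
  fixes g :: "real \<Rightarrow> real"
  assumes "\<forall>x>0. (g has_real_derivative 0) (at x)"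
  shows "\<exists>C. \<forall>x>0. g x = C"
  using has_field_derivative_zero_constant[of "{0<..}" g] assms
  by (auto intro: has_field_derivative_at_within)

lemma equals_limit_if_derivative_0:
  fixes g :: "real \<Rightarrow> real"
  assumes "\<forall>x>0. (g has_real_derivative 0) (at x)"
    and lim: "(\<lambda>n. g (1 / real (Suc n))) \<longlonglongrightarrow> l" and x: "0 < x"
  shows "g x = l"
proof -
  obtain C where C: "\<forall>x>0. g x = C"
    using constant_on_positive_if_derivative_0[OF assms(1)] ..
  then have "(\<lambda>n. g (1 / real (Suc n))) \<longlonglongrightarrow> C" by simp
  with lim C x show ?thesis using LIMSEQ_unique by blast
qed

lemma has_derivative_ln_comp:
  fixes f :: "real \<Rightarrow> real"
  assumes "(f has_real_derivative f') (at x)" "0 < f x"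
  shows "((\<lambda>x. ln (f x)) has_real_derivative f' / f x) (at x)"
  using assms by (auto intro!: derivative_eq_intros)

lemma eq_return_if_AE_const:
  fixes M :: "real measure"
  assumes "prob_space M" "sets M = sets borel" "AE x in M. x = a"
  shows "M = return borel a"
  by (rule trans[OF prob_space.AE_eq_constD(1)[OF assms(1,3)] return_cong[OF assms(2)]])

context division begin

sublocale FF: nonneg_prob F
proof
  show "AE x in F. 0 \<le> x" using F(3) by eventually_elim simp
qed (rule F)+

lemma prob_UNIV[simp]: "measure F UNIV = 1" "measure G UNIV = 1"
  using F.prob_space G.prob_space by simp_all

lemma integrable_G_power: "integrable G (\<lambda>b. b ^ k)"
  by (rule G.integrable_const_bound[where B=1])
     (auto intro!: eventually_mono[OF G(3)] power_le_one simp: power_abs)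

lemma AE_factors_nonneg:
  assumes L: "parts_law F G = A \<Otimes>\<^sub>M B" and A: "prob_space A" "sets A = sets borel"
    and B: "prob_space B" "sets B = sets borel"
  shows "nonneg_prob A" "nonneg_prob B"
proof -
  interpret A: prob_space A by fact
  interpret B: prob_space B by fact
  interpret BA: pair_prob_space B A ..
  have swap: "pair_sigma_finite B A" ..
  note [measurable_cong] = A(2) B(2)
  have ae: "AE z in A \<Otimes>\<^sub>M B. 0 \<le> fst z" "AE z in A \<Otimes>\<^sub>M B. 0 \<le> snd z"
    using AE_parts_law unfolding L split_beta' by (auto elim!: eventually_mono)
  have "AE x in distr (A \<Otimes>\<^sub>M B) A fst. 0 \<le> x"
    by (subst AE_distr_iff) (use ae in auto)
  then have "AE x in A. 0 \<le> x"
    unfolding prob_space.distr_pair_fst[OF B(1)] .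
  then show "nonneg_prob A" by (intro nonneg_prob.intro A)
  have "AE x in distr (B \<Otimes>\<^sub>M A) B fst. 0 \<le> x"
  proof (subst AE_distr_iff)
    have "AE z in distr (A \<Otimes>\<^sub>M B) (B \<Otimes>\<^sub>M A) (\<lambda>(x, y). (y, x)). 0 \<le> fst z"
      by (subst AE_distr_iff) (use ae in \<open>auto simp: split_beta'\<close>)
    then show "AE x in B \<Otimes>\<^sub>M A. 0 \<le> fst x"
      by (subst pair_sigma_finite.distr_pair_swap[OF swap])
  qed auto
  then have "AE x in B. 0 \<le> x"
    unfolding prob_space.distr_pair_fst[OF A(1)] .
  then show "nonneg_prob B" by (intro nonneg_prob.intro B)
qed

text \<open>
  The independence of the parts \<open>Y\<close> and \<open>X\<close> and the independence of \<open>b\<close> and \<open>t = Y + X\<close> give two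
  evaluations of the expectation of \<open>Y ^ k * exp (- (\<theta> * t))\<close>.
\<close>

lemma factor_moments:
  assumes L: "parts_law F G = A \<Otimes>\<^sub>M B" and A: "prob_space A" "sets A = sets borel"
    and B: "prob_space B" "sets B = sets borel" and \<theta>: "0 < \<theta>"
  shows "laplace_moment A k \<theta> * laplace_moment B 0 \<theta> = (\<integral>b. b ^ k \<partial>G) * laplace_moment F k \<theta>"
proof -
  interpret A: nonneg_prob A by (rule AE_factors_nonneg[OF L A B])
  interpret B: nonneg_prob B by (rule AE_factors_nonneg[OF L A B])
  have nonneg: "0 \<le> laplace_moment A k \<theta>" "0 \<le> laplace_moment B 0 \<theta>" "0 \<le> laplace_moment F k \<theta>" "0 \<le> (\<integral>b. b ^ k \<partial>G)"
    unfolding laplace_moment_def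
    by (auto intro!: integral_nonneg_AE eventually_mono[OF A.H(3)] eventually_mono[OF FF.H(3)] eventually_mono[OF G(3)])
  let ?f = "\<lambda>y x. ennreal (y ^ k * exp (- (\<theta> * y))) * ennreal (x ^ 0 * exp (- (\<theta> * x)))"
  have "ennreal (laplace_moment A k \<theta>) * ennreal (laplace_moment B 0 \<theta>) = (\<integral>\<^sup>+y. \<integral>\<^sup>+x. ?f y x \<partial>B \<partial>A)"
    unfolding A.laplace_moment_eq[OF \<theta>] B.laplace_moment_eq[OF \<theta>]
    by (simp add: nn_integral_cmult nn_integral_multc)
  also have "\<dots> = (\<integral>\<^sup>+z. ?f (fst z) (snd z) \<partial>parts_law F G)"
    unfolding L by (subst B.nn_integral_fst[symmetric]) auto
  also have "\<dots> = (\<integral>\<^sup>+z. ?f (snd z * fst z) ((1 - snd z) * fst z) \<partial>(F \<Otimes>\<^sub>M G))"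
    unfolding parts_law_def by (subst nn_integral_distr) (auto simp: split_beta')
  also have "\<dots> = (\<integral>\<^sup>+z. ennreal (fst z ^ k * exp (- (\<theta> * fst z))) * ennreal (snd z ^ k) \<partial>(F \<Otimes>\<^sub>M G))"
  proof (intro nn_integral_cong_AE eventually_mono[OF AE_FG])
    fix z :: "real \<times> real"
    obtain t b where z: "z = (t, b)" by fastforce
    have "exp (- (\<theta> * (b * t))) * exp (- (\<theta> * ((1 - b) * t))) = exp (- (\<theta> * t))"
      by (simp add: exp_add[symmetric] algebra_simps)
    then have "(b * t) ^ k * exp (- (\<theta> * (b * t))) * (((1 - b) * t) ^ 0 * exp (- (\<theta> * ((1 - b) * t))))
        = t ^ k * exp (- (\<theta> * t)) * b ^ k"
      by (simp add: power_mult_distrib mult_ac)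
    moreover assume "0 < fst z \<and> snd z \<in> {0..1}"
    ultimately show "?f (snd z * fst z) ((1 - snd z) * fst z)
        = ennreal (fst z ^ k * exp (- (\<theta> * fst z))) * ennreal (snd z ^ k)"
      by (simp add: z ennreal_mult'[symmetric] ennreal_mult''[symmetric])
  qed
  also have "\<dots> = (\<integral>\<^sup>+t. \<integral>\<^sup>+b. ennreal (t ^ k * exp (- (\<theta> * t))) * ennreal (b ^ k) \<partial>G \<partial>F)"
    by (subst G.nn_integral_fst[symmetric]) auto
  also have "\<dots> = (\<integral>\<^sup>+t. ennreal (t ^ k * exp (- (\<theta> * t))) \<partial>F) * (\<integral>\<^sup>+b. ennreal (b ^ k) \<partial>G)"
    by (simp add: nn_integral_cmult nn_integral_multc)
  also have "(\<integral>\<^sup>+b. ennreal (b ^ k) \<partial>G) = ennreal (\<integral>b. b ^ k \<partial>G)"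
    by (rule nn_integral_eq_integral[OF integrable_G_power]) (auto intro: eventually_mono[OF G(3)])
  finally show ?thesis
    unfolding FF.laplace_moment_eq[OF \<theta>, symmetric]
    using nonneg by (simp add: ennreal_mult'[symmetric] mult.commute)
qed

text \<open>
  Let \<open>D n\<close> and \<open>U n\<close> be the expectations of \<open>t ^ n * exp (- (\<theta> * t))\<close> under \<open>F\<close> and under the law \<open>A\<close> of
  the left part, let \<open>V\<close> be the Laplace transform of the right part, and let \<open>r\<close> and \<open>m\<close> be the first two
  moments of \<open>b\<close>. Then \<open>U 0 * V = D 0\<close>, \<open>U 1 * V = r * D 1\<close> and \<open>U 2 * V = m * D 2\<close>. Eliminating \<open>V\<close>, one
  gets \<open>U 1 / U 0 = r * (D 1 / D 0)\<close>, and differentiating this relation gives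
  \<open>(r - m) * (D 2 / D 0) = (r - r\<^sup>2) * (D 1 / D 0)\<^sup>2\<close>.
  
  If \<open>m = r\<close>, then \<open>r\<close> is 0 or 1 and \<open>b\<close> is degenerate at this value. Otherwise the equation says that
  \<open>D 0 / D 1\<close> has the constant derivative \<open>\<kappa> = (m - r\<^sup>2) / (r - m)\<close>, so that \<open>ln (D 0)\<close> is minus a primitive
  of \<open>1 / (\<kappa> * \<theta> + c)\<close>. For \<open>\<kappa> = 0\<close> this is the transform of a point mass, and \<open>b\<close> has variance 0; for
  \<open>\<kappa> > 0\<close> it is the transform of a gamma distribution with shape \<open>1 / \<kappa>\<close> and rate \<open>c / \<kappa>\<close>. The relation
  between \<open>U 1 / U 0\<close> and \<open>D 1 / D 0\<close> then makes \<open>U 0\<close> the power \<open>r\<close> of \<open>D 0\<close>.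
\<close>

theorem lukacs:
  assumes L: "parts_law F G = A \<Otimes>\<^sub>M B" and A: "prob_space A" "sets A = sets borel"
    and B: "prob_space B" "sets B = sets borel"
  shows "G = return borel 0 \<or> G = return borel 1
    \<or> (\<exists>s r. 0 < s \<and> 0 \<le> r \<and> r \<le> 1 \<and> F = return borel s \<and> G = return borel r)
    \<or> (\<exists>\<alpha> \<gamma> r. 0 < \<alpha> \<and> 0 < \<gamma> \<and> 0 < r \<and> r < 1 \<and> (\<forall>\<theta>>0.
          laplace_moment F 0 \<theta> = (\<gamma> / (\<gamma> + \<theta>)) powr \<alpha>
        \<and> laplace_moment A 0 \<theta> = (\<gamma> / (\<gamma> + \<theta>)) powr (r * \<alpha>)
        \<and> laplace_moment B 0 \<theta> = (\<gamma> / (\<gamma> + \<theta>)) powr ((1 - r) * \<alpha>)))"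
proof -
  interpret A: nonneg_prob A by (rule AE_factors_nonneg[OF L A B])
  interpret B: nonneg_prob B by (rule AE_factors_nonneg[OF L A B])
  define r where "r = (\<integral>b. b \<partial>G)"
  define m where "m = (\<integral>b. b\<^sup>2 \<partial>G)"
  define D where "D = laplace_moment F"
  define U where "U = laplace_moment A"
  define V where "V = laplace_moment B 0"
  have int: "integrable G (\<lambda>b. b)" "integrable G (\<lambda>b. b\<^sup>2)"
    using integrable_G_power[of 1] integrable_G_power[of 2] by simp_all
  note One_nat_def[simp del]
  have D_deriv: "(D 0 has_real_derivative - D 1 \<theta>) (at \<theta>)" "(D 1 has_real_derivative - D 2 \<theta>) (at \<theta>)"
    if "0 < \<theta>" for \<theta>
    using FF.laplace_moment_deriv[OF that, of 0] FF.laplace_moment_deriv[OF that, of 1]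
    unfolding D_def numeral_2_eq_2 One_nat_def by auto
  have U_deriv: "(U 0 has_real_derivative - U 1 \<theta>) (at \<theta>)" "(U 1 has_real_derivative - U 2 \<theta>) (at \<theta>)"
    if "0 < \<theta>" for \<theta>
    using A.laplace_moment_deriv[OF that, of 0] A.laplace_moment_deriv[OF that, of 1]
    unfolding U_def numeral_2_eq_2 One_nat_def by auto
  have pos: "0 < D 0 \<theta>" "0 < U 0 \<theta>" "0 < V \<theta>" if "0 < \<theta>" for \<theta>
    using that by (auto simp: D_def U_def V_def FF.laplace_moment_0_pos A.laplace_moment_0_pos B.laplace_moment_0_pos)
  have D1: "0 < D 1 \<theta>" if \<theta>: "0 < \<theta>" for \<theta>
  proof -
    have "(\<integral>x. x ^ 1 * exp (- (\<theta> * x)) \<partial>F) \<noteq> 0"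
    proof
      assume "(\<integral>x. x ^ 1 * exp (- (\<theta> * x)) \<partial>F) = 0"
      then have "AE x in F. x ^ 1 * exp (- (\<theta> * x)) = 0"
        by (subst (asm) integral_nonneg_eq_0_iff_AE[OF FF.integrable_laplace_moment[OF \<theta>]])
           (auto intro!: eventually_mono[OF F(3)])
      then have "AE x in F. False" using F(3) by eventually_elim auto
      then show False using F.AE_False by simp
    qed
    moreover have "0 \<le> (\<integral>x. x ^ 1 * exp (- (\<theta> * x)) \<partial>F)"
      by (rule integral_nonneg_AE) (auto intro!: eventually_mono[OF F(3)])
    ultimately show ?thesis unfolding D_def laplace_moment_def by linarith
  qed
  have rel: "U 0 \<theta> * V \<theta> = D 0 \<theta>" "U 1 \<theta> * V \<theta> = r * D 1 \<theta>" "U 2 \<theta> * V \<theta> = m * D 2 \<theta>" if "0 < \<theta>" for \<theta>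
    using factor_moments[OF L A B that, of 0] factor_moments[OF L A B that, of 1] factor_moments[OF L A B that, of 2]
    using G.prob_space by (simp_all add: U_def V_def D_def r_def m_def)
  have ratio: "U 1 \<theta> / U 0 \<theta> = r * (D 1 \<theta> / D 0 \<theta>)" "U 2 \<theta> / U 0 \<theta> = m * (D 2 \<theta> / D 0 \<theta>)" if "0 < \<theta>" for \<theta>
  proof -
    have "U 1 \<theta> / U 0 \<theta> = (U 1 \<theta> * V \<theta>) / (U 0 \<theta> * V \<theta>)" "U 2 \<theta> / U 0 \<theta> = (U 2 \<theta> * V \<theta>) / (U 0 \<theta> * V \<theta>)"
      using pos(3)[OF that] by (simp_all only: mult_divide_mult_cancel_right less_imp_neq[symmetric] not_False_eq_True)
    then show "U 1 \<theta> / U 0 \<theta> = r * (D 1 \<theta> / D 0 \<theta>)" "U 2 \<theta> / U 0 \<theta> = m * (D 2 \<theta> / D 0 \<theta>)"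
      by (simp_all only: rel[OF that] times_divide_eq_right)
  qed
  have ode: "(r - m) * (D 2 \<theta> / D 0 \<theta>) = (r - r\<^sup>2) * (D 1 \<theta> / D 0 \<theta>)\<^sup>2" if \<theta>: "0 < \<theta>" for \<theta>
  proof -
    have "((\<lambda>\<theta>. U 1 \<theta> / U 0 \<theta>) has_real_derivative ((- U 2 \<theta>) * U 0 \<theta> - U 1 \<theta> * (- U 1 \<theta>)) / (U 0 \<theta> * U 0 \<theta>)) (at \<theta>)"
      using U_deriv[OF \<theta>] pos(2)[OF \<theta>]
      by (intro DERIV_divide) auto
    then have "((\<lambda>\<theta>. r * (D 1 \<theta> / D 0 \<theta>)) has_real_derivative ((- U 2 \<theta>) * U 0 \<theta> - U 1 \<theta> * (- U 1 \<theta>)) / (U 0 \<theta> * U 0 \<theta>)) (at \<theta>)"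
      by (rule has_field_derivative_transform_within_open[where S="{0<..}"]) (use \<theta> in \<open>auto simp: ratio\<close>)
    moreover have "((\<lambda>\<theta>. r * (D 1 \<theta> / D 0 \<theta>)) has_real_derivative r * (((- D 2 \<theta>) * D 0 \<theta> - D 1 \<theta> * (- D 1 \<theta>)) / (D 0 \<theta> * D 0 \<theta>))) (at \<theta>)"
      using D_deriv[OF \<theta>] pos(1)[OF \<theta>]
      by (intro DERIV_cmult DERIV_divide) auto
    ultimately have "((- U 2 \<theta>) * U 0 \<theta> - U 1 \<theta> * (- U 1 \<theta>)) / (U 0 \<theta> * U 0 \<theta>) = r * (((- D 2 \<theta>) * D 0 \<theta> - D 1 \<theta> * (- D 1 \<theta>)) / (D 0 \<theta> * D 0 \<theta>))"
      by (rule DERIV_unique)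
    moreover have quotient: "((- z) * x - y * (- y)) / (x * x) = - (z / x) + (y / x)\<^sup>2" if "0 < x" for x y z :: real
      using that by (simp add: field_simps power2_eq_square)
    ultimately have "- (m * (D 2 \<theta> / D 0 \<theta>)) + (r * (D 1 \<theta> / D 0 \<theta>))\<^sup>2 = r * (- (D 2 \<theta> / D 0 \<theta>) + (D 1 \<theta> / D 0 \<theta>)\<^sup>2)"
      by (simp only: ratio[OF \<theta>] quotient[OF pos(1)[OF \<theta>]] quotient[OF pos(2)[OF \<theta>]])
    moreover have "(r - m) * q = (r - r\<^sup>2) * v\<^sup>2" if "- (m * q) + (r * v)\<^sup>2 = r * (- q + v\<^sup>2)" for q v
      using that by (simp add: power_mult_distrib algebra_simps)
    ultimately show ?thesis by blast
  qed
  have r01: "0 \<le> r" "r \<le> 1"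
  proof -
    show "0 \<le> r" unfolding r_def by (rule integral_nonneg_AE) (auto intro: eventually_mono[OF G(3)])
    have "r \<le> (\<integral>b. 1 \<partial>G)" unfolding r_def
      by (rule integral_mono_AE[OF int(1)]) (auto intro: eventually_mono[OF G(3)])
    then show "r \<le> 1" by simp
  qed
  have "m \<le> r" unfolding m_def r_def
    by (rule integral_mono_AE[OF int(2,1)])
       (rule eventually_mono[OF G(3)], simp add: power2_eq_square mult_left_le)
  have var: "(\<integral>b. (b - r)\<^sup>2 \<partial>G) = m - r\<^sup>2"
  proof -
    have "(\<integral>b. (b - r)\<^sup>2 \<partial>G) = (\<integral>b. b\<^sup>2 + (- 2 * r) * b + r\<^sup>2 \<partial>G)"
      by (intro Bochner_Integration.integral_cong refl) (simp add: power2_eq_square algebra_simps)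
    also have "\<dots> = (\<integral>b. b\<^sup>2 + (- 2 * r) * b \<partial>G) + (\<integral>b. r\<^sup>2 \<partial>G)"
      by (intro Bochner_Integration.integral_add Bochner_Integration.integrable_add integrable_mult_right int) simp
    also have "(\<integral>b. b\<^sup>2 + (- 2 * r) * b \<partial>G) = m + (\<integral>b. (- 2 * r) * b \<partial>G)"
      unfolding m_def by (intro Bochner_Integration.integral_add integrable_mult_right int)
    also have "(\<integral>b. (- 2 * r) * b \<partial>G) = (- 2 * r) * r"
      unfolding integral_mult_right_zero by (simp only: r_def)
    also have "(\<integral>b. r\<^sup>2 \<partial>G) = r\<^sup>2" by simp
    finally show ?thesis by (simp add: power2_eq_square)
  qed
  have "0 \<le> (\<integral>b. (b - r)\<^sup>2 \<partial>G)" by simp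
  then have "0 \<le> m - r\<^sup>2" by (simp only: var)
  show ?thesis
  proof (cases "m = r")
    case True
    have "0 < (D 1 1 / D 0 1)\<^sup>2" using pos(1)[of 1] D1[of 1] by simp
    then have "r - r\<^sup>2 = 0" using ode[of 1] True by simp
    then have "r * (1 - r) = 0" by (simp add: power2_eq_square algebra_simps)
    then consider "r = 0" | "r = 1" by auto
    then show ?thesis
    proof cases
      case 1
      then have "AE b in G. b = 0"
        using integral_nonneg_eq_0_iff_AE[OF int(1)] eventually_mono[OF G(3), of "\<lambda>b. 0 \<le> b"]
        by (simp add: r_def)
      then show ?thesis using eq_return_if_AE_const[OF G(1,2)] by simp
    next
      case 2
      have i: "integrable G (\<lambda>b. 1 - b)" using int by simp
      have "(\<integral>b. 1 - b \<partial>G) = 0" using int 2 by (simp add: r_def)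
      then have "AE b in G. 1 - b = 0"
        using integral_nonneg_eq_0_iff_AE[OF i] eventually_mono[OF G(3), of "\<lambda>b. 0 \<le> 1 - b"]
        by simp
      then have "AE b in G. b = 1" by eventually_elim simp
      then show ?thesis using eq_return_if_AE_const[OF G(1,2)] by simp
    qed
  next
    case False
    with \<open>m \<le> r\<close> have mr: "0 < r - m" by simp
    define \<kappa> where "\<kappa> = (m - r\<^sup>2) / (r - m)"
    have \<kappa>: "0 \<le> \<kappa>" unfolding \<kappa>_def using \<open>0 \<le> m - r\<^sup>2\<close> mr by simp
    have inv_deriv: "((\<lambda>\<theta>. D 0 \<theta> / D 1 \<theta>) has_real_derivative \<kappa>) (at \<theta>)" if \<theta>: "0 < \<theta>" for \<theta>
    proof -
      have "((\<lambda>\<theta>. D 0 \<theta> / D 1 \<theta>) has_real_derivative ((- D 1 \<theta>) * D 1 \<theta> - D 0 \<theta> * (- D 2 \<theta>)) / (D 1 \<theta> * D 1 \<theta>)) (at \<theta>)"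
        using D_deriv[OF \<theta>] D1[OF \<theta>]
        by (intro DERIV_divide) auto
      moreover have "((- D 1 \<theta>) * D 1 \<theta> - D 0 \<theta> * (- D 2 \<theta>)) / (D 1 \<theta> * D 1 \<theta>) = \<kappa>"
      proof -
        have "D 0 \<theta> * D 2 \<theta> / (D 1 \<theta> * D 1 \<theta>) = (D 2 \<theta> / D 0 \<theta>) / (D 1 \<theta> / D 0 \<theta>)\<^sup>2"
          using pos(1)[OF \<theta>] D1[OF \<theta>] by (simp add: field_simps power2_eq_square)
        also have "\<dots> = (r - r\<^sup>2) / (r - m)"
        proof -
          have "q / w = a / b" if "b * q = a * w" "0 < w" "0 < b" for a b q w :: real
            using that by (simp add: frac_eq_eq mult.commute)
          from this[OF ode[OF \<theta>] zero_less_power[OF divide_pos_pos[OF D1[OF \<theta>] pos(1)[OF \<theta>]]] mr] show ?thesis .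
        qed
        finally have "D 0 \<theta> * D 2 \<theta> / (D 1 \<theta> * D 1 \<theta>) = (r - r\<^sup>2) / (r - m)" .
        moreover have quotient: "((- x) * x - y * (- z)) / (x * x) = y * z / (x * x) - 1" if "0 < x" for x y z :: real
          using that by (simp add: field_simps)
        ultimately have "((- D 1 \<theta>) * D 1 \<theta> - D 0 \<theta> * (- D 2 \<theta>)) / (D 1 \<theta> * D 1 \<theta>) = (r - r\<^sup>2) / (r - m) - 1"
          unfolding quotient[OF D1[OF \<theta>]] by simp
        also have "\<dots> = \<kappa>" unfolding \<kappa>_def using mr by (simp add: field_simps)
        finally show ?thesis .
      qed
      ultimately show ?thesis by simp
    qed
    have inv_const: "\<forall>\<theta>>0. ((\<lambda>\<theta>. D 0 \<theta> / D 1 \<theta> - \<kappa> * \<theta>) has_real_derivative 0) (at \<theta>)"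
      using DERIV_diff[OF inv_deriv DERIV_cmult_Id[of \<kappa>]] by simp
    obtain c where c': "\<forall>\<theta>>0. D 0 \<theta> / D 1 \<theta> - \<kappa> * \<theta> = c"
      using constant_on_positive_if_derivative_0[OF inv_const] ..
    have c: "D 0 \<theta> / D 1 \<theta> = \<kappa> * \<theta> + c" if "0 < \<theta>" for \<theta>
      using c'[rule_format, OF that] by linarith
    have cpos: "0 < \<kappa> * \<theta> + c" if "0 < \<theta>" for \<theta>
      using c[OF that] pos(1)[OF that] D1[OF that] by (metis divide_pos_pos)
    have D01: "D 1 \<theta> / D 0 \<theta> = 1 / (\<kappa> * \<theta> + c)" if "0 < \<theta>" for \<theta>
      using c[OF that] by (metis inverse_divide inverse_eq_divide)
    have lnD: "((\<lambda>\<theta>. ln (D 0 \<theta>)) has_real_derivative - (1 / (\<kappa> * \<theta> + c))) (at \<theta>)" if \<theta>: "0 < \<theta>" for \<theta>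
      using has_derivative_ln_comp[OF D_deriv(1)[OF \<theta>] pos(1)[OF \<theta>]] D01[OF \<theta>] by simp
    have lnU: "((\<lambda>\<theta>. ln (U 0 \<theta>)) has_real_derivative r * (- (1 / (\<kappa> * \<theta> + c)))) (at \<theta>)" if \<theta>: "0 < \<theta>" for \<theta>
      using has_derivative_ln_comp[OF U_deriv(1)[OF \<theta>] pos(2)[OF \<theta>]] ratio(1)[OF \<theta>] D01[OF \<theta>] by simp
    have limD: "(\<lambda>n. ln (D 0 (1 / real (Suc n)))) \<longlonglongrightarrow> 0"
      using tendsto_ln[OF FF.laplace_moment_0_limit] by (simp add: D_def)
    have limU: "(\<lambda>n. ln (U 0 (1 / real (Suc n)))) \<longlonglongrightarrow> 0"
      using tendsto_ln[OF A.laplace_moment_0_limit] by (simp add: U_def)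
    show ?thesis
    proof (cases "\<kappa> = 0")
      case True
      then have "m - r\<^sup>2 = 0" using mr by (simp add: \<kappa>_def)
      with var have "(\<integral>b. (b - r)\<^sup>2 \<partial>G) = 0" by simp
      moreover have "integrable G (\<lambda>b. (b - r)\<^sup>2)"
        using int by (simp add: power2_diff)
      ultimately have "AE b in G. (b - r)\<^sup>2 = 0"
        by (subst (asm) integral_nonneg_eq_0_iff_AE) auto
      then have "AE b in G. b = r" by eventually_elim simp
      then have "G = return borel r" by (rule eq_return_if_AE_const[OF G(1,2)])
      moreover have c0: "0 < c" using cpos[of 1] True by simp
      moreover have "F = return borel (1 / c)"
      proof (rule eq_if_laplace_moment_0_eq)
        show "nonneg_prob (return borel (1 / c))"
          using c0 by (intro nonneg_prob.intro prob_space_return) (simp_all add: AE_return)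
        fix \<theta> :: real assume \<theta>: "0 < \<theta>"
        have "ln (D 0 \<theta>) + \<theta> / c = 0"
        proof (rule equals_limit_if_derivative_0[OF _ _ \<theta>])
          show "\<forall>x>0. ((\<lambda>\<theta>. ln (D 0 \<theta>) + \<theta> / c) has_real_derivative 0) (at x)"
            using DERIV_add[OF lnD DERIV_cdivide[OF DERIV_ident, of c]] True by simp
          have "(\<lambda>n. ln (D 0 (1 / real (Suc n))) + (1 / real (Suc n)) / c) \<longlonglongrightarrow> 0 + 0 / c"
            by (intro tendsto_intros limD LIMSEQ_Suc[OF lim_1_over_n]) (use c0 in simp)
          then show "(\<lambda>n. ln (D 0 (1 / real (Suc n))) + (1 / real (Suc n)) / c) \<longlonglongrightarrow> 0" by simp
        qed
        then have "D 0 \<theta> = exp (- (\<theta> / c))" using pos(1)[OF \<theta>] by (metis add_eq_0_iff2 exp_ln)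
        then show "laplace_moment F 0 \<theta> = laplace_moment (return borel (1 / c)) 0 \<theta>"
          by (simp add: D_def laplace_moment_def integral_return)
      qed (rule FF.nonneg_prob_axioms)
      ultimately have "\<exists>s r. 0 < s \<and> 0 \<le> r \<and> r \<le> 1 \<and> F = return borel s \<and> G = return borel r"
        using r01 by (intro exI[of _ "1 / c"] exI[of _ r]) simp
      then show ?thesis by (intro disjI2 disjI1)
    next
      case False
      with \<kappa> have \<kappa>0: "0 < \<kappa>" by simp
      have lnD': "\<forall>\<theta>>0. ((\<lambda>\<theta>. ln (D 0 \<theta>) + ln (\<kappa> * \<theta> + c) / \<kappa>) has_real_derivative 0) (at \<theta>)"
      proof (intro allI impI)
        fix \<theta> :: real assume \<theta>: "0 < \<theta>"
        have "((\<lambda>\<theta>. ln (\<kappa> * \<theta> + c) / \<kappa>) has_real_derivative 1 / (\<kappa> * \<theta> + c)) (at \<theta>)"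
          using cpos[OF \<theta>] \<kappa>0 by (auto intro!: derivative_eq_intros)
        from DERIV_add[OF lnD[OF \<theta>] this]
        show "((\<lambda>\<theta>. ln (D 0 \<theta>) + ln (\<kappa> * \<theta> + c) / \<kappa>) has_real_derivative 0) (at \<theta>)" by simp
      qed
      have c0: "0 < c"
      proof (rule ccontr)
        assume "\<not> 0 < c"
        moreover have "0 \<le> c"
        proof (rule ccontr)
          assume "\<not> 0 \<le> c"
          then show False using cpos[of "- c / (2 * \<kappa>)"] \<kappa>0 divide_neg_pos[of c "2 * \<kappa>"] by simp
        qed
        ultimately have c: "c = 0" by simp
        obtain C where C: "\<forall>\<theta>>0. ln (D 0 \<theta>) + ln (\<kappa> * \<theta> + c) / \<kappa> = C"
          using constant_on_positive_if_derivative_0[OF lnD'] ..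
        \<comment> \<open>For \<open>c = 0\<close> the transform would be unbounded near 0; this argument makes its logarithm equal to \<open>1 / \<kappa>\<close>.\<close>
        define \<theta> where "\<theta> = exp (\<kappa> * C - 1) / \<kappa>"
        have \<theta>: "0 < \<theta>" using \<kappa>0 by (simp add: \<theta>_def)
        have "ln (\<kappa> * \<theta> + c) / \<kappa> = C - 1 / \<kappa>" using \<kappa>0 by (simp add: \<theta>_def c field_simps)
        with C[rule_format, OF \<theta>] have "ln (D 0 \<theta>) = 1 / \<kappa>" by simp
        moreover have "ln (D 0 \<theta>) \<le> 0" using FF.laplace_moment_0_le[OF \<theta>] pos(1)[OF \<theta>] by (simp add: D_def)
        ultimately show False using \<kappa>0 by simp
      qed
      define \<alpha> where "\<alpha> = 1 / \<kappa>"
      define \<gamma> where "\<gamma> = c / \<kappa>"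
      have ag: "0 < \<alpha>" "0 < \<gamma>" using \<kappa>0 c0 by (simp_all add: \<alpha>_def \<gamma>_def)
      have D0: "ln (D 0 \<theta>) = \<alpha> * ln (\<gamma> / (\<gamma> + \<theta>))" if \<theta>: "0 < \<theta>" for \<theta>
      proof -
        have "ln (D 0 \<theta>) + ln (\<kappa> * \<theta> + c) / \<kappa> = ln c / \<kappa>"
        proof (rule equals_limit_if_derivative_0[OF lnD' _ \<theta>])
          have "(\<lambda>n. ln (D 0 (1 / real (Suc n))) + ln (\<kappa> * (1 / real (Suc n)) + c) / \<kappa>) \<longlonglongrightarrow> 0 + ln (\<kappa> * 0 + c) / \<kappa>"
            by (intro tendsto_intros limD LIMSEQ_Suc[OF lim_1_over_n]) (use c0 \<kappa>0 in auto)
          then show "(\<lambda>n. ln (D 0 (1 / real (Suc n))) + ln (\<kappa> * (1 / real (Suc n)) + c) / \<kappa>) \<longlonglongrightarrow> ln c / \<kappa>" by simp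
        qed
        then have "ln (D 0 \<theta>) = \<alpha> * (ln c - ln (\<kappa> * \<theta> + c))" by (simp add: \<alpha>_def diff_divide_distrib)
        also have "ln c - ln (\<kappa> * \<theta> + c) = ln (c / (\<kappa> * \<theta> + c))"
          using c0 cpos[OF \<theta>] by (simp add: ln_div)
        also have "c / (\<kappa> * \<theta> + c) = \<gamma> / (\<gamma> + \<theta>)" using \<kappa>0 by (simp add: \<gamma>_def field_simps)
        finally show ?thesis .
      qed
      have U0: "ln (U 0 \<theta>) = r * ln (D 0 \<theta>)" if \<theta>: "0 < \<theta>" for \<theta>
      proof -
        have "ln (U 0 \<theta>) - r * ln (D 0 \<theta>) = 0"
        proof (rule equals_limit_if_derivative_0[OF _ _ \<theta>])
          show "\<forall>x>0. ((\<lambda>\<theta>. ln (U 0 \<theta>) - r * ln (D 0 \<theta>)) has_real_derivative 0) (at x)"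
            using DERIV_diff[OF lnU DERIV_cmult[OF lnD, of _ r]] by simp
          have "(\<lambda>n. ln (U 0 (1 / real (Suc n))) - r * ln (D 0 (1 / real (Suc n)))) \<longlonglongrightarrow> 0 - r * 0"
            by (intro tendsto_intros limD limU)
          then show "(\<lambda>n. ln (U 0 (1 / real (Suc n))) - r * ln (D 0 (1 / real (Suc n)))) \<longlonglongrightarrow> 0" by simp
        qed
        then show ?thesis by simp
      qed
      have V0: "ln (V \<theta>) = (1 - r) * ln (D 0 \<theta>)" if \<theta>: "0 < \<theta>" for \<theta>
      proof -
        have "ln (D 0 \<theta>) = ln (U 0 \<theta>) + ln (V \<theta>)"
          using pos[OF \<theta>] by (simp add: rel(1)[OF \<theta>, symmetric] ln_mult)
        then show ?thesis using U0[OF \<theta>] by (simp add: algebra_simps)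
      qed
      have rm: "0 < r" "r < 1"
      proof -
        show "0 < r" using mr \<open>0 \<le> m - r\<^sup>2\<close> by (smt (verit) zero_le_power2)
        have "r\<^sup>2 < r" using mr \<open>0 \<le> m - r\<^sup>2\<close> by simp
        then show "r < 1" using \<open>0 < r\<close> by (simp add: power2_eq_square)
      qed
      have powr: "x = y powr e" if "0 < x" "0 < y" "ln x = e * ln y" for x y e :: real
        using that by (metis exp_ln powr_def less_irrefl)
      have "D 0 \<theta> = (\<gamma> / (\<gamma> + \<theta>)) powr \<alpha> \<and> U 0 \<theta> = (\<gamma> / (\<gamma> + \<theta>)) powr (r * \<alpha>) \<and> V \<theta> = (\<gamma> / (\<gamma> + \<theta>)) powr ((1 - r) * \<alpha>)"
        if \<theta>: "0 < \<theta>" for \<theta>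
        using pos[OF \<theta>] ag \<theta> D0[OF \<theta>] U0[OF \<theta>] V0[OF \<theta>] by (intro conjI powr) auto
      then have "\<forall>\<theta>>0. laplace_moment F 0 \<theta> = (\<gamma> / (\<gamma> + \<theta>)) powr \<alpha>
        \<and> laplace_moment A 0 \<theta> = (\<gamma> / (\<gamma> + \<theta>)) powr (r * \<alpha>)
        \<and> laplace_moment B 0 \<theta> = (\<gamma> / (\<gamma> + \<theta>)) powr ((1 - r) * \<alpha>)"
        unfolding D_def U_def V_def by (intro allI impI)
      with ag rm have "\<exists>\<alpha> \<gamma> r. 0 < \<alpha> \<and> 0 < \<gamma> \<and> 0 < r \<and> r < 1 \<and> (\<forall>\<theta>>0.
          laplace_moment F 0 \<theta> = (\<gamma> / (\<gamma> + \<theta>)) powr \<alpha>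
        \<and> laplace_moment A 0 \<theta> = (\<gamma> / (\<gamma> + \<theta>)) powr (r * \<alpha>)
        \<and> laplace_moment B 0 \<theta> = (\<gamma> / (\<gamma> + \<theta>)) powr ((1 - r) * \<alpha>))"
        by (intro exI[of _ \<alpha>] exI[of _ \<gamma>] exI[of _ r] conjI)
      then show ?thesis by (intro disjI2)
    qed
  qed
qed

end

section \<open>Gamma and beta distributions\<close>

lemma nn_integral_gamma_kernel:
  assumes "0 < \<alpha>" "0 < c"
  shows "(\<integral>\<^sup>+x. ennreal (if 0 < x then x powr (\<alpha> - 1) * exp (- (c * x)) else 0) \<partial>lborel) = ennreal (Gamma \<alpha> / c powr \<alpha>)"
    (is "?I = _")
proof -
  have "ennreal (Gamma \<alpha>) = (\<integral>\<^sup>+t. ennreal (indicator {0..} t * t powr (\<alpha> - 1) / exp t) \<partial>lborel)"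
    by (rule Gamma_conv_nn_integral_real[OF assms(1)])
  also have "\<dots> = (\<integral>\<^sup>+t. ennreal (if 0 < t then t powr (\<alpha> - 1) * exp (- t) else 0) \<partial>lborel)"
    by (intro nn_integral_cong) (auto simp: indicator_def exp_minus divide_inverse)
  also have "\<dots> = ennreal c * (\<integral>\<^sup>+x. ennreal (if 0 < c * x then (c * x) powr (\<alpha> - 1) * exp (- (c * x)) else 0) \<partial>lborel)"
    using assms by (subst nn_integral_real_affine[where c=c and t=0]) (auto cong: if_cong)
  also have "(\<integral>\<^sup>+x. ennreal (if 0 < c * x then (c * x) powr (\<alpha> - 1) * exp (- (c * x)) else 0) \<partial>lborel)
      = (\<integral>\<^sup>+x. ennreal (c powr (\<alpha> - 1)) * ennreal (if 0 < x then x powr (\<alpha> - 1) * exp (- (c * x)) else 0) \<partial>lborel)"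
    using assms by (intro nn_integral_cong) (auto simp: ennreal_mult'[symmetric] powr_mult zero_less_mult_iff mult.assoc)
  also have "\<dots> = ennreal (c powr (\<alpha> - 1)) * ?I"
    by (rule nn_integral_cmult) simp
  also have "ennreal c * (ennreal (c powr (\<alpha> - 1)) * ?I) = ennreal (c powr \<alpha>) * ?I"
    using assms by (simp add: mult.assoc[symmetric] ennreal_mult'[symmetric] powr_diff)
  finally have "ennreal (Gamma \<alpha>) = ennreal (c powr \<alpha>) * ?I" .
  then have "ennreal (1 / c powr \<alpha>) * ennreal (Gamma \<alpha>) = (ennreal (1 / c powr \<alpha>) * ennreal (c powr \<alpha>)) * ?I"
    by (simp add: mult.assoc)
  also have "ennreal (1 / c powr \<alpha>) * ennreal (c powr \<alpha>) = 1"
    using assms by (simp add: ennreal_mult'[symmetric])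
  finally show ?thesis
    using assms by (simp add: ennreal_mult'[symmetric])
qed

lemma sets_gamma_distribution[simp, measurable_cong]: "sets (gamma_distribution \<alpha> \<gamma>) = sets borel"
  by (simp add: gamma_distribution_def)

lemma sets_beta_distribution[simp, measurable_cong]: "sets (beta_distribution p q) = sets borel"
  by (simp add: beta_distribution_def)

lemma space_gamma_beta[simp]: "space (gamma_distribution \<alpha> \<gamma>) = UNIV" "space (beta_distribution p q) = UNIV"
  by (simp_all add: gamma_distribution_def beta_distribution_def)

lemma nn_integral_exp_gamma_distribution:
  assumes "0 < \<alpha>" "0 < \<gamma>" "0 \<le> \<theta>"
  shows "(\<integral>\<^sup>+x. ennreal (exp (- (\<theta> * x))) \<partial>gamma_distribution \<alpha> \<gamma>) = ennreal ((\<gamma> / (\<gamma> + \<theta>)) powr \<alpha>)"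
proof -
  have G: "0 < Gamma \<alpha>" using assms by (simp add: Gamma_real_pos)
  then have G0: "Gamma \<alpha> \<noteq> 0" by linarith
  have "(\<integral>\<^sup>+x. ennreal (exp (- (\<theta> * x))) \<partial>gamma_distribution \<alpha> \<gamma>)
      = (\<integral>\<^sup>+x. ennreal (\<gamma> powr \<alpha> / Gamma \<alpha>) * ennreal (if 0 < x then x powr (\<alpha> - 1) * exp (- ((\<gamma> + \<theta>) * x)) else 0) \<partial>lborel)"
    unfolding gamma_distribution_def using G
    by (subst nn_integral_density)
       (auto intro!: nn_integral_cong simp: ennreal_mult'[symmetric] ennreal_mult''[symmetric] exp_add[symmetric] algebra_simps)
  also have "\<dots> = ennreal (\<gamma> powr \<alpha> / Gamma \<alpha>) * ennreal (Gamma \<alpha> / (\<gamma> + \<theta>) powr \<alpha>)"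
    using nn_integral_gamma_kernel[of \<alpha> "\<gamma> + \<theta>"] assms by (simp add: nn_integral_cmult G0)
  also have "\<dots> = ennreal ((\<gamma> / (\<gamma> + \<theta>)) powr \<alpha>)"
    using G assms by (simp add: ennreal_mult''[symmetric] powr_divide G0)
  finally show ?thesis .
qed

lemma gamma_distribution_nonneg_prob:
  assumes "0 < \<alpha>" "0 < \<gamma>"
  shows "nonneg_prob (gamma_distribution \<alpha> \<gamma>)"
proof (rule nonneg_prob.intro)
  show "prob_space (gamma_distribution \<alpha> \<gamma>)"
    using nn_integral_exp_gamma_distribution[of \<alpha> \<gamma> 0] assms by (intro prob_spaceI) simp
  show "AE x in gamma_distribution \<alpha> \<gamma>. 0 \<le> x"
    unfolding gamma_distribution_def by (subst AE_density) auto
qed simp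

lemma laplace_moment_gamma_distribution:
  assumes "0 < \<alpha>" "0 < \<gamma>" "0 < \<theta>"
  shows "laplace_moment (gamma_distribution \<alpha> \<gamma>) 0 \<theta> = (\<gamma> / (\<gamma> + \<theta>)) powr \<alpha>"
proof -
  interpret nonneg_prob "gamma_distribution \<alpha> \<gamma>" by (rule gamma_distribution_nonneg_prob[OF assms(1,2)])
  have "ennreal (laplace_moment (gamma_distribution \<alpha> \<gamma>) 0 \<theta>) = ennreal ((\<gamma> / (\<gamma> + \<theta>)) powr \<alpha>)"
    using nn_integral_exp_gamma_distribution[of \<alpha> \<gamma> \<theta>] assms by (simp add: laplace_moment_eq)
  then show ?thesis
    using laplace_moment_0_pos[OF assms(3)] by (subst (asm) ennreal_inj) auto
qed

text \<open>
  Substituting \<open>y = b * t\<close> for fixed \<open>t\<close> turns the product of the gamma and the beta density into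
  \<open>d p y * d q (t - y)\<close>, where \<open>d \<alpha>\<close> is the gamma density with shape \<open>\<alpha>\<close>: the powers of \<open>t\<close> cancel because
  the shape of the whole interval is \<open>p + q\<close>. The substitution \<open>t = y + x\<close> then separates the variables.
\<close>

lemma nn_integral_parts_law_gamma_beta:
  assumes p: "0 < p" and q: "0 < q" and \<gamma>: "0 < \<gamma>"
    and g[measurable]: "g \<in> borel_measurable (borel \<Otimes>\<^sub>M borel)"
  shows "(\<integral>\<^sup>+t. \<integral>\<^sup>+b. g (b * t, (1 - b) * t) \<partial>beta_distribution p q \<partial>gamma_distribution (p + q) \<gamma>)
    = (\<integral>\<^sup>+y. \<integral>\<^sup>+x. g (y, x) \<partial>gamma_distribution q \<gamma> \<partial>gamma_distribution p \<gamma>)"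
proof -
  define d where "d \<alpha> x = ennreal (if 0 < x then \<gamma> powr \<alpha> / Gamma \<alpha> * x powr (\<alpha> - 1) * exp (- \<gamma> * x) else 0)" for \<alpha> x
  define e where "e x = ennreal (if 0 < x \<and> x < 1 then Gamma (p + q) / (Gamma p * Gamma q) * x powr (p - 1) * (1 - x) powr (q - 1) else 0)" for x
  have [measurable]: "d \<alpha> \<in> borel_measurable borel" "e \<in> borel_measurable borel" for \<alpha>
    unfolding d_def e_def by measurable
  have gam: "gamma_distribution \<alpha> \<gamma> = density lborel (d \<alpha>)" for \<alpha>
    unfolding gamma_distribution_def d_def ..
  have bet: "beta_distribution p q = density lborel e"
    unfolding beta_distribution_def e_def ..
  have G: "0 < Gamma p" "0 < Gamma q" "0 < Gamma (p + q)" using p q by (simp_all add: Gamma_real_pos)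
  have dens: "d (p + q) t * (ennreal (1 / t) * e (y / t)) = d p y * d q (t - y)" if t: "0 < t" for t y
  proof (cases "0 < y \<and> y < t")
    case True
    have "\<gamma> powr (p + q) / Gamma (p + q) * t powr (p + q - 1) * exp (- \<gamma> * t) *
       (1 / t * (Gamma (p + q) / (Gamma p * Gamma q) * (y / t) powr (p - 1) * (1 - y / t) powr (q - 1)))
       = \<gamma> powr p / Gamma p * y powr (p - 1) * exp (- \<gamma> * y) * (\<gamma> powr q / Gamma q * (t - y) powr (q - 1) * exp (- \<gamma> * (t - y)))"
    proof -
      have 1: "1 - y / t = (t - y) / t" using t by (simp add: field_simps)
      have 2: "exp (- \<gamma> * t) = exp (- \<gamma> * y) * exp (- \<gamma> * (t - y))" by (simp add: exp_add[symmetric] algebra_simps)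
      have 3: "t powr (p + q - 1) = t * (t powr (p - 1) * t powr (q - 1))"
        using t by (simp add: powr_add[symmetric] powr_mult_base)
      show ?thesis
        unfolding 1 2 3 using t True G by (simp add: powr_divide powr_add field_simps)
    qed
    then show ?thesis using t True G by (simp add: d_def e_def ennreal_mult'[symmetric] ennreal_mult''[symmetric])
  next
    case False
    then show ?thesis using t by (auto simp: d_def e_def zero_less_divide_iff divide_less_eq)
  qed
  have "(\<integral>\<^sup>+t. \<integral>\<^sup>+b. g (b * t, (1 - b) * t) \<partial>beta_distribution p q \<partial>gamma_distribution (p + q) \<gamma>)
     = (\<integral>\<^sup>+t. d (p + q) t * (\<integral>\<^sup>+b. e b * g (b * t, (1 - b) * t) \<partial>lborel) \<partial>lborel)"
    unfolding gam bet by (simp add: nn_integral_density)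
  also have "\<dots> = (\<integral>\<^sup>+t. \<integral>\<^sup>+y. d p y * d q (t - y) * g (y, t - y) \<partial>lborel \<partial>lborel)"
  proof (rule nn_integral_cong)
    fix t :: real
    show "d (p + q) t * (\<integral>\<^sup>+b. e b * g (b * t, (1 - b) * t) \<partial>lborel) = (\<integral>\<^sup>+y. d p y * d q (t - y) * g (y, t - y) \<partial>lborel)"
    proof (cases "0 < t")
      case True
      have "(\<integral>\<^sup>+b. e b * g (b * t, (1 - b) * t) \<partial>lborel) = ennreal (1 / t) * (\<integral>\<^sup>+y. e (y / t) * g (y, t - y) \<partial>lborel)"
        using True by (subst nn_integral_real_affine[where c="1 / t" and t=0]) (auto simp: algebra_simps intro!: arg_cong[where f="\<lambda>x. _ * x"] nn_integral_cong)
      then have "d (p + q) t * (\<integral>\<^sup>+b. e b * g (b * t, (1 - b) * t) \<partial>lborel)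
         = (\<integral>\<^sup>+y. (d (p + q) t * (ennreal (1 / t) * e (y / t))) * g (y, t - y) \<partial>lborel)"
        by (simp add: nn_integral_cmult[symmetric] mult.assoc)
      then show ?thesis by (simp only: dens[OF True])
    next
      case False
      then have zero: "d (p + q) t = 0" "d p y * d q (t - y) = 0" for y by (auto simp: d_def)
      show ?thesis unfolding zero by simp
    qed
  qed
  also have "\<dots> = (\<integral>\<^sup>+y. \<integral>\<^sup>+t. d p y * d q (t - y) * g (y, t - y) \<partial>lborel \<partial>lborel)"
    by (rule lborel_pair.Fubini') simp
  also have "\<dots> = (\<integral>\<^sup>+y. \<integral>\<^sup>+x. d p y * d q x * g (y, x) \<partial>lborel \<partial>lborel)"
  proof (rule nn_integral_cong)
    fix y :: real
    show "(\<integral>\<^sup>+t. d p y * d q (t - y) * g (y, t - y) \<partial>lborel) = (\<integral>\<^sup>+x. d p y * d q x * g (y, x) \<partial>lborel)"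
      by (subst nn_integral_real_affine[where c=1 and t=y]) simp_all
  qed
  also have "\<dots> = (\<integral>\<^sup>+y. d p y * (\<integral>\<^sup>+x. d q x * g (y, x) \<partial>lborel) \<partial>lborel)"
    by (simp add: nn_integral_cmult mult.assoc)
  also have "\<dots> = (\<integral>\<^sup>+y. \<integral>\<^sup>+x. g (y, x) \<partial>gamma_distribution q \<gamma> \<partial>gamma_distribution p \<gamma>)"
    unfolding gam bet by (simp add: nn_integral_density)
  finally show ?thesis .
qed

lemma AE_beta_distribution: "AE x in beta_distribution p q. x \<in> {0..1}"
  unfolding beta_distribution_def by (subst AE_density) auto

text \<open>
  The normalisation of the beta density is the total mass in the preceding identity.
\<close>

lemma prob_space_beta_distribution:
  assumes "0 < p" "0 < q"
  shows "prob_space (beta_distribution p q)"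
proof (rule prob_spaceI)
  interpret A: nonneg_prob "gamma_distribution p 1" by (rule gamma_distribution_nonneg_prob) (use assms in auto)
  interpret B: nonneg_prob "gamma_distribution q 1" by (rule gamma_distribution_nonneg_prob) (use assms in auto)
  interpret C: nonneg_prob "gamma_distribution (p + q) 1" by (rule gamma_distribution_nonneg_prob) (use assms in auto)
  show "emeasure (beta_distribution p q) (space (beta_distribution p q)) = 1"
    using nn_integral_parts_law_gamma_beta[of p q 1 "\<lambda>_. 1"] assms
      A.emeasure_space_1 B.emeasure_space_1 C.emeasure_space_1 by simp
qed

lemma parts_law_gamma_beta:
  assumes p: "0 < p" and q: "0 < q" and \<gamma>: "0 < \<gamma>"
  shows "parts_law (gamma_distribution (p + q) \<gamma>) (beta_distribution p q)
    = gamma_distribution p \<gamma> \<Otimes>\<^sub>M gamma_distribution q \<gamma>" (is "?L = ?R")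
proof (rule measure_eqI)
  interpret B: nonneg_prob "gamma_distribution q \<gamma>" by (rule gamma_distribution_nonneg_prob) (use assms in auto)
  interpret beta: prob_space "beta_distribution p q" by (rule prob_space_beta_distribution[OF p q])
  show "sets ?L = sets ?R"
    by (simp add: parts_law_def cong: sets_pair_measure_cong)
  fix A assume "A \<in> sets ?L"
  then have [measurable]: "A \<in> sets (borel \<Otimes>\<^sub>M borel)" by (simp add: parts_law_def)
  have R: "A \<in> sets ?R" using \<open>sets ?L = sets ?R\<close> \<open>A \<in> sets ?L\<close> by simp
  have "emeasure ?L A = (\<integral>\<^sup>+z. indicator A z \<partial>?L)"
    using \<open>A \<in> sets ?L\<close> by simp
  also have "\<dots> = (\<integral>\<^sup>+z. indicator A (snd z * fst z, (1 - snd z) * fst z) \<partial>(gamma_distribution (p + q) \<gamma> \<Otimes>\<^sub>M beta_distribution p q))"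
    unfolding parts_law_def by (subst nn_integral_distr) (auto simp: split_beta')
  also have "\<dots> = (\<integral>\<^sup>+t. \<integral>\<^sup>+b. indicator A (b * t, (1 - b) * t) \<partial>beta_distribution p q \<partial>gamma_distribution (p + q) \<gamma>)"
    by (subst beta.nn_integral_fst[symmetric]) auto
  also have "\<dots> = (\<integral>\<^sup>+y. \<integral>\<^sup>+x. indicator A (y, x) \<partial>gamma_distribution q \<gamma> \<partial>gamma_distribution p \<gamma>)"
    by (rule nn_integral_parts_law_gamma_beta[OF assms]) simp
  also have "\<dots> = emeasure ?R A"
    by (rule B.emeasure_pair_measure[OF R, symmetric])
  finally show "emeasure ?L A = emeasure ?R A" .
qed

context division begin

text \<open>
  The division law is recovered from the parts, since the ratio of the left part to the whole
  interval is \<open>b\<close>. This identifies \<open>G\<close> once the law of the parts is known.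
\<close>

lemma distr_parts_ratio: "distr (parts_law F G) borel (\<lambda>z. fst z / (fst z + snd z)) = G"
proof -
  have "distr (parts_law F G) borel (\<lambda>z. fst z / (fst z + snd z))
      = distr (F \<Otimes>\<^sub>M G) borel (\<lambda>z. (snd z * fst z) / (snd z * fst z + (1 - snd z) * fst z))"
    unfolding parts_law_def by (subst distr_distr) (auto intro!: distr_cong)
  also have "\<dots> = distr (F \<Otimes>\<^sub>M G) borel snd"
    by (rule distr_cong_AE) (auto intro!: eventually_mono[OF AE_FG] simp: algebra_simps)
  also have "\<dots> = distr (distr (G \<Otimes>\<^sub>M F) (F \<Otimes>\<^sub>M G) (\<lambda>(x, y). (y, x))) borel snd"
    by (subst FG.distr_pair_swap) (rule refl)
  also have "\<dots> = distr (G \<Otimes>\<^sub>M F) G fst"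
    by (subst distr_distr) (auto intro!: distr_cong simp: G(2) split_beta')
  also have "\<dots> = G" by (rule F.distr_pair_fst)
  finally show ?thesis .
qed

lemma parts_law_return:
  assumes "F = return borel s" "G = return borel b"
  shows "parts_law F G = return borel (b * s) \<Otimes>\<^sub>M return borel ((1 - b) * s)"
proof -
  let ?A = "return borel (b * s)" and ?B = "return borel ((1 - b) * s)"
  interpret A: prob_space ?A by (rule prob_space_return) simp
  interpret B: prob_space ?B by (rule prob_space_return) simp
  interpret AB: pair_prob_space ?A ?B ..
  interpret L: prob_space "parts_law F G" by (rule parts_law_prob)
  have sAB: "sets (?A \<Otimes>\<^sub>M ?B) = sets (borel \<Otimes>\<^sub>M borel)" by (intro sets_pair_measure_cong) simp_all
  have "AE t in F. AE x in G. t = s \<and> x = b"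
    unfolding assms by (simp add: AE_return)
  then have "AE z in F \<Otimes>\<^sub>M G. fst z = s \<and> snd z = b"
    by (subst FG.AE_pair_iff[symmetric]) auto
  then have "AE z in F \<Otimes>\<^sub>M G. fst (case z of (t, b) \<Rightarrow> (b * t, (1 - b) * t)) = b * s
      \<and> snd (case z of (t, b) \<Rightarrow> (b * t, (1 - b) * t)) = (1 - b) * s"
    by (rule eventually_mono) (auto simp: split_beta')
  then have "AE z in parts_law F G. fst z = b * s \<and> snd z = (1 - b) * s"
    unfolding parts_law_def by (subst AE_distr_iff) simp_all
  then have "AE z in parts_law F G. z = (b * s, (1 - b) * s)"
    by (rule eventually_mono) (simp add: prod_eq_iff)
  then have 1: "parts_law F G = return (parts_law F G) (b * s, (1 - b) * s)" by (rule L.AE_eq_constD)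
  have "AE y in ?A. AE x in ?B. y = b * s \<and> x = (1 - b) * s"
    by (simp add: AE_return)
  moreover have "{z \<in> space (?A \<Otimes>\<^sub>M ?B). fst z = b * s \<and> snd z = (1 - b) * s} \<in> sets (?A \<Otimes>\<^sub>M ?B)"
  proof -
    have "{z \<in> space (borel \<Otimes>\<^sub>M borel). fst z = b * s \<and> snd z = (1 - b) * s} \<in> sets (borel \<Otimes>\<^sub>M borel)"
      by measurable
    then show ?thesis by (simp add: space_pair_measure sAB)
  qed
  ultimately have "AE z in ?A \<Otimes>\<^sub>M ?B. fst z = b * s \<and> snd z = (1 - b) * s"
    using AB.AE_pair_measure[of "\<lambda>z. fst z = b * s \<and> snd z = (1 - b) * s"] by simp
  then have "AE z in ?A \<Otimes>\<^sub>M ?B. z = (b * s, (1 - b) * s)"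
    by eventually_elim (auto simp: prod_eq_iff)
  then have 2: "?A \<Otimes>\<^sub>M ?B = return (?A \<Otimes>\<^sub>M ?B) (b * s, (1 - b) * s)" by (rule AB.AE_eq_constD)
  have "return (parts_law F G) (b * s, (1 - b) * s) = return (?A \<Otimes>\<^sub>M ?B) (b * s, (1 - b) * s)"
    by (rule return_cong) (simp only: sets_parts_law sAB)
  with 1 2 show ?thesis by simp
qed

text \<open>
  In the gamma case the two parts have the law of the parts of a gamma interval that is divided by a
  beta variable, and the law of the parts determines the division law. The case of \<open>G\<close> degenerate at 0
  or 1 leaves every sequence unchanged up to a change of the index, so it says nothing about \<open>F\<close>; the
  assumption restricts it to degenerate \<open>F\<close>.
\<close>

theorem exchange_invariant_iff:
  assumes nontrivial: "(\<exists>s. F = return borel s) \<or> (G \<noteq> return borel 0 \<and> G \<noteq> return borel 1)"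
  shows "distr (taus \<Otimes>\<^sub>M bs) seq_space exchanged = taus \<longleftrightarrow>
    (\<exists>\<alpha> \<gamma> r. \<alpha> > 0 \<and> \<gamma> > 0 \<and> 0 < r \<and> r < 1 \<and>
         F = gamma_distribution \<alpha> \<gamma> \<and> G = beta_distribution (r * \<alpha>) ((1 - r) * \<alpha>)) \<or>
      (\<exists>s b. 0 < s \<and> 0 \<le> b \<and> b \<le> 1 \<and> F = return borel s \<and> G = return borel b)"
    (is "?inv \<longleftrightarrow> ?gamma \<or> ?det")
proof
  assume ?inv
  let ?A = "distr (parts_law F G) borel fst" and ?B = "distr (parts_law F G) borel snd"
  interpret L: prob_space "parts_law F G" by (rule parts_law_prob)
  have L: "parts_law F G = ?A \<Otimes>\<^sub>M ?B" by (rule parts_independent_if_exchange_invariant[OF \<open>?inv\<close>])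
  have A: "prob_space ?A" "sets ?A = sets borel" and B: "prob_space ?B" "sets ?B = sets borel"
    by (auto intro!: L.prob_space_distr)
  have s_pos: "0 < s" if "F = return borel s" for s
    using F(3) unfolding that by (simp add: AE_return)
  have det: ?det if G01: "G = return borel 0 \<or> G = return borel 1"
  proof -
    obtain b where b: "G = return borel b" "b = 0 \<or> b = 1" using G01 by blast
    obtain s where s: "F = return borel s" using nontrivial G01 by blast
    show ?det
      using b s s_pos[OF s] by (intro exI[of _ s] exI[of _ b]) auto
  qed
  from lukacs[OF L A B] consider "G = return borel 0 \<or> G = return borel 1"
    | "\<exists>s r. 0 < s \<and> 0 \<le> r \<and> r \<le> 1 \<and> F = return borel s \<and> G = return borel r"
    | \<alpha> \<gamma> r where "0 < \<alpha>" "0 < \<gamma>" "0 < r" "r < 1"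
      "\<And>\<theta>. 0 < \<theta> \<Longrightarrow> laplace_moment F 0 \<theta> = (\<gamma> / (\<gamma> + \<theta>)) powr \<alpha>"
      "\<And>\<theta>. 0 < \<theta> \<Longrightarrow> laplace_moment ?A 0 \<theta> = (\<gamma> / (\<gamma> + \<theta>)) powr (r * \<alpha>)"
      "\<And>\<theta>. 0 < \<theta> \<Longrightarrow> laplace_moment ?B 0 \<theta> = (\<gamma> / (\<gamma> + \<theta>)) powr ((1 - r) * \<alpha>)"
    by metis
  then show "?gamma \<or> ?det"
  proof cases
    case 1 then show ?thesis using det by (intro disjI2)
  next
    case 2 then show ?thesis by (intro disjI2)
  next
    case (3 \<alpha> \<gamma> r)
    have pq: "0 < r * \<alpha>" "0 < (1 - r) * \<alpha>" "r * \<alpha> + (1 - r) * \<alpha> = \<alpha>" using 3 by (auto simp: algebra_simps)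
    have nA: "nonneg_prob ?A" and nB: "nonneg_prob ?B" by (rule AE_factors_nonneg[OF L A B])+
    have Fg: "F = gamma_distribution \<alpha> \<gamma>"
      by (rule eq_if_laplace_moment_0_eq[OF FF.nonneg_prob_axioms gamma_distribution_nonneg_prob])
         (use 3 in \<open>simp_all add: laplace_moment_gamma_distribution\<close>)
    have Ag: "?A = gamma_distribution (r * \<alpha>) \<gamma>"
      by (rule eq_if_laplace_moment_0_eq[OF nA gamma_distribution_nonneg_prob])
         (use 3 pq in \<open>simp_all add: laplace_moment_gamma_distribution\<close>)
    have Bg: "?B = gamma_distribution ((1 - r) * \<alpha>) \<gamma>"
      by (rule eq_if_laplace_moment_0_eq[OF nB gamma_distribution_nonneg_prob])
         (use 3 pq in \<open>simp_all add: laplace_moment_gamma_distribution\<close>)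
    let ?beta = "beta_distribution (r * \<alpha>) ((1 - r) * \<alpha>)"
    have eq: "parts_law F G = parts_law F ?beta"
      using parts_law_gamma_beta[OF pq(1,2) \<open>0 < \<gamma>\<close>] L unfolding pq(3) Fg[symmetric] Ag Bg by simp
    interpret beta: division F ?beta
      by (rule division.intro[OF F prob_space_beta_distribution[OF pq(1,2)] sets_beta_distribution AE_beta_distribution])
    have "G = distr (parts_law F G) borel (\<lambda>z. fst z / (fst z + snd z))" by (rule distr_parts_ratio[symmetric])
    also have "\<dots> = ?beta" unfolding eq by (rule beta.distr_parts_ratio)
    finally have "G = ?beta" .
    then have ?gamma using 3(1-4) Fg by (intro exI[of _ \<alpha>] exI[of _ \<gamma>] exI[of _ r] conjI)
    then show ?thesis ..
  qed
next
  assume "?gamma \<or> ?det"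
  then show ?inv
  proof
    assume ?gamma
    then obtain \<alpha> \<gamma> r where *: "\<alpha> > 0" "\<gamma> > 0" "0 < r" "r < 1"
      "F = gamma_distribution \<alpha> \<gamma>" "G = beta_distribution (r * \<alpha>) ((1 - r) * \<alpha>)" by blast
    have pq: "0 < r * \<alpha>" "0 < (1 - r) * \<alpha>" "r * \<alpha> + (1 - r) * \<alpha> = \<alpha>" using * by (auto simp: algebra_simps)
    have "parts_law F G = gamma_distribution (r * \<alpha>) \<gamma> \<Otimes>\<^sub>M gamma_distribution ((1 - r) * \<alpha>) \<gamma>"
      using parts_law_gamma_beta[OF pq(1,2) *(2)] * by (simp add: pq(3))
    then show ?inv
      by (rule exchange_invariant_if_parts_independent)
         (use gamma_distribution_nonneg_prob[OF pq(1) *(2)] gamma_distribution_nonneg_prob[OF pq(2) *(2)]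
           in \<open>auto simp: nonneg_prob_def\<close>)
  next
    assume ?det
    then obtain s b where *: "F = return borel s" "G = return borel b" by blast
    show ?inv
      by (rule exchange_invariant_if_parts_independent[OF parts_law_return[OF *]])
         (auto intro: prob_space_return)
  qed
qed

end

section \<open>Measurable enumeration of locally finite configurations\<close>

lemma in_configs_iff: "T \<in> space configs \<longleftrightarrow> (\<forall>n::nat. finite (T \<inter> {- real n..real n}))"
proof -
  have sp: "space configs = {T. countable T \<and> (\<forall>x. \<not> x islimpt T)}"
    unfolding configs_def Let_def by (rule space_measure_of) auto
  show ?thesis
  proof
    assume "T \<in> space configs"
    then have "\<And>x. \<not> x islimpt T" by (simp add: sp)
    then show "\<forall>n::nat. finite (T \<inter> {- real n..real n})"
      using finite_not_islimpt_in_compact[of "{- real n..real n}" T for n] by (auto simp: Int_commute)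
  next
    assume fin: "\<forall>n::nat. finite (T \<inter> {- real n..real n})"
    have "T \<subseteq> (\<Union>n::nat. T \<inter> {- real n..real n})"
    proof
      fix x assume "x \<in> T"
      obtain n :: nat where "\<bar>x\<bar> \<le> real n" using real_arch_simple by blast
      then show "x \<in> (\<Union>n::nat. T \<inter> {- real n..real n})" using \<open>x \<in> T\<close> by (auto intro!: exI[of _ n])
    qed
    moreover have "countable (\<Union>n::nat. T \<inter> {- real n..real n})"
      by (rule countable_UN) (use fin in \<open>auto intro: countable_finite\<close>)
    ultimately have "countable T" by (rule countable_subset)
    moreover have "\<not> x islimpt T" for x
    proof
      assume lim: "x islimpt T"
      obtain n :: nat where n: "\<bar>x\<bar> + 1 \<le> real n" using real_arch_simple by blast
      have "finite (T \<inter> ball x 1)"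
        by (rule finite_subset[OF _ fin[rule_format, of n]]) (use n in \<open>auto simp: dist_real_def\<close>)
      then show False using lim unfolding islimpt_eq_infinite_ball by (auto dest: spec[of _ 1])
    qed
    ultimately show "T \<in> space configs" by (simp add: sp)
  qed
qed

lemma finite_config_Int_bounded:
  assumes "T \<in> space configs" "bounded B"
  shows "finite (T \<inter> B)"
proof -
  obtain b where b: "\<And>x. x \<in> B \<Longrightarrow> norm x \<le> b" using assms(2) unfolding bounded_iff by blast
  obtain n :: nat where "b \<le> real n" using real_arch_simple by blast
  then have "T \<inter> B \<subseteq> T \<inter> {- real n..real n}" using b by force
  then show ?thesis using assms(1) finite_subset unfolding in_configs_iff by blast
qed

lemma measurable_card_config_Int:
  assumes "B \<in> sets borel" "bounded B"
  shows "(\<lambda>T. card (T \<inter> B)) \<in> configs \<rightarrow>\<^sub>M count_space UNIV"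
  unfolding measurable_count_space_eq2_countable
proof (intro conjI ballI)
  fix n :: nat
  let ?O = "{T::real set. countable T \<and> (\<forall>x. \<not> x islimpt T)}"
  have sp: "space configs = ?O"
    unfolding configs_def Let_def by (rule space_measure_of) auto
  have "{T \<in> ?O. card (T \<inter> B) = n} \<in> sets configs"
    unfolding configs_def Let_def using assms by (intro in_measure_of) auto
  moreover have "(\<lambda>T. card (T \<inter> B)) -` {n} \<inter> space configs = {T \<in> ?O. card (T \<inter> B) = n}"
    by (auto simp: sp)
  ultimately show "(\<lambda>T. card (T \<inter> B)) -` {n} \<inter> space configs \<in> sets configs" by simp
qed auto

lemma measurable_configsI:
  assumes "\<And>\<omega>. \<omega> \<in> space M \<Longrightarrow> f \<omega> \<in> space configs"
    and "\<And>B. B \<in> sets borel \<Longrightarrow> bounded B \<Longrightarrow> (\<lambda>\<omega>. card (f \<omega> \<inter> B)) \<in> M \<rightarrow>\<^sub>M count_space UNIV"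
  shows "f \<in> M \<rightarrow>\<^sub>M configs"
proof -
  let ?O = "{T::real set. countable T \<and> (\<forall>x. \<not> x islimpt T)}"
  have sp: "space configs = ?O"
    unfolding configs_def Let_def by (rule space_measure_of) auto
  show ?thesis
    unfolding configs_def Let_def
  proof (rule measurable_measure_of)
    show "f \<in> space M \<rightarrow> ?O" using assms(1) by (auto simp: sp[symmetric])
    fix y assume "y \<in> {{T \<in> ?O. card (T \<inter> B) = n} |B n. B \<in> sets borel \<and> bounded B}"
    then obtain B n where y: "y = {T \<in> ?O. card (T \<inter> B) = n}" and B: "B \<in> sets borel" "bounded B" by blast
    have "(\<lambda>\<omega>. card (f \<omega> \<inter> B)) -` {n} \<inter> space M \<in> sets M"
      using assms(2)[OF B] by (rule measurable_sets) simp
    moreover have "f -` y \<inter> space M = (\<lambda>\<omega>. card (f \<omega> \<inter> B)) -` {n} \<inter> space M"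
      using assms(1) by (auto simp: y sp[symmetric])
    ultimately show "f -` y \<inter> space M \<in> sets M" by simp
  qed auto
qed

text \<open>
  Each point of the image is counted once, by the smallest index at which it occurs; such an index
  exists because only finitely many indices have their point in a bounded set. So \<open>p\<close> may enumerate its
  points in any order and with repetitions.
\<close>

lemma measurable_configs_enumeration:
  fixes p :: "'a \<Rightarrow> int \<Rightarrow> real"
  assumes K[measurable]: "\<And>k. Measurable.pred M (\<lambda>\<omega>. k \<in> K \<omega>)"
    and p[measurable]: "\<And>k. (\<lambda>\<omega>. p \<omega> k) \<in> borel_measurable M"
    and fin: "\<And>\<omega> n. \<omega> \<in> space M \<Longrightarrow> finite {k \<in> K \<omega>. \<bar>p \<omega> k\<bar> \<le> real n}"
  shows "(\<lambda>\<omega>. p \<omega> ` K \<omega>) \<in> M \<rightarrow>\<^sub>M configs"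
proof (rule measurable_configsI)
  fix \<omega> assume "\<omega> \<in> space M"
  then have "finite (p \<omega> ` {k \<in> K \<omega>. \<bar>p \<omega> k\<bar> \<le> real n})" for n by (intro finite_imageI fin)
  moreover have "p \<omega> ` K \<omega> \<inter> {- real n..real n} = p \<omega> ` {k \<in> K \<omega>. \<bar>p \<omega> k\<bar> \<le> real n}" for n by auto
  ultimately show "p \<omega> ` K \<omega> \<in> space configs" unfolding in_configs_iff by simp
next
  fix B :: "real set" assume B[measurable]: "B \<in> sets borel" and "bounded B"
  define S where "S \<omega> = {i. int_decode i \<in> K \<omega> \<and> p \<omega> (int_decode i) \<in> B
      \<and> (\<forall>j. j \<in> K \<omega> \<longrightarrow> j < int_decode i \<longrightarrow> p \<omega> j \<noteq> p \<omega> (int_decode i))}" for \<omega>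
  have "card (S \<omega>) = card (p \<omega> ` K \<omega> \<inter> B)" if \<omega>: "\<omega> \<in> space M" for \<omega>
  proof (rule bij_betw_same_card)
    show "bij_betw (\<lambda>i. p \<omega> (int_decode i)) (S \<omega>) (p \<omega> ` K \<omega> \<inter> B)"
      unfolding bij_betw_def
    proof (intro conjI inj_onI set_eqI iffI)
      fix i j assume ij: "i \<in> S \<omega>" "j \<in> S \<omega>" "p \<omega> (int_decode i) = p \<omega> (int_decode j)"
      then have "int_decode i = int_decode j"
        unfolding S_def by (metis (mono_tags, lifting) linorder_neqE mem_Collect_eq)
      then show "i = j" by (metis int_decode_inverse)
    next
      fix x assume "x \<in> (\<lambda>i. p \<omega> (int_decode i)) ` S \<omega>"
      then show "x \<in> p \<omega> ` K \<omega> \<inter> B" by (auto simp: S_def)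
    next
      fix x assume x: "x \<in> p \<omega> ` K \<omega> \<inter> B"
      let ?C = "{k \<in> K \<omega>. p \<omega> k = x}"
      obtain n :: nat where n: "\<bar>x\<bar> \<le> real n" using real_arch_simple by blast
      have C: "finite ?C" by (rule finite_subset[OF _ fin[OF \<omega>, of n]]) (use n in auto)
      moreover have "?C \<noteq> {}" using x by auto
      ultimately have m: "Min ?C \<in> ?C" by (rule Min_in)
      have "p \<omega> j \<noteq> x" if "j \<in> K \<omega>" "j < Min ?C" for j
        using Min_le[OF C, of j] that by auto
      then have "int_encode (Min ?C) \<in> S \<omega>" using m x by (auto simp: S_def)
      then show "x \<in> (\<lambda>i. p \<omega> (int_decode i)) ` S \<omega>"
        using m by (intro image_eqI[of _ _ "int_encode (Min ?C)"]) auto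
    qed
  qed
  moreover have "(\<lambda>\<omega>. card (S \<omega>)) \<in> M \<rightarrow>\<^sub>M count_space UNIV"
  proof (rule measurable_card)
    fix i :: nat
    show "{\<omega> \<in> space M. i \<in> S \<omega>} \<in> sets M" unfolding S_def by simp
  qed
  ultimately show "(\<lambda>\<omega>. card (p \<omega> ` K \<omega> \<inter> B)) \<in> M \<rightarrow>\<^sub>M count_space UNIV"
    by (simp cong: measurable_cong)
qed


section \<open>The indices of the points\<close>

lemma finite_linorder_rank_surj:
  fixes S :: "real set"
  assumes "finite S" "1 \<le> m" "m \<le> card S"
  shows "\<exists>x\<in>S. card {y \<in> S. y \<le> x} = m"
  using assms
proof (induction S arbitrary: m rule: finite_linorder_max_induct)
  case empty
  then show ?case by simp
next
  case (insert b A)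
  have b: "b \<notin> A" using insert.hyps by auto
  show ?case
  proof (cases "m \<le> card A")
    case True
    with insert obtain x where x: "x \<in> A" "card {y \<in> A. y \<le> x} = m" by blast
    have "{y \<in> insert b A. y \<le> x} = {y \<in> A. y \<le> x}" using insert.hyps x by force
    then have "card {y \<in> insert b A. y \<le> x} = m" using x(2) by (simp only:)
    then show ?thesis using x(1) by blast
  next
    case False
    then have "m = card (insert b A)" using insert b by simp
    moreover have "{y \<in> insert b A. y \<le> b} = insert b A" using insert.hyps by force
    ultimately show ?thesis by auto
  qed
qed

definition point_indices :: "real set \<Rightarrow> int set" where
  "point_indices T = point_index T ` T"

locale config =
  fixes T :: "real set"
  assumes T: "T \<in> space configs"
begin

abbreviation "idx \<equiv> point_index T"

lemma fin: "bounded B \<Longrightarrow> finite (T \<inter> B)"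
  by (rule finite_config_Int_bounded[OF T])

text \<open>
  The two branches in the definition of the index agree in this: differences of indices count the
  points in between. Everything about the index follows from this identity.
\<close>

lemma idx_diff:
  assumes "x \<le> y"
  shows "idx y - idx x = int (card (T \<inter> {x<..y}))"
proof -
  have split: "card (T \<inter> {a<..c}) = card (T \<inter> {a<..b}) + card (T \<inter> {b<..c})" if "a \<le> b" "b \<le> c" for a b c
  proof -
    have "T \<inter> {a<..c} = (T \<inter> {a<..b}) \<union> (T \<inter> {b<..c})" using that by auto
    also have "card \<dots> = card (T \<inter> {a<..b}) + card (T \<inter> {b<..c})"
      by (intro card_Un_disjoint fin bounded_Ioc) auto
    finally show ?thesis .
  qed
  show ?thesis
  proof (cases "0 < x")
    case True then show ?thesis using split[of 0 x y] assms by (simp add: point_index_def)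
  next
    case x: False
    show ?thesis
    proof (cases "0 < y")
      case True then show ?thesis using split[of x 0 y] assms x by (simp add: point_index_def)
    next
      case False then show ?thesis using split[of x y 0] assms x by (simp add: point_index_def)
    qed
  qed
qed

lemma idx_mono: "x \<le> y \<Longrightarrow> idx x \<le> idx y"
  using idx_diff[of x y] by linarith

lemma idx_less: "x < y \<Longrightarrow> y \<in> T \<Longrightarrow> idx x < idx y"
proof -
  assume *: "x < y" "y \<in> T"
  have "T \<inter> {x<..y} \<noteq> {}" using * by auto
  then have "0 < card (T \<inter> {x<..y})" by (simp add: card_gt_0_iff fin bounded_Ioc)
  then show "idx x < idx y" using idx_diff[of x y] * by linarith
qed

lemma idx_inj: "x \<in> T \<Longrightarrow> y \<in> T \<Longrightarrow> idx x = idx y \<Longrightarrow> x = y"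
  using idx_less by (metis less_irrefl linorder_neqE)

text \<open>
  An intermediate value property of the index.
\<close>

lemma idx_hits:
  assumes "a \<le> b" "idx a < k" "k \<le> idx b"
  shows "\<exists>x\<in>T. a < x \<and> x \<le> b \<and> idx x = k"
proof -
  let ?S = "T \<inter> {a<..b}"
  have "\<exists>x\<in>?S. card {y \<in> ?S. y \<le> x} = nat (k - idx a)"
    using assms idx_diff[OF assms(1)] by (intro finite_linorder_rank_surj fin bounded_Ioc) auto
  then obtain x where x: "x \<in> ?S" "card {y \<in> ?S. y \<le> x} = nat (k - idx a)" by blast
  have "{y \<in> ?S. y \<le> x} = T \<inter> {a<..x}" using x(1) by auto
  then have "idx x - idx a = k - idx a" using idx_diff[of a x] x assms by simp
  then show ?thesis using x by auto
qed

lemma nth_point_idx: "x \<in> T \<Longrightarrow> nth_point T (idx x) = x"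
  unfolding nth_point_def by (rule the_equality) (auto intro: idx_inj)

abbreviation "inds \<equiv> point_indices T"

lemma nth_in: "k \<in> inds \<Longrightarrow> nth_point T k \<in> T" and idx_nth: "k \<in> inds \<Longrightarrow> idx (nth_point T k) = k"
  unfolding point_indices_def by (auto simp: nth_point_idx)

lemma T_eq: "T = nth_point T ` inds"
  unfolding point_indices_def image_image by (auto simp: nth_point_idx)

text \<open>
  A condition on the numbers of points in bounded intervals only, hence a measurable one.
\<close>

lemma inds_iff: "k \<in> inds \<longleftrightarrow> (\<exists>n::nat. idx (- real n) < k \<and> k \<le> idx (real n))"
proof
  assume "k \<in> inds"
  then obtain x where x: "x \<in> T" "idx x = k" by (auto simp: point_indices_def)
  obtain n :: nat where "\<bar>x\<bar> + 1 \<le> real n" using real_arch_simple by blast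
  then have "- real n < x" "x \<le> real n" by auto
  then show "\<exists>n::nat. idx (- real n) < k \<and> k \<le> idx (real n)" using x idx_less idx_mono by blast
next
  assume "\<exists>n::nat. idx (- real n) < k \<and> k \<le> idx (real n)"
  then obtain n :: nat where "idx (- real n) < k" "k \<le> idx (real n)" by blast
  from idx_hits[OF _ this] show "k \<in> inds" by (auto simp: point_indices_def)
qed

text \<open>
  This Galois connection between the enumeration and the index makes the points measurable functions
  of the configuration.
\<close>

lemma nth_le_iff: "k \<in> inds \<Longrightarrow> nth_point T k \<le> a \<longleftrightarrow> k \<le> idx a"
  using idx_mono[of "nth_point T k" a] idx_less[of a "nth_point T k"] by (auto simp: idx_nth nth_in not_le[symmetric])

lemma nth_less: "j \<in> inds \<Longrightarrow> k \<in> inds \<Longrightarrow> j < k \<Longrightarrow> nth_point T j < nth_point T k"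
  using nth_le_iff[of k "nth_point T j"] by (simp add: idx_nth not_le[symmetric])

lemma inds_convex: "i \<in> inds \<Longrightarrow> k \<in> inds \<Longrightarrow> i \<le> j \<Longrightarrow> j \<le> k \<Longrightarrow> j \<in> inds"
  unfolding inds_iff
proof safe
  fix m n :: nat assume *: "i \<le> j" "j \<le> k" "idx (- real m) < i" "k \<le> idx (real n)"
  have "idx (- real (max m n)) \<le> idx (- real m)" "idx (real n) \<le> idx (real (max m n))"
    by (intro idx_mono; simp)+
  then show "\<exists>n::nat. idx (- real n) < j \<and> j \<le> idx (real n)" using * by (intro exI[of _ "max m n"]) auto
qed

lemma finite_inds: "finite {k \<in> inds. \<bar>nth_point T k\<bar> \<le> c}"
proof (rule finite_subset)
  show "{k \<in> inds. \<bar>nth_point T k\<bar> \<le> c} \<subseteq> idx ` (T \<inter> {-c..c})"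
  proof
    fix k assume k: "k \<in> {k \<in> inds. \<bar>nth_point T k\<bar> \<le> c}"
    then show "k \<in> idx ` (T \<inter> {-c..c})"
      by (intro image_eqI[of _ _ "nth_point T k"]) (auto simp: idx_nth nth_in abs_le_iff)
  qed
qed (auto intro: fin bounded_closed_interval)

lemma intervals_eq: "intervals T = {(nth_point T (k - 1), nth_point T k) |k. k \<in> inds \<and> k - 1 \<in> inds}"
proof (intro set_eqI iffI)
  fix I assume "I \<in> intervals T"
  then obtain x y where I: "I = (x, y)" "x \<in> T" "y \<in> T" "x < y" "T \<inter> {x<..<y} = {}"
    by (auto simp: intervals_def)
  have "T \<inter> {x<..y} = {y}" using I by force
  then have "idx x = idx y - 1" using idx_diff[of x y] I by simp
  then have "x = nth_point T (idx y - 1)" "idx y - 1 \<in> inds"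
    using nth_point_idx[OF I(2)] imageI[OF I(2), of idx] by (simp_all add: point_indices_def)
  then show "I \<in> {(nth_point T (k - 1), nth_point T k) |k. k \<in> inds \<and> k - 1 \<in> inds}"
    using I by (auto simp: nth_point_idx point_indices_def intro!: exI[of _ "idx y"])
next
  fix I assume "I \<in> {(nth_point T (k - 1), nth_point T k) |k. k \<in> inds \<and> k - 1 \<in> inds}"
  then obtain k where k: "I = (nth_point T (k - 1), nth_point T k)" "k \<in> inds" "k - 1 \<in> inds" by blast
  have "T \<inter> {nth_point T (k - 1)<..<nth_point T k} = {}"
  proof (rule ccontr)
    assume "T \<inter> {nth_point T (k - 1)<..<nth_point T k} \<noteq> {}"
    then obtain z where z: "z \<in> T" "nth_point T (k - 1) < z" "z < nth_point T k" by auto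
    have "k - 1 < idx z" "idx z < k"
      using idx_less[OF z(2,1)] idx_less[OF z(3) nth_in[OF k(2)]] k by (simp_all add: idx_nth)
    then show False by simp
  qed
  then show "I \<in> intervals T" using k nth_less[of "k - 1" k] by (auto simp: intervals_def nth_in)
qed

lemma neighbour_shift_eq:
  "neighbour_shift b T = (\<lambda>k. nth_point T (k - 1) + b k * (nth_point T k - nth_point T (k - 1))) ` {k \<in> inds. k - 1 \<in> inds}"
  unfolding neighbour_shift_def intervals_eq by (auto simp: idx_nth)


text \<open>
  The division points of distinct intervals may coincide, in which case the gaps do not determine the
  enumeration; the gap that contains the origin is still bounded by the points 0 and 1.
\<close>

lemma nth_around_0:
  assumes "x \<in> T" "y \<in> T" "x \<le> 0" "0 < y" "T \<inter> {x<..<y} = {}"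
  shows "nth_point T 0 = x" "nth_point T 1 = y"
proof -
  have "T \<inter> {0<..y} = {y}" "T \<inter> {x<..0} = {}" using assms by force+
  then have "idx y = 1" "idx x = 0" using assms by (auto simp: point_index_def)
  then show "nth_point T 0 = x" "nth_point T 1 = y" using nth_point_idx assms by metis+
qed

lemma nth_point_enumeration:
  assumes p: "strict_mono p" "T = range p" "p (0::int) \<le> 0" "0 < p 1"
  shows "point_index T (p k) = k" "nth_point T k = p k" "inds = UNIV"
proof -
  have step: "idx (p (k + 1)) = idx (p k) + 1" for k
  proof -
    have "T \<inter> {p k<..p (k + 1)} = p ` {j. k < j \<and> j \<le> k + 1}"
      by (auto simp: p(2) strict_mono_less[OF p(1)] strict_mono_less_eq[OF p(1)])
    also have "{j. k < j \<and> j \<le> k + 1} = {k + 1}" by auto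
    finally have "T \<inter> {p k<..p (k + 1)} = {p (k + 1)}" by simp
    then show ?thesis using idx_diff[of "p k" "p (k + 1)"] strict_mono_less_eq[OF p(1), of k "k + 1"] by simp
  qed
  have "\<not> (p 0 < p j \<and> p j \<le> 0)" for j
  proof
    assume *: "p 0 < p j \<and> p j \<le> 0"
    then have "p j < p 1" using p(4) by linarith
    then show False using * by (simp add: strict_mono_less[OF p(1)])
  qed
  then have "T \<inter> {p 0<..0} = {}" by (auto simp: p(2))
  then have 0: "idx (p 0) = 0" using p(3) by (simp add: point_index_def)
  show i: "idx (p k) = k" for k
  proof (induction k rule: int_induct[where k=0])
    case base show ?case by (rule 0)
  next
    case (step1 i) then show ?case using step[of i] by simp
  next
    case (step2 i) then show ?case using step[of "i - 1"] by simp
  qed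
  show "nth_point T k = p k" using nth_point_idx[of "p k"] i[of k] by (simp add: p(2))
  have "k \<in> inds" for k
    unfolding point_indices_def by (rule image_eqI[where x="p k"], simp only: i, simp only: p(2) rangeI)
  then show "inds = UNIV" by auto
qed

end

lemma configD: "T \<in> space configs \<Longrightarrow> config T"
  by (rule config.intro)

lemma measurable_point_index[measurable]: "(\<lambda>T. point_index T a) \<in> configs \<rightarrow>\<^sub>M count_space UNIV"
proof -
  note [measurable] = measurable_card_config_Int[of "{0<..a}"] measurable_card_config_Int[of "{a<..0}"]
  show ?thesis unfolding point_index_def by (cases "0 < a") (simp_all add: bounded_Ioc)
qed

lemma pred_point_indices[measurable]: "Measurable.pred configs (\<lambda>T. k \<in> point_indices T)"
proof -
  have "Measurable.pred configs (\<lambda>T. \<exists>n::nat. point_index T (- real n) < k \<and> k \<le> point_index T (real n))"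
    by measurable
  then show ?thesis
    by (subst measurable_cong[OF config.inds_iff[OF configD]])
qed

text \<open>
  An extension of the enumeration by 0, so that it is defined for every index.
\<close>

definition point_at :: "real set \<Rightarrow> int \<Rightarrow> real" where
  "point_at T k = (if k \<in> point_indices T then nth_point T k else 0)"

lemma measurable_point_at[measurable]: "(\<lambda>T. point_at T k) \<in> borel_measurable configs"
proof (rule borel_measurableI_le)
  fix a
  have "{T \<in> space configs. point_at T k \<le> a} = {T \<in> space configs. (k \<in> point_indices T \<and> k \<le> point_index T a) \<or> (k \<notin> point_indices T \<and> 0 \<le> a)}"
    using config.nth_le_iff[OF configD] by (auto simp: point_at_def)
  also have "\<dots> \<in> sets configs" by measurable
  finally show "{T \<in> space configs. point_at T k \<le> a} \<in> sets configs" .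
qed

lemma point_at_image: "T \<in> space configs \<Longrightarrow> point_at T ` point_indices T = T"
  using config.T_eq[OF configD] by (auto simp: point_at_def)

lemma finite_point_at: "T \<in> space configs \<Longrightarrow> finite {k \<in> point_indices T. \<bar>point_at T k\<bar> \<le> c}"
  by (rule finite_subset[OF _ config.finite_inds[OF configD, of T c]]) (auto simp: point_at_def)

lemma measurable_translate: "(\<lambda>(T, s). (\<lambda>x. x + s) ` T) \<in> configs \<Otimes>\<^sub>M borel \<rightarrow>\<^sub>M configs"
proof -
  have "(\<lambda>z. (\<lambda>k. point_at (fst z) k + snd z) ` point_indices (fst z)) \<in> configs \<Otimes>\<^sub>M borel \<rightarrow>\<^sub>M configs"
  proof (rule measurable_configs_enumeration)
    fix z :: "real set \<times> real" and n :: nat assume "z \<in> space (configs \<Otimes>\<^sub>M borel)"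
    then have "finite {k \<in> point_indices (fst z). \<bar>point_at (fst z) k\<bar> \<le> real n + \<bar>snd z\<bar>}"
      by (intro finite_point_at) (auto simp: space_pair_measure)
    then show "finite {k \<in> point_indices (fst z). \<bar>point_at (fst z) k + snd z\<bar> \<le> real n}"
      by (rule rev_finite_subset) auto
  qed measurable
  then show ?thesis
  proof (rule measurable_cong[THEN iffD1, rotated])
    fix z :: "real set \<times> real" assume "z \<in> space (configs \<Otimes>\<^sub>M borel)"
    then have "fst z \<in> space configs" by (auto simp: space_pair_measure)
    from point_at_image[OF this]
    have "(\<lambda>x. x + snd z) ` fst z = (\<lambda>x. x + snd z) ` point_at (fst z) ` point_indices (fst z)" by simp
    then show "(\<lambda>k. point_at (fst z) k + snd z) ` point_indices (fst z) = (case z of (T, s) \<Rightarrow> (\<lambda>x. x + s) ` T)"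
      by (simp add: split_beta' image_image)
  qed
qed

text \<open>
  Marks outside the unit interval could produce accumulation points. Clipping makes the shift a
  measurable map on all pairs of marks and configurations, and does not alter the marks that occur.
\<close>

definition clip :: "(int \<Rightarrow> real) \<Rightarrow> int \<Rightarrow> real" where
  "clip b k = max 0 (min 1 (b k))"

lemma clip_range: "0 \<le> clip b k" "clip b k \<le> 1" by (auto simp: clip_def)

lemma between_if_clip:
  assumes "x \<le> y"
  shows "x \<le> x + clip b k * (y - x)" "x + clip b k * (y - x) \<le> y"
  using assms clip_range[of b k] mult_left_le_one_le[of "y - x" "clip b k"] by (auto simp: mult.commute)

lemma measurable_neighbour_shift:
  "(\<lambda>(b, T). neighbour_shift (clip b) T) \<in> seq_space \<Otimes>\<^sub>M configs \<rightarrow>\<^sub>M configs"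
proof -
  let ?K = "\<lambda>z::(int \<Rightarrow> real) \<times> real set. {k. k \<in> point_indices (snd z) \<and> k - 1 \<in> point_indices (snd z)}"
  let ?p = "\<lambda>z k. point_at (snd z) (k - 1) + clip (fst z) k * (point_at (snd z) k - point_at (snd z) (k - 1))"
  have [measurable]: "(\<lambda>z. clip (fst z) k) \<in> borel_measurable (seq_space \<Otimes>\<^sub>M configs)" for k
  proof -
    have "(\<lambda>z. fst z k) \<in> borel_measurable (seq_space \<Otimes>\<^sub>M configs)"
      using measurable_compose[OF measurable_fst measurable_seq_component] .
    then show ?thesis unfolding clip_def by simp
  qed
  have "(\<lambda>z. ?p z ` ?K z) \<in> seq_space \<Otimes>\<^sub>M configs \<rightarrow>\<^sub>M configs"
  proof (rule measurable_configs_enumeration)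
    fix z :: "(int \<Rightarrow> real) \<times> real set" and n :: nat assume "z \<in> space (seq_space \<Otimes>\<^sub>M configs)"
    then interpret config "snd z" by unfold_locales (auto simp: space_pair_measure)
    have "{k \<in> ?K z. \<bar>?p z k\<bar> \<le> real n} \<subseteq> {idx (- real n)..idx (real n) + 1}"
    proof safe
      fix k assume k: "k \<in> inds" "k - 1 \<in> inds" "\<bar>?p z k\<bar> \<le> real n"
      have le: "point_at (snd z) (k - 1) \<le> point_at (snd z) k"
        using nth_less[OF k(2,1)] k by (simp add: point_at_def)
      have "point_at (snd z) (k - 1) \<le> real n" "- real n \<le> point_at (snd z) k"
        using between_if_clip[OF le, of "fst z" k] k(3) by (auto simp: abs_le_iff)
      then have "k - 1 \<le> idx (real n)" "idx (- real n) \<le> idx (nth_point (snd z) k)"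
        using k nth_le_iff[OF k(2)] idx_mono by (auto simp: point_at_def)
      then show "k \<in> {idx (- real n)..idx (real n) + 1}" using idx_nth[OF k(1)] by simp
    qed
    then show "finite {k \<in> ?K z. \<bar>?p z k\<bar> \<le> real n}" by (rule finite_subset) simp
  qed measurable
  then show ?thesis
  proof (rule measurable_cong[THEN iffD1, rotated])
    fix z :: "(int \<Rightarrow> real) \<times> real set" assume "z \<in> space (seq_space \<Otimes>\<^sub>M configs)"
    then interpret config "snd z" by unfold_locales (auto simp: space_pair_measure)
    show "?p z ` ?K z = (case z of (b, T) \<Rightarrow> neighbour_shift (clip b) T)"
      unfolding split_beta' neighbour_shift_eq by (intro image_cong) (auto simp: point_at_def)
  qed
qed


section \<open>Configurations with given gaps\<close>

text \<open>
  The position of the point with index \<open>k\<close> when \<open>t i\<close> is the gap to the left of the point \<open>i\<close> and the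
  point with index 0 is at the origin.
\<close>

definition partial_sum :: "(int \<Rightarrow> real) \<Rightarrow> int \<Rightarrow> real" where
  "partial_sum t k = (if 0 \<le> k then \<Sum>i\<in>{0<..k}. t i else - (\<Sum>i\<in>{k<..0}. t i))"

lemma partial_sum_0[simp]: "partial_sum t 0 = 0" by (simp add: partial_sum_def)

lemma partial_sum_step: "partial_sum t k = partial_sum t (k - 1) + t k"
proof (cases "1 \<le> k")
  case True
  then have "{0<..k} = insert k {0<..k - 1}" by auto
  then show ?thesis using True by (simp add: partial_sum_def)
next
  case False
  then have "{k - 1<..0} = insert k {k<..0}" by auto
  then show ?thesis using False by (cases "k = 0") (auto simp: partial_sum_def)
qed

lemma partial_sum_1[simp]: "partial_sum t 1 = t 1" using partial_sum_step[of t 1] by simp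

lemma partial_sum_unique:
  assumes "\<And>k. p k = p (k - 1) + t k"
  shows "p k = p 0 + partial_sum t k"
proof (induction k rule: int_induct[where k=0])
  case base show ?case by simp
next
  case (step1 i) then show ?case using assms[of "i + 1"] partial_sum_step[of t "i + 1"] by simp
next
  case (step2 i) then show ?case using assms[of i] partial_sum_step[of t i] by simp
qed

lemma int_mono_if_steps:
  fixes p :: "int \<Rightarrow> real"
  assumes "\<And>k. p (k - 1) \<le> p k"
  shows "mono p"
proof (rule monoI)
  fix i j :: int assume "i \<le> j"
  then show "p i \<le> p j"
  proof (induction j rule: int_ge_induct)
    case (step j) then show ?case using assms[of "j + 1"] by simp
  qed simp
qed

lemma int_strict_mono_if_steps:
  fixes p :: "int \<Rightarrow> real"
  assumes "\<And>k. p (k - 1) < p k"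
  shows "strict_mono p"
proof (rule strict_monoI)
  fix i j :: int assume "i < j"
  then show "p i < p j"
  proof (induction j rule: int_gr_induct)
    case base then show ?case using assms[of "i + 1"] by simp
  next
    case (step j) then show ?case using assms[of "j + 1"] by simp
  qed
qed

definition two_sided :: "(int \<Rightarrow> real) \<Rightarrow> bool" where
  "two_sided p \<longleftrightarrow> (\<forall>n::nat. \<exists>k. real n < p k) \<and> (\<forall>n::nat. \<exists>k. p k < - real n)"

lemma finite_two_sided:
  assumes "mono p" "two_sided p"
  shows "finite {k. \<bar>p k\<bar> \<le> c}"
proof -
  obtain n :: nat where n: "c \<le> real n" using real_arch_simple by blast
  obtain i j where ij: "real n < p i" "p j < - real n" using assms(2) unfolding two_sided_def by blast
  have "k \<in> {j..i}" if k: "\<bar>p k\<bar> \<le> c" for k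
  proof -
    have "\<not> i < k" using monoD[OF assms(1), of i k] ij(1) n k by linarith
    moreover have "\<not> k < j" using monoD[OF assms(1), of k j] ij(2) n k by linarith
    ultimately show ?thesis by simp
  qed
  then show ?thesis by (auto intro: finite_subset[of _ "{j..i}"])
qed

text \<open>
  Gaps of length 0 are admitted, because the exchange operator can produce them.
\<close>

definition proper_gaps :: "(int \<Rightarrow> real) \<Rightarrow> bool" where
  "proper_gaps t \<longleftrightarrow> (\<forall>k. 0 \<le> t k) \<and> two_sided (partial_sum t)"

lemma mono_partial_sum:
  assumes "\<And>k. 0 \<le> t k"
  shows "mono (partial_sum t)"
proof (rule int_mono_if_steps)
  fix k show "partial_sum t (k - 1) \<le> partial_sum t k" using partial_sum_step[of t k] assms[of k] by linarith
qed

definition renewal_points :: "(int \<Rightarrow> real) \<Rightarrow> real set" where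
  "renewal_points t = partial_sum t ` (if proper_gaps t then UNIV else {})"

lemma measurable_partial_sum[measurable]: "(\<lambda>t. partial_sum t k) \<in> borel_measurable seq_space"
  unfolding partial_sum_def using measurable_seq_component by simp

lemma pred_proper_gaps[measurable]: "Measurable.pred seq_space proper_gaps"
proof -
  have "Measurable.pred seq_space (\<lambda>t. 0 \<le> t k)" for k
    using measurable_seq_component[of k] by simp
  then show ?thesis unfolding proper_gaps_def[abs_def] two_sided_def by measurable
qed

lemma measurable_renewal_points[measurable]: "renewal_points \<in> seq_space \<rightarrow>\<^sub>M configs"
  unfolding renewal_points_def[abs_def]
proof (rule measurable_configs_enumeration)
  fix t n assume "t \<in> space seq_space"
  show "finite {k \<in> if proper_gaps t then UNIV else {}. \<bar>partial_sum t k\<bar> \<le> real n}"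
    using finite_two_sided[OF mono_partial_sum, of t "real n"] by (auto simp: proper_gaps_def)
qed simp_all

section \<open>Palm distributions of stationary renewal processes\<close>

definition recentre :: "real \<Rightarrow> real set \<Rightarrow> real set" where
  "recentre t S = (\<lambda>x. x - t) ` S"

lemma recentre_recentre: "recentre s (recentre t S) = recentre (t + s) S"
  by (auto simp: recentre_def image_image algebra_simps)

lemma recentre_0[simp]: "recentre 0 S = S" by (simp add: recentre_def)

lemma measurable_recentre[measurable (raw)]:
  assumes "f \<in> M \<rightarrow>\<^sub>M configs" "g \<in> borel_measurable M"
  shows "(\<lambda>\<omega>. recentre (g \<omega>) (f \<omega>)) \<in> M \<rightarrow>\<^sub>M configs"
proof -
  have "(\<lambda>\<omega>. (f \<omega>, - g \<omega>)) \<in> M \<rightarrow>\<^sub>M configs \<Otimes>\<^sub>M borel" using assms by simp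
  from measurable_compose[OF this measurable_translate] show ?thesis by (simp add: recentre_def)
qed

lemma recentre_in_configs: "S \<in> space configs \<Longrightarrow> recentre t S \<in> space configs"
  using measurable_space[OF measurable_recentre[OF measurable_ident measurable_const[of t borel configs]], of S] by simp

text \<open>
  The integral of \<open>f\<close> over the configurations that are seen from the locations in \<open>[a, b)\<close>.
\<close>

definition window_integral :: "(real set \<Rightarrow> ennreal) \<Rightarrow> real set \<Rightarrow> real \<Rightarrow> real \<Rightarrow> ennreal" where
  "window_integral f S a b = (\<integral>\<^sup>+t. (if a \<le> t \<and> t < b then f (recentre t S) else 0) \<partial>lborel)"

lemma measurable_window_integral:
  assumes [measurable]: "f \<in> borel_measurable configs" "S \<in> M \<rightarrow>\<^sub>M configs" "a \<in> borel_measurable M" "b \<in> borel_measurable M"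
  shows "(\<lambda>\<omega>. window_integral f (S \<omega>) (a \<omega>) (b \<omega>)) \<in> borel_measurable M"
  unfolding window_integral_def by (rule lborel.borel_measurable_nn_integral) (simp add: split_beta')

text \<open>
  When \<open>0\<close> is a point of \<open>S\<close>, this is the integral over the gap to the right of the origin.
\<close>

definition gap_integral :: "(real set \<Rightarrow> ennreal) \<Rightarrow> real set \<Rightarrow> ennreal" where
  "gap_integral f S = window_integral f S 0 (point_at S 1)"

lemma measurable_gap_integral[measurable]:
  assumes "f \<in> borel_measurable configs"
  shows "gap_integral f \<in> borel_measurable configs"
  unfolding gap_integral_def[abs_def] using assms by (intro measurable_window_integral) simp_all

lemma measurable_recentre_const:
  assumes "f \<in> borel_measurable configs" "S \<in> space configs"
  shows "(\<lambda>t. f (recentre t S)) \<in> borel_measurable borel"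
  by (rule measurable_compose[OF _ assms(1)]) (intro measurable_recentre measurable_const assms, simp)

lemma window_integral_add:
  assumes f: "f \<in> borel_measurable configs" "S \<in> space configs" and "a \<le> b" "b \<le> c"
  shows "window_integral f S a c = window_integral f S a b + window_integral f S b c"
proof -
  note [measurable] = measurable_recentre_const[OF f]
  show ?thesis
    unfolding window_integral_def using assms(3,4)
    by (subst nn_integral_add[symmetric]) (auto intro!: nn_integral_cong)
qed

lemma window_integral_recentre:
  assumes f: "f \<in> borel_measurable configs" "S \<in> space configs"
  shows "window_integral f (recentre s S) a b = window_integral f S (s + a) (s + b)"
proof -
  note [measurable] = measurable_recentre_const[OF f]
  have "window_integral f S (s + a) (s + b)
      = (\<integral>\<^sup>+t. (if s + a \<le> s + t \<and> s + t < s + b then f (recentre (s + t) S) else 0) \<partial>lborel)"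
    unfolding window_integral_def by (subst nn_integral_real_affine[where c=1 and t=s]) (simp_all cong: if_cong)
  then show ?thesis by (simp add: window_integral_def recentre_recentre cong: if_cong)
qed

locale two_sided_config = config +
  assumes inds_UNIV: "point_indices T = UNIV"
begin

abbreviation "p \<equiv> nth_point T"

lemma in_inds[simp]: "k \<in> point_indices T" by (simp add: inds_UNIV)

lemma point_at_eq: "point_at T k = p k" by (simp add: point_at_def)

lemma strict_mono_p: "strict_mono p" by (rule strict_monoI) (simp add: nth_less)

lemma p_mono: "j \<le> k \<Longrightarrow> p j \<le> p k" using strict_mono_less_eq[OF strict_mono_p] by simp

lemma range_p: "range p = T" using T_eq by (simp add: inds_UNIV)

lemma p_around_0: "p 0 \<le> 0" "0 < p 1"
  using nth_le_iff[of 0 0] nth_le_iff[of 1 0] by (auto simp: point_index_def not_le)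

lemma two_sided_p: "two_sided p"
  unfolding two_sided_def
proof (intro conjI allI)
  fix n :: nat
  show "\<exists>k. real n < p k" using nth_le_iff[of "idx (real n) + 1" "real n"] by (intro exI[of _ "idx (real n) + 1"]) (simp add: not_le)
  show "\<exists>k. p k < - real n"
    using nth_le_iff[of "idx (- real n - 1)" "- real n - 1"] by (intro exI[of _ "idx (- real n - 1)"]) auto
qed

lemma recentre_two_sided:
  assumes a: "p k \<le> a" "a < p (k + 1)"
  shows "two_sided_config (recentre a T)" "nth_point (recentre a T) j = p (k + j) - a"
proof -
  interpret S: config "recentre a T" by unfold_locales (rule recentre_in_configs[OF T])
  have "strict_mono (\<lambda>j. p (k + j) - a)"
    using strict_mono_less[OF strict_mono_p] by (intro strict_monoI) simp
  moreover have "recentre a T = range (\<lambda>j. p (k + j) - a)"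
  proof -
    have "p i - a \<in> range (\<lambda>j. p (k + j) - a)" for i
      by (rule range_eqI[of _ _ "i - k"]) simp
    then have "range (\<lambda>j. p (k + j) - a) = (\<lambda>x. x - a) ` range p" by auto
    then show ?thesis by (simp add: recentre_def range_p)
  qed
  ultimately have *: "nth_point (recentre a T) j = p (k + j) - a" "point_indices (recentre a T) = UNIV" for j
    using a by (intro S.nth_point_enumeration[of "\<lambda>j. p (k + j) - a"]; simp)+
  show "two_sided_config (recentre a T)" by unfold_locales (rule *)
  show "nth_point (recentre a T) j = p (k + j) - a" by (rule *)
qed

context
  fixes f :: "real set \<Rightarrow> ennreal"
  assumes f[measurable]: "f \<in> borel_measurable configs"
begin

abbreviation "between_integral \<equiv> window_integral f T"

lemma gap_integral_recentre:
  assumes a: "p k \<le> a" "a < p (k + 1)"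
  shows "gap_integral f (recentre a T) = between_integral a (p (k + 1))"
proof -
  interpret S: two_sided_config "recentre a T" by (rule recentre_two_sided[OF a])
  show ?thesis
    unfolding gap_integral_def S.point_at_eq recentre_two_sided(2)[OF a] window_integral_recentre[OF f T] by simp
qed

text \<open>
  With \<open>m\<close> points in \<open>(0, 1]\<close>, the windows \<open>[0, 1)\<close> and \<open>[1, p (m + 1))\<close> on the left cover the same
  interval as the window \<open>[0, p 1)\<close> and the gaps that begin at the points in \<open>(0, 1]\<close> on the right.
  Both sides thus are the integral over \<open>[0, p (m + 1))\<close>.
\<close>

lemma gap_integral_balance:
  "gap_integral f (recentre 1 T) + between_integral 0 1
    = gap_integral f T + (\<Sum>x\<in>T \<inter> {0<..1}. gap_integral f (recentre x T))"
proof -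
  define m where "m = idx 1"
  have m: "0 \<le> m" using idx_mono[of 0 1] by (simp add: m_def point_index_def)
  have pm: "p m \<le> 1" "1 < p (m + 1)"
    using nth_le_iff[of m 1] nth_le_iff[of "m + 1" 1] by (auto simp: m_def not_le)
  have pk: "p k < p (k + 1)" for k using strict_mono_less[OF strict_mono_p] by simp
  have T1: "T \<inter> {0<..1} = p ` {1..m}"
  proof -
    have "0 < p k \<longleftrightarrow> 1 \<le> k" "p k \<le> 1 \<longleftrightarrow> k \<le> m" for k
      using nth_le_iff[of k 0] nth_le_iff[of k 1] by (auto simp: m_def point_index_def not_le[symmetric])
    then have "p ` {1..m} = range p \<inter> {0<..1}" by auto
    then show ?thesis by (simp add: range_p)
  qed
  have "(\<Sum>x\<in>T \<inter> {0<..1}. gap_integral f (recentre x T)) = (\<Sum>k\<in>{1..m}. gap_integral f (recentre (p k) T))"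
    unfolding T1 using strict_mono_imp_inj_on[OF strict_mono_p] by (subst sum.reindex) (auto intro: inj_on_subset)
  also have "\<dots> = (\<Sum>k\<in>{1..m}. between_integral (p k) (p (k + 1)))"
    by (intro sum.cong refl gap_integral_recentre pk order_refl)
  also have "\<dots> = between_integral (p 1) (p (m + 1))"
    using m
  proof (induction m rule: int_ge_induct)
    case base
    have "(\<lambda>t. if p 1 \<le> t \<and> t < p 1 then f (recentre t T) else 0) = (\<lambda>_. 0)" by (intro ext) auto
    then show ?case by (simp add: window_integral_def)
  next
    case (step i)
    have "{1..i + 1} = insert (i + 1) {1..i}" using step by auto
    moreover have "between_integral (p 1) (p (i + 1 + 1)) = between_integral (p 1) (p (i + 1)) + between_integral (p (i + 1)) (p (i + 1 + 1))"
      using step by (intro window_integral_add[OF f T] p_mono) auto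
    ultimately show ?case using step by (simp add: add.commute)
  qed
  finally have S: "(\<Sum>x\<in>T \<inter> {0<..1}. gap_integral f (recentre x T)) = between_integral (p 1) (p (m + 1))" .
  have "gap_integral f T = between_integral 0 (p 1)"
    using gap_integral_recentre[of 0 0] p_around_0 by simp
  moreover have "gap_integral f (recentre 1 T) = between_integral 1 (p (m + 1))"
    by (rule gap_integral_recentre[OF pm])
  moreover have "between_integral 0 (p (m + 1)) = between_integral 0 1 + between_integral 1 (p (m + 1))"
    using pm by (intro window_integral_add[OF f T]) auto
  moreover have "between_integral 0 (p (m + 1)) = between_integral 0 (p 1) + between_integral (p 1) (p (m + 1))"
    using p_around_0 m by (intro window_integral_add[OF f T] p_mono) auto
  ultimately show ?thesis by (simp add: S add.commute)
qed

end

end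

text \<open>
  At indices without a point, the enumeration takes one and the same unspecified value. As the set of
  indices is an interval, a missing index has a missing neighbour, and the gap between the two
  would be 0.
\<close>

lemma point_indices_UNIV_if_interpoint_pos:
  assumes T: "T \<in> space configs" and pos: "\<And>k. 0 < interpoint k T"
  shows "point_indices T = UNIV"
proof -
  interpret config T by unfold_locales (rule T)
  have "k \<in> inds" for k
  proof (rule ccontr)
    assume k: "k \<notin> inds"
    define c :: real where "c = (THE x. False)"
    have c: "nth_point T j = c" if "j \<notin> inds" for j
    proof -
      have "(\<lambda>x. x \<in> T \<and> point_index T x = j) = (\<lambda>x. False)" using that by (auto simp: point_indices_def)
      then show ?thesis unfolding nth_point_def c_def by simp
    qed
    have "k + 1 \<notin> inds \<or> k - 1 \<notin> inds" using inds_convex[of "k - 1" "k + 1" k] k by auto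
    then show False using c[of k] c[of "k + 1"] c[of "k - 1"] k pos[of k] pos[of "k + 1"]
      by (auto simp: interpoint_def)
  qed
  then show ?thesis by auto
qed

lemma two_sided_configI:
  "T \<in> space configs \<Longrightarrow> point_indices T = UNIV \<Longrightarrow> two_sided_config T"
  by unfold_locales

lemma point_indices_recentre_UNIV:
  assumes "T \<in> space configs"
  shows "point_indices (recentre a T) = UNIV \<longleftrightarrow> point_indices T = UNIV"
proof -
  have *: "point_indices (recentre a S) = UNIV" if S: "S \<in> space configs" "point_indices S = UNIV" for a S
  proof -
    interpret two_sided_config S by (rule two_sided_configI[OF S])
    define k where "k = idx a"
    have "p k \<le> a" "a < p (k + 1)" using nth_le_iff[of k a] nth_le_iff[of "k + 1" a] by (auto simp: k_def not_le)
    from recentre_two_sided(1)[OF this] show ?thesis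
      by (simp add: two_sided_config_def two_sided_config_axioms_def)
  qed
  show ?thesis
    using *[OF assms, of a] *[OF recentre_in_configs[OF assms, of a], of "- a"] by (auto simp: recentre_recentre)
qed


text \<open>
  Summing over indices instead of points makes the sum a measurable function of the configuration.
\<close>

lemma sum_points_eq_nn_integral:
  fixes g :: "real set \<Rightarrow> ennreal"
  assumes c: "S \<in> space configs"
  shows "(\<Sum>x\<in>S \<inter> {0<..1}. g (recentre x S))
    = (\<integral>\<^sup>+k. (if k \<in> point_indices S \<and> 0 < point_at S k \<and> point_at S k \<le> 1 then g (recentre (point_at S k) S) else 0) \<partial>count_space UNIV)"
proof -
  interpret config S by (rule configD[OF c])
  let ?A = "{k. k \<in> point_indices S \<and> 0 < point_at S k \<and> point_at S k \<le> 1}"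
  have "finite ?A" by (rule finite_subset[OF _ finite_point_at[OF c, of 1]]) auto
  then have "(\<integral>\<^sup>+k. (if k \<in> point_indices S \<and> 0 < point_at S k \<and> point_at S k \<le> 1 then g (recentre (point_at S k) S) else 0) \<partial>count_space UNIV)
      = (\<Sum>k\<in>?A. (if k \<in> point_indices S \<and> 0 < point_at S k \<and> point_at S k \<le> 1 then g (recentre (point_at S k) S) else 0))"
    by (intro nn_integral_count_space') auto
  also have "\<dots> = (\<Sum>k\<in>?A. g (recentre (point_at S k) S))" by (intro sum.cong) auto
  also have "\<dots> = (\<Sum>x\<in>S \<inter> {0<..1}. g (recentre x S))"
  proof (rule sum.reindex_bij_betw)
    have "inj_on (point_at S) ?A"
    proof (rule inj_onI)
      fix i j assume "i \<in> ?A" "j \<in> ?A" "point_at S i = point_at S j"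
      then have i: "i \<in> inds" and j: "j \<in> inds" and eq: "nth_point S i = nth_point S j"
        by (simp_all add: point_at_def)
      show "i = j" using arg_cong[OF eq, of idx] unfolding idx_nth[OF i] idx_nth[OF j] .
    qed
    moreover have "point_at S ` ?A = S \<inter> {0<..1}"
    proof (intro set_eqI iffI)
      fix x assume "x \<in> S \<inter> {0<..1}"
      then show "x \<in> point_at S ` ?A"
        by (intro image_eqI[of _ _ "idx x"]) (auto simp: point_at_def nth_point_idx point_indices_def)
    qed (auto simp: point_at_def nth_in)
    ultimately show "bij_betw (point_at S) ?A (S \<inter> {0<..1})" by (simp add: bij_betw_def)
  qed
  finally show ?thesis ..
qed

lemma measurable_sum_points_integrand:
  assumes [measurable]: "g \<in> borel_measurable configs" "f \<in> M \<rightarrow>\<^sub>M configs"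
  shows "(\<lambda>(\<omega>, k). if k \<in> point_indices (f \<omega>) \<and> 0 < point_at (f \<omega>) k \<and> point_at (f \<omega>) k \<le> 1
      then g (recentre (point_at (f \<omega>) k) (f \<omega>)) else 0) \<in> borel_measurable (M \<Otimes>\<^sub>M count_space UNIV)"
  unfolding split_beta'
  by (rule measurable_compose_countable[where g=snd and f="\<lambda>i z. if i \<in> point_indices (f (fst z)) \<and> 0 < point_at (f (fst z)) i \<and> point_at (f (fst z)) i \<le> 1
      then g (recentre (point_at (f (fst z)) i) (f (fst z))) else 0"]) measurable

lemma measurable_sum_points:
  fixes g :: "real set \<Rightarrow> ennreal"
  assumes g: "g \<in> borel_measurable configs"
  shows "(\<lambda>S. \<Sum>x\<in>S \<inter> {0<..1}. g (recentre x S)) \<in> borel_measurable configs"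
proof -
  interpret C: sigma_finite_measure "count_space (UNIV :: int set)"
    by (rule sigma_finite_measure_count_space_countable) simp
  have "(\<lambda>S. \<integral>\<^sup>+k. (if k \<in> point_indices S \<and> 0 < point_at S k \<and> point_at S k \<le> 1
      then g (recentre (point_at S k) S) else 0) \<partial>count_space UNIV) \<in> borel_measurable configs"
    by (rule C.borel_measurable_nn_integral) (rule measurable_sum_points_integrand[OF g measurable_ident_sets[OF refl]])
  then show ?thesis
    by (rule measurable_cong[THEN iffD1, rotated]) (rule sum_points_eq_nn_integral[symmetric])
qed

locale renewal_process = N: prob_space N for N :: "'b measure" +
  fixes T :: "'b \<Rightarrow> real set" and F :: "real measure"
  assumes renewal: "stationary_renewal_process N T F"
    and F: "prob_space F" "sets F = sets borel" "AE t in F. 0 < t"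
begin

abbreviation "lam \<equiv> intensity N T"

lemma T_measurable[measurable]: "T \<in> N \<rightarrow>\<^sub>M configs"
  and lam: "0 < lam" "lam < \<infinity>" and T_nonempty: "AE \<omega> in N. T \<omega> \<noteq> {}"
  using renewal by (auto simp: stationary_renewal_process_def stationary_process_def)

definition P :: "real set measure" where
  "P = (SOME P. prob_space P \<and> palm_distribution N T P \<and> iid P interpoint F)"

lemma P: "prob_space P" "palm_distribution N T P" "iid P interpoint F"
proof -
  have "\<exists>P. prob_space P \<and> palm_distribution N T P \<and> iid P interpoint F"
    using renewal by (simp add: stationary_renewal_process_def)
  from someI_ex[OF this] show "prob_space P" "palm_distribution N T P" "iid P interpoint F"
    unfolding P_def by blast+
qed

sublocale P: prob_space P by (rule P)

lemma sets_P[measurable_cong, simp]: "sets P = sets configs"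
  using P(2) by (simp add: palm_distribution_def)

lemma space_P[simp]: "space P = space configs"
  by (rule sets_eq_imp_space_eq) simp

lemma measurable_interpoint[measurable]: "interpoint k \<in> borel_measurable configs"
proof -
  have "interpoint k \<in> borel_measurable P"
    using P(3) unfolding iid_def P.indep_vars_def by auto
  then show ?thesis by (simp add: measurable_cong_sets[OF sets_P refl])
qed

lemma stationary_integral:
  assumes [measurable]: "f \<in> borel_measurable configs"
  shows "(\<integral>\<^sup>+\<omega>. f (recentre s (T \<omega>)) \<partial>N) = (\<integral>\<^sup>+\<omega>. f (T \<omega>) \<partial>N)"
proof -
  have "distr N configs (\<lambda>\<omega>. (\<lambda>x. x + (- s)) ` T \<omega>) = distr N configs T"
    using renewal unfolding stationary_renewal_process_def stationary_process_def by blast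
  then have "distr N configs (\<lambda>\<omega>. recentre s (T \<omega>)) = distr N configs T" by (simp add: recentre_def)
  then have "(\<integral>\<^sup>+S. f S \<partial>distr N configs (\<lambda>\<omega>. recentre s (T \<omega>))) = (\<integral>\<^sup>+S. f S \<partial>distr N configs T)" by simp
  then show ?thesis by (simp add: nn_integral_distr)
qed

text \<open>
  Both sides are integrals of \<open>h\<close> with respect to measures that agree on indicator functions by the
  definition of the Palm distribution: on the right, push forward the restriction of the product of \<open>N\<close>
  with the counting measure on the indices.
\<close>

lemma palm_integral:
  assumes [measurable]: "h \<in> borel_measurable configs"
  shows "lam * (\<integral>\<^sup>+S. h S \<partial>P) = (\<integral>\<^sup>+\<omega>. (\<Sum>x\<in>T \<omega> \<inter> {0<..1}. h (recentre x (T \<omega>))) \<partial>N)"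
proof -
  let ?C = "count_space (UNIV :: int set)"
  interpret C: sigma_finite_measure ?C by (rule sigma_finite_measure_count_space_countable) simp
  define E where "E z \<longleftrightarrow> snd z \<in> point_indices (T (fst z)) \<and> 0 < point_at (T (fst z)) (snd z) \<and> point_at (T (fst z)) (snd z) \<le> 1" for z
  define Y where "Y z = recentre (point_at (T (fst z)) (snd z)) (T (fst z))" for z
  have [measurable]: "Measurable.pred (N \<Otimes>\<^sub>M ?C) E"
    unfolding E_def[abs_def]
    by (rule measurable_compose_countable[where g=snd and f="\<lambda>i z. i \<in> point_indices (T (fst z)) \<and> 0 < point_at (T (fst z)) i \<and> point_at (T (fst z)) i \<le> 1"]) measurable
  have [measurable]: "Y \<in> N \<Otimes>\<^sub>M ?C \<rightarrow>\<^sub>M configs"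
    unfolding Y_def[abs_def]
    by (rule measurable_compose_countable[where g=snd and f="\<lambda>i z. recentre (point_at (T (fst z)) i) (T (fst z))"]) measurable
  \<comment> \<open>The measure obtained by choosing every point in \<open>(0, 1]\<close> with mass 1 and moving it to the origin.\<close>
  define Q where "Q = distr (density (N \<Otimes>\<^sub>M ?C) (\<lambda>z. if E z then 1 else 0)) configs Y"
  have Q: "(\<integral>\<^sup>+S. g S \<partial>Q) = (\<integral>\<^sup>+\<omega>. (\<Sum>x\<in>T \<omega> \<inter> {0<..1}. g (recentre x (T \<omega>))) \<partial>N)"
    if [measurable]: "g \<in> borel_measurable configs" for g
  proof -
    have "(\<integral>\<^sup>+S. g S \<partial>Q) = (\<integral>\<^sup>+z. (if E z then 1 else 0) * g (Y z) \<partial>(N \<Otimes>\<^sub>M ?C))"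
      unfolding Q_def by (simp add: nn_integral_distr nn_integral_density)
    also have "\<dots> = (\<integral>\<^sup>+\<omega>. \<integral>\<^sup>+k. (if E (\<omega>, k) then 1 else 0) * g (Y (\<omega>, k)) \<partial>?C \<partial>N)"
      by (rule C.nn_integral_fst[symmetric]) simp
    also have "\<dots> = (\<integral>\<^sup>+\<omega>. (\<Sum>x\<in>T \<omega> \<inter> {0<..1}. g (recentre x (T \<omega>))) \<partial>N)"
    proof (rule nn_integral_cong)
      fix \<omega> assume "\<omega> \<in> space N"
      then have "T \<omega> \<in> space configs" by (rule measurable_space[OF T_measurable])
      then show "(\<integral>\<^sup>+k. (if E (\<omega>, k) then 1 else 0) * g (Y (\<omega>, k)) \<partial>?C) = (\<Sum>x\<in>T \<omega> \<inter> {0<..1}. g (recentre x (T \<omega>)))"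
        unfolding sum_points_eq_nn_integral[OF \<open>T \<omega> \<in> space configs\<close>]
        by (intro nn_integral_cong) (auto simp: E_def Y_def)
    qed
    finally show ?thesis .
  qed
  have "scale_measure lam P = Q"
  proof (rule measure_eqI)
    show "sets (scale_measure lam P) = sets Q" by (simp add: Q_def)
    fix A assume "A \<in> sets (scale_measure lam P)"
    then have A[measurable]: "A \<in> sets configs" by simp
    have "emeasure (scale_measure lam P) A = (\<integral>\<^sup>+ \<omega>. of_nat (card {x \<in> T \<omega> \<inter> {0<..1}. (\<lambda>y. y - x) ` T \<omega> \<in> A}) \<partial>N)"
      using P(2) A by (simp add: palm_distribution_def)
    also have "\<dots> = (\<integral>\<^sup>+\<omega>. (\<Sum>x\<in>T \<omega> \<inter> {0<..1}. indicator A (recentre x (T \<omega>))) \<partial>N)"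
    proof (rule nn_integral_cong)
      fix \<omega> assume \<omega>: "\<omega> \<in> space N"
      have "finite (T \<omega> \<inter> {0<..1})"
        by (rule finite_config_Int_bounded[OF measurable_space[OF T_measurable \<omega>] bounded_Ioc])
      moreover have set: "{x \<in> T \<omega> \<inter> {0<..1}. Q x} = T \<omega> \<inter> {0<..1} \<inter> {x. Q x}" for Q by auto
      ultimately show "of_nat (card {x \<in> T \<omega> \<inter> {0<..1}. (\<lambda>y. y - x) ` T \<omega> \<in> A}) = (\<Sum>x\<in>T \<omega> \<inter> {0<..1}. indicator A (recentre x (T \<omega>)) :: ennreal)"
        by (simp add: indicator_def recentre_def sum.If_cases set)
    qed
    also have "\<dots> = emeasure Q A"
      using Q[of "indicator A"] by (simp add: Q_def)
    finally show "emeasure (scale_measure lam P) A = emeasure Q A" .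
  qed
  then have "lam * (\<integral>\<^sup>+S. h S \<partial>P) = (\<integral>\<^sup>+S. h S \<partial>Q)"
    by (simp add: nn_integral_scale_measure[symmetric])
  then show ?thesis by (simp add: Q)
qed

lemma palm_origin: "AE S in P. 0 \<in> S"
proof -
  have [measurable]: "Measurable.pred configs (\<lambda>S. 0 \<in> S)"
  proof -
    have [measurable]: "(\<lambda>S. card (S \<inter> {0})) \<in> configs \<rightarrow>\<^sub>M count_space UNIV"
      by (rule measurable_card_config_Int) simp_all
    have "Measurable.pred configs (\<lambda>S. card (S \<inter> {0}) \<noteq> 0)" by measurable
    then show ?thesis by (rule measurable_cong[THEN iffD1, rotated]) (auto simp: card_eq_0_iff)
  qed
  have "lam * (\<integral>\<^sup>+S. (if 0 \<in> S then 0 else 1) \<partial>P) = 0"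
    by (subst palm_integral) (auto simp: recentre_def image_iff intro!: nn_integral_zero' sum.neutral AE_I2)
  then have "(\<integral>\<^sup>+S. (if 0 \<in> S then 0 else 1) \<partial>P) = 0" using lam by auto
  then have "AE S in P. (if 0 \<in> S then 0 else 1) = (0::ennreal)" by (subst (asm) nn_integral_0_iff_AE) auto
  then show ?thesis by eventually_elim (simp split: if_splits)
qed

lemma palm_interpoint_pos: "AE S in P. \<forall>k. 0 < interpoint k S"
proof -
  have "AE S in P. 0 < interpoint k S" for k
  proof -
    have law: "distr P borel (interpoint k) = F" using P(3) by (simp add: iid_def)
    have "AE t in distr P borel (interpoint k). 0 < t" unfolding law by (rule F(3))
    then show ?thesis by (rule AE_distrD[rotated]) simp
  qed
  then show ?thesis by (simp add: AE_all_countable)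
qed

lemma palm_two_sided: "AE S in P. two_sided_config S"
proof -
  have "AE S in P. S \<in> space configs" using AE_space[of P] by simp
  with palm_interpoint_pos show ?thesis
    by eventually_elim (auto intro!: two_sided_configI point_indices_UNIV_if_interpoint_pos)
qed

lemma two_sided_iff: "S \<in> space configs \<Longrightarrow> two_sided_config S \<longleftrightarrow> (\<forall>k. k \<in> point_indices S)"
  by (auto simp: two_sided_config_def two_sided_config_axioms_def config_def)

text \<open>
  Having points arbitrarily far to both sides is invariant under translations and holds for the Palm
  distribution. So configurations without this property have no point in \<open>(0, 1]\<close> almost surely and, by
  stationarity, no point in any \<open>(n, n + 1]\<close>; they would be empty.
\<close>

lemma process_two_sided: "AE \<omega> in N. two_sided_config (T \<omega>)"
proof -
  define g :: "real set \<Rightarrow> ennreal" where "g S = (if (\<exists>k. k \<notin> point_indices S) then 1 else 0)" for S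
  have [measurable]: "g \<in> borel_measurable configs" unfolding g_def[abs_def] by measurable
  have c: "T \<omega> \<in> space configs" if "\<omega> \<in> space N" for \<omega> by (rule measurable_space[OF T_measurable that])
  have g_shift: "g (recentre s S) = g S" if "S \<in> space configs" for s S
  proof -
    have "g S = (if point_indices S = UNIV then 0 else 1)" for S by (auto simp: g_def)
    then show ?thesis using point_indices_recentre_UNIV[OF that, of s] by simp
  qed
  have "AE S in P. g S = 0"
    using palm_two_sided AE_space[of P] by eventually_elim (simp add: g_def two_sided_iff)
  then have "(\<integral>\<^sup>+S. g S \<partial>P) = 0" by (subst nn_integral_0_iff_AE) auto
  then have "(\<integral>\<^sup>+\<omega>. (\<Sum>x\<in>T \<omega> \<inter> {0<..1}. g (recentre x (T \<omega>))) \<partial>N) = 0"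
    by (simp add: palm_integral[symmetric])
  also have "(\<integral>\<^sup>+\<omega>. (\<Sum>x\<in>T \<omega> \<inter> {0<..1}. g (recentre x (T \<omega>))) \<partial>N) = (\<integral>\<^sup>+\<omega>. of_nat (card (T \<omega> \<inter> {0<..1})) * g (T \<omega>) \<partial>N)"
    by (intro nn_integral_cong) (simp add: g_shift c)
  finally have zero: "(\<integral>\<^sup>+\<omega>. of_nat (card (T \<omega> \<inter> {0<..1})) * g (T \<omega>) \<partial>N) = 0" .
  note [measurable] = measurable_card_config_Int[of "{0<..1}"]
  have [measurable]: "(\<lambda>S. of_nat (card (S \<inter> {0<..1})) * g S) \<in> borel_measurable configs" by (simp add: bounded_Ioc)
  have "AE \<omega> in N. of_nat (card (recentre (real_of_int n) (T \<omega>) \<inter> {0<..1})) * g (T \<omega>) = 0" for n :: int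
  proof -
    have "(\<integral>\<^sup>+\<omega>. of_nat (card (recentre (real_of_int n) (T \<omega>) \<inter> {0<..1})) * g (recentre (real_of_int n) (T \<omega>)) \<partial>N) = 0"
      using stationary_integral[of "\<lambda>S. of_nat (card (S \<inter> {0<..1})) * g S" "real_of_int n"] zero by simp
    then have "AE \<omega> in N. of_nat (card (recentre (real_of_int n) (T \<omega>) \<inter> {0<..1})) * g (recentre (real_of_int n) (T \<omega>)) = 0"
      by (subst (asm) nn_integral_0_iff_AE) (simp_all add: bounded_Ioc)
    then show ?thesis using AE_space by eventually_elim (simp add: g_shift c)
  qed
  then have "AE \<omega> in N. \<forall>n::int. of_nat (card (recentre (real_of_int n) (T \<omega>) \<inter> {0<..1})) * g (T \<omega>) = 0"
    by (subst AE_all_countable) (rule allI)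
  then show ?thesis
    using T_nonempty AE_space
  proof eventually_elim
    case (elim \<omega>)
    then obtain x where x: "x \<in> T \<omega>" by auto
    \<comment> \<open>The integer with \<open>n < x \<le> n + 1\<close>.\<close>
    define n where "n = \<lceil>x\<rceil> - 1"
    have "x - real_of_int n \<in> recentre (real_of_int n) (T \<omega>) \<inter> {0<..1}"
      using x by (auto simp: recentre_def n_def) linarith+
    moreover have "finite (recentre (real_of_int n) (T \<omega>) \<inter> {0<..1})"
      by (rule finite_config_Int_bounded[OF recentre_in_configs[OF c[OF elim(3)]] bounded_Ioc])
    ultimately have "card (recentre (real_of_int n) (T \<omega>) \<inter> {0<..1}) \<noteq> 0" by auto
    then have "g (T \<omega>) = 0" using elim(1) by (metis mult_eq_0_iff of_nat_eq_0_iff)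
    then show ?case by (simp add: g_def two_sided_iff c[OF elim(3)] split: if_splits)
  qed
qed


end

section \<open>The inversion formula\<close>

context renewal_process begin

text \<open>
  Take expectations in the balance equation. By stationarity the two boundary terms
  \<open>gap_integral f (recentre 1 T)\<close> and \<open>gap_integral f T\<close> have the same expectation, and the window \<open>[0, 1)\<close>
  contributes the expectation of \<open>f T\<close>. Cancelling the boundary terms needs finiteness.
\<close>

lemma inversion_if_finite:
  assumes f[measurable]: "f \<in> borel_measurable configs"
    and fin: "(\<integral>\<^sup>+\<omega>. gap_integral f (T \<omega>) \<partial>N) \<noteq> \<infinity>"
  shows "(\<integral>\<^sup>+\<omega>. f (T \<omega>) \<partial>N) = lam * (\<integral>\<^sup>+S. gap_integral f S \<partial>P)"
proof -
  interpret NL: pair_sigma_finite N lborel by unfold_locales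
  have m: "(\<lambda>\<omega>. window_integral f (T \<omega>) 0 1) \<in> borel_measurable N" by (intro measurable_window_integral) simp_all
  have "(\<integral>\<^sup>+\<omega>. window_integral f (T \<omega>) 0 1 \<partial>N) = (\<integral>\<^sup>+t. \<integral>\<^sup>+\<omega>. (if 0 \<le> t \<and> t < 1 then f (recentre t (T \<omega>)) else 0) \<partial>N \<partial>lborel)"
    unfolding window_integral_def by (rule NL.Fubini'[symmetric]) (simp add: split_beta')
  also have "\<dots> = (\<integral>\<^sup>+t. (\<integral>\<^sup>+\<omega>. f (T \<omega>) \<partial>N) * indicator {0..<1} t \<partial>(lborel :: real measure))"
  proof (rule nn_integral_cong)
    fix t :: real assume "t \<in> space lborel"
    show "(\<integral>\<^sup>+\<omega>. (if 0 \<le> t \<and> t < 1 then f (recentre t (T \<omega>)) else 0) \<partial>N) = (\<integral>\<^sup>+\<omega>. f (T \<omega>) \<partial>N) * indicator {0..<1} t"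
      using stationary_integral[OF f, of t] by (cases "0 \<le> t \<and> t < 1") (auto simp: indicator_def)
  qed
  also have "\<dots> = (\<integral>\<^sup>+\<omega>. f (T \<omega>) \<partial>N)"
    by (simp add: nn_integral_cmult_indicator)
  finally have mean: "(\<integral>\<^sup>+\<omega>. window_integral f (T \<omega>) 0 1 \<partial>N) = (\<integral>\<^sup>+\<omega>. f (T \<omega>) \<partial>N)" .
  have "(\<integral>\<^sup>+\<omega>. gap_integral f (T \<omega>) \<partial>N) + (\<integral>\<^sup>+\<omega>. f (T \<omega>) \<partial>N)
      = (\<integral>\<^sup>+\<omega>. gap_integral f (recentre 1 (T \<omega>)) \<partial>N) + (\<integral>\<^sup>+\<omega>. window_integral f (T \<omega>) 0 1 \<partial>N)"
    by (simp add: mean stationary_integral)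
  also have "\<dots> = (\<integral>\<^sup>+\<omega>. gap_integral f (recentre 1 (T \<omega>)) + window_integral f (T \<omega>) 0 1 \<partial>N)"
    using m by (simp add: nn_integral_add)
  also have "\<dots> = (\<integral>\<^sup>+\<omega>. gap_integral f (T \<omega>) + (\<Sum>x\<in>T \<omega> \<inter> {0<..1}. gap_integral f (recentre x (T \<omega>))) \<partial>N)"
    by (intro nn_integral_cong_AE eventually_mono[OF process_two_sided] two_sided_config.gap_integral_balance f)
  also have "\<dots> = (\<integral>\<^sup>+\<omega>. gap_integral f (T \<omega>) \<partial>N) + lam * (\<integral>\<^sup>+S. gap_integral f S \<partial>P)"
    unfolding palm_integral[OF measurable_gap_integral[OF f]]
    by (rule nn_integral_add) (simp_all add: measurable_compose[OF T_measurable measurable_sum_points[OF measurable_gap_integral[OF f]]])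
  finally show ?thesis using fin by (simp add: ennreal_add_left_cancel)
qed

text \<open>
  The expected gap integral can be infinite even for bounded \<open>f\<close>, namely when the gaps have infinite
  variance. Restricting \<open>f\<close> to configurations whose first positive point is at most \<open>n\<close> leaves at most a
  length \<open>n\<close> of the gap, and monotone convergence removes the restriction.
\<close>

lemma inversion:
  assumes f[measurable]: "f \<in> borel_measurable configs"
  shows "(\<integral>\<^sup>+\<omega>. f (T \<omega>) \<partial>N) = lam * (\<integral>\<^sup>+S. gap_integral f S \<partial>P)"
proof -
  define h where "h n S = (if point_at S 1 \<le> real n then min (f S) (of_nat n) else 0)" for n S
  have h_meas[measurable]: "h n \<in> borel_measurable configs" for n unfolding h_def[abs_def] by measurable
  have h_le: "h m S \<le> h n S" if "m \<le> n" for m n S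
    using that unfolding h_def by (auto simp: min_le_iff_disj intro: order_trans[OF min.cobounded2] of_nat_mono)
  have h_SUP: "(SUP n. h n S) = f S" for S
  proof (rule antisym)
    show "(SUP n. h n S) \<le> f S" by (rule SUP_least) (simp add: h_def)
    obtain m :: nat where m: "point_at S 1 \<le> real m" using real_arch_simple by blast
    have "f S = inf (f S) (SUP n. of_nat n)" by (simp add: ennreal_SUP_of_nat_eq_top)
    also have "\<dots> = (SUP n. min (f S) (of_nat n))" by (simp only: inf_SUP) (simp only: inf_min)
    also have "\<dots> \<le> (SUP n. h n S)"
    proof (rule SUP_least)
      fix n
      have "min (f S) (of_nat n) \<le> min (f S) (of_nat (max m n))"
        by (intro min.mono order_refl of_nat_mono) simp
      also have "\<dots> = h (max m n) S" using m by (simp add: h_def)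
      also have "\<dots> \<le> (SUP n. h n S)" by (rule SUP_upper) simp
      finally show "min (f S) (of_nat n) \<le> (SUP n. h n S)" .
    qed
    finally show "f S \<le> (SUP n. h n S)" .
  qed
  have gap_SUP: "gap_integral f S = (SUP n. gap_integral (h n) S)" if S: "S \<in> space configs" for S
  proof -
    have m[measurable]: "(\<lambda>t. h n (recentre t S)) \<in> borel_measurable borel" for n
      by (rule measurable_compose[OF _ h_meas]) (intro measurable_recentre measurable_const S, simp)
    have "gap_integral f S = (\<integral>\<^sup>+t. (SUP n. if 0 \<le> t \<and> t < point_at S 1 then h n (recentre t S) else 0) \<partial>lborel)"
      unfolding gap_integral_def window_integral_def by (intro nn_integral_cong) (simp add: h_SUP)
    also have "\<dots> = (SUP n. gap_integral (h n) S)"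
      unfolding gap_integral_def window_integral_def
      by (rule nn_integral_monotone_convergence_SUP) (auto intro!: incseq_SucI le_funI h_le)
    finally show ?thesis .
  qed
  have gap_mono: "incseq (\<lambda>n. gap_integral (h n))"
    unfolding gap_integral_def[abs_def] window_integral_def
    by (intro incseq_SucI le_funI nn_integral_mono) (auto intro: h_le)
  have "(\<integral>\<^sup>+\<omega>. h n (T \<omega>) \<partial>N) = lam * (\<integral>\<^sup>+S. gap_integral (h n) S \<partial>P)" for n
  proof (rule inversion_if_finite[OF h_meas])
    have "(\<integral>\<^sup>+\<omega>. gap_integral (h n) (T \<omega>) \<partial>N) \<le> (\<integral>\<^sup>+\<omega>. of_nat n * of_nat n \<partial>N)"
    proof (rule nn_integral_mono_AE, rule eventually_mono[OF process_two_sided])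
      fix \<omega> assume "two_sided_config (T \<omega>)"
      then interpret two_sided_config "T \<omega>" .
      have "gap_integral (h n) (T \<omega>) \<le> (\<integral>\<^sup>+t. of_nat n * indicator {p 1 - real n..p 1} t \<partial>lborel)"
        unfolding gap_integral_def window_integral_def point_at_eq
      proof (rule nn_integral_mono)
        fix t :: real
        show "(if 0 \<le> t \<and> t < p 1 then h n (recentre t (T \<omega>)) else 0) \<le> of_nat n * indicator {p 1 - real n..p 1} t"
        proof (cases "0 \<le> t \<and> t < p 1")
          case True
          then have t: "p 0 \<le> t" "t < p (0 + 1)" using p_around_0 by auto
          interpret S: two_sided_config "recentre t (T \<omega>)" by (rule recentre_two_sided[OF t])
          have "point_at (recentre t (T \<omega>)) 1 = p 1 - t"
            unfolding S.point_at_eq using recentre_two_sided(2)[OF t, of 1] by simp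
          then show ?thesis using True by (auto simp: h_def indicator_def)
        next
          case False then show ?thesis by auto
        qed
      qed
      also have "\<dots> = of_nat n * of_nat n"
        by (subst nn_integral_cmult_indicator) (auto simp: ennreal_of_nat_eq_real_of_nat)
      finally show "gap_integral (h n) (T \<omega>) \<le> of_nat n * of_nat n" .
    qed
    also have "\<dots> < \<infinity>" by (simp add: N.emeasure_space_1 ennreal_mult_less_top of_nat_less_top)
    finally show "(\<integral>\<^sup>+\<omega>. gap_integral (h n) (T \<omega>) \<partial>N) \<noteq> \<infinity>" by simp
  qed
  then have eq: "(SUP n. \<integral>\<^sup>+\<omega>. h n (T \<omega>) \<partial>N) = lam * (SUP n. \<integral>\<^sup>+S. gap_integral (h n) S \<partial>P)"
    by (simp add: SUP_mult_left_ennreal)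
  have "(\<integral>\<^sup>+\<omega>. f (T \<omega>) \<partial>N) = (\<integral>\<^sup>+\<omega>. (SUP n. h n (T \<omega>)) \<partial>N)" by (simp add: h_SUP)
  also have "\<dots> = (SUP n. \<integral>\<^sup>+\<omega>. h n (T \<omega>) \<partial>N)"
    by (rule nn_integral_monotone_convergence_SUP) (auto intro!: incseq_SucI le_funI h_le)
  also have "\<dots> = lam * (\<integral>\<^sup>+S. (SUP n. gap_integral (h n) S) \<partial>P)"
    unfolding eq using gap_mono
    by (subst nn_integral_monotone_convergence_SUP) simp_all
  also have "(\<integral>\<^sup>+S. (SUP n. gap_integral (h n) S) \<partial>P) = (\<integral>\<^sup>+S. gap_integral f S \<partial>P)"
    by (intro nn_integral_cong) (simp add: gap_SUP)
  finally show ?thesis .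
qed

text \<open>
  Seen from a typical point, the configuration is determined by its gaps.
\<close>

lemma palm_points: "AE S in P. proper_gaps (\<lambda>k. interpoint k S) \<and> renewal_points (\<lambda>k. interpoint k S) = S
    \<and> point_at S 1 = interpoint 1 S"
  using palm_two_sided palm_origin palm_interpoint_pos
proof eventually_elim
  case (elim S)
  interpret two_sided_config S by (rule elim)
  have "idx 0 = 0" by (simp add: point_index_def)
  then have p0: "p 0 = 0" using nth_point_idx[OF elim(2)] by simp
  have partial_sum: "partial_sum (\<lambda>k. interpoint k S) = p"
  proof
    fix k
    have "p k = p 0 + partial_sum (\<lambda>k. interpoint k S) k" by (rule partial_sum_unique) (simp add: interpoint_def)
    then show "partial_sum (\<lambda>k. interpoint k S) k = p k" using p0 by linarith
  qed
  have proper_gaps: "proper_gaps (\<lambda>k. interpoint k S)"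
    using elim(3) two_sided_p by (auto simp: proper_gaps_def partial_sum less_imp_le)
  then show ?case
    by (simp add: renewal_points_def partial_sum range_p point_at_eq) (simp add: interpoint_def p0)
qed

lemma palm_interpoint_law: "distr P seq_space (\<lambda>S k. interpoint k S) = PiM UNIV (\<lambda>_. F)"
proof -
  have "distr P (PiM UNIV (\<lambda>_. borel)) (\<lambda>S. \<lambda>k\<in>UNIV. interpoint k S) = PiM UNIV (\<lambda>k. distr P borel (interpoint k))"
    by (rule P.indep_vars_iff_distr_eq_PiM[THEN iffD1]) (use P(3) in \<open>simp_all add: iid_def\<close>)
  then show ?thesis using P(3) by (simp add: seq_space_def iid_def restrict_UNIV)
qed

text \<open>
  The law of a stationary renewal process in terms of i.i.d. gaps: put a point at the origin, choose a
  location in the gap to its right with Lebesgue measure, and look at the configuration from there.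
\<close>

theorem inversion_renewal:
  assumes f[measurable]: "f \<in> borel_measurable configs"
  shows "(\<integral>\<^sup>+\<omega>. f (T \<omega>) \<partial>N) = lam * (\<integral>\<^sup>+t. window_integral f (renewal_points t) 0 (t 1) \<partial>PiM UNIV (\<lambda>_. F))"
proof -
  have [measurable]: "(\<lambda>S k. interpoint k S) \<in> P \<rightarrow>\<^sub>M seq_space"
    unfolding seq_space_def by (rule measurable_PiM_UNIV) simp
  have [measurable]: "(\<lambda>t. window_integral f (renewal_points t) 0 (t 1)) \<in> borel_measurable seq_space"
    by (intro measurable_window_integral f measurable_renewal_points measurable_const measurable_seq_component) simp
  have "(\<integral>\<^sup>+S. gap_integral f S \<partial>P) = (\<integral>\<^sup>+S. window_integral f (renewal_points (\<lambda>k. interpoint k S)) 0 (interpoint 1 S) \<partial>P)"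
    by (intro nn_integral_cong_AE eventually_mono[OF palm_points]) (simp add: gap_integral_def)
  also have "\<dots> = (\<integral>\<^sup>+t. window_integral f (renewal_points t) 0 (t 1) \<partial>distr P seq_space (\<lambda>S k. interpoint k S))"
    by (subst nn_integral_distr) simp_all
  also have "\<dots> = (\<integral>\<^sup>+t. window_integral f (renewal_points t) 0 (t 1) \<partial>PiM UNIV (\<lambda>_. F))"
    unfolding palm_interpoint_law ..
  finally show ?thesis by (simp only: inversion[OF f])
qed

lemma AE_proper_gaps: "AE t in PiM UNIV (\<lambda>_. F). proper_gaps t"
proof -
  have m: "(\<lambda>S k. interpoint k S) \<in> P \<rightarrow>\<^sub>M seq_space"
    unfolding seq_space_def by (rule measurable_PiM_UNIV) simp
  have "AE t in distr P seq_space (\<lambda>S k. interpoint k S). proper_gaps t"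
    by (subst AE_distr_iff[OF m]) (use palm_points in \<open>auto elim: eventually_mono\<close>)
  then show ?thesis unfolding palm_interpoint_law .
qed

end

section \<open>Gaps, marks and division points\<close>

lemma distr_pair_if_independent:
  assumes "prob_space M" "independent_elements M S X S' Y"
  shows "distr M (S \<Otimes>\<^sub>M S') (\<lambda>\<omega>. (X \<omega>, Y \<omega>)) = distr M S X \<Otimes>\<^sub>M distr M S' Y"
proof -
  interpret prob_space M by fact
  have X[measurable]: "X \<in> M \<rightarrow>\<^sub>M S" and Y[measurable]: "Y \<in> M \<rightarrow>\<^sub>M S'"
    and ind: "indep_set {X -` A \<inter> space M |A. A \<in> sets S} {Y -` B \<inter> space M |B. B \<in> sets S'}"
    using assms(2) by (auto simp: independent_elements_def)
  have "distr M S X \<Otimes>\<^sub>M distr M S' Y = distr M (S \<Otimes>\<^sub>M S') (\<lambda>\<omega>. (X \<omega>, Y \<omega>))"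
  proof (rule pair_measure_eqI)
    show "sigma_finite_measure (distr M S X)" "sigma_finite_measure (distr M S' Y)"
      by (intro prob_space_imp_sigma_finite prob_space_distr X Y)+
    show "sets (distr M S X \<Otimes>\<^sub>M distr M S' Y) = sets (distr M (S \<Otimes>\<^sub>M S') (\<lambda>\<omega>. (X \<omega>, Y \<omega>)))"
      by (simp cong: sets_pair_measure_cong)
    fix A B assume AB: "A \<in> sets (distr M S X)" "B \<in> sets (distr M S' Y)"
    then have A[measurable]: "A \<in> sets S" and B[measurable]: "B \<in> sets S'" by simp_all
    have "prob ((X -` A \<inter> space M) \<inter> (Y -` B \<inter> space M)) = prob (X -` A \<inter> space M) * prob (Y -` B \<inter> space M)"
      using A B by (intro indep_setD[OF ind]) blast+
    moreover have "(X -` A \<inter> space M) \<inter> (Y -` B \<inter> space M) = (\<lambda>\<omega>. (X \<omega>, Y \<omega>)) -` (A \<times> B) \<inter> space M" by auto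
    ultimately show "emeasure (distr M S X) A * emeasure (distr M S' Y) B = emeasure (distr M (S \<Otimes>\<^sub>M S') (\<lambda>\<omega>. (X \<omega>, Y \<omega>))) (A \<times> B)"
      by (simp add: emeasure_distr emeasure_eq_measure ennreal_mult'[symmetric])
  qed
  then show ?thesis ..
qed

lemma iid_trajectory_law:
  assumes "prob_space M" "iid M X F"
  shows "distr M seq_space (trajectory X) = PiM UNIV (\<lambda>_. F)" "trajectory X \<in> M \<rightarrow>\<^sub>M seq_space"
proof -
  interpret prob_space M by fact
  have rv: "X k \<in> borel_measurable M" for k
    using assms(2) unfolding iid_def indep_vars_def by auto
  have "distr M (PiM UNIV (\<lambda>_. borel)) (\<lambda>\<omega>. \<lambda>k\<in>UNIV. X k \<omega>) = PiM UNIV (\<lambda>k. distr M borel (X k))"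
    by (rule indep_vars_iff_distr_eq_PiM[THEN iffD1]) (use assms(2) rv in \<open>simp_all add: iid_def\<close>)
  then show "distr M seq_space (trajectory X) = PiM UNIV (\<lambda>_. F)"
    using assms(2) by (simp add: seq_space_def trajectory_def iid_def restrict_UNIV)
  show "trajectory X \<in> M \<rightarrow>\<^sub>M seq_space"
    unfolding seq_space_def trajectory_def by (rule measurable_PiM_UNIV) (simp add: rv)
qed

context division begin

lemma distr_shift_pair:
  "distr (taus \<Otimes>\<^sub>M bs) (taus \<Otimes>\<^sub>M bs) (\<lambda>(t, b). (\<lambda>k. t (k + m), \<lambda>k. b (k + m))) = taus \<Otimes>\<^sub>M bs"
proof -
  interpret B: prob_space bs by (intro prob_space_PiM G)
  have s: "(\<lambda>\<omega> k. \<omega> (k + m)) \<in> taus \<rightarrow>\<^sub>M taus" "(\<lambda>\<omega> k. \<omega> (k + m)) \<in> bs \<rightarrow>\<^sub>M bs"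
    by (rule measurable_PiM_UNIV; simp)+
  have "taus \<Otimes>\<^sub>M bs = distr taus taus (\<lambda>\<omega> k. \<omega> (k + m)) \<Otimes>\<^sub>M distr bs bs (\<lambda>\<omega> k. \<omega> (k + m))"
    by (simp add: distr_PiM_shift F G)
  also have "\<dots> = distr (taus \<Otimes>\<^sub>M bs) (taus \<Otimes>\<^sub>M bs) (\<lambda>(t, b). (\<lambda>k. t (k + m), \<lambda>k. b (k + m)))"
    by (rule pair_measure_distr[OF s]) (simp add: distr_PiM_shift F G B.sigma_finite_measure_axioms)
  finally show ?thesis ..
qed

lemma sets_pair_law[measurable_cong]: "sets (taus \<Otimes>\<^sub>M bs) = sets (seq_space \<Otimes>\<^sub>M seq_space)"
  by (intro sets_pair_measure_cong sets_taus sets_bs)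

lemma measurable_shift_pair:
  "(\<lambda>(t, b). (\<lambda>k. t (k + m), \<lambda>k. b (k + m))) \<in> taus \<Otimes>\<^sub>M bs \<rightarrow>\<^sub>M taus \<Otimes>\<^sub>M bs"
proof -
  have s: "(\<lambda>\<omega> k. \<omega> (k + m)) \<in> taus \<rightarrow>\<^sub>M taus" "(\<lambda>\<omega> k. \<omega> (k + m)) \<in> bs \<rightarrow>\<^sub>M bs"
    by (rule measurable_PiM_UNIV; simp)+
  show ?thesis
    unfolding split_beta'
    by (intro measurable_Pair measurable_compose[OF measurable_fst s(1)] measurable_compose[OF measurable_snd s(2)])
qed

lemma nn_integral_shift_pair:
  assumes "h \<in> borel_measurable (seq_space \<Otimes>\<^sub>M seq_space)"
  shows "(\<integral>\<^sup>+z. h (\<lambda>k. fst z (k + m), \<lambda>k. snd z (k + m)) \<partial>(taus \<Otimes>\<^sub>M bs)) = (\<integral>\<^sup>+z. h z \<partial>(taus \<Otimes>\<^sub>M bs))"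
proof -
  have h: "h \<in> borel_measurable (taus \<Otimes>\<^sub>M bs)"
    unfolding measurable_cong_sets[OF sets_pair_law refl] by (rule assms)
  have "(\<integral>\<^sup>+z. h z \<partial>(taus \<Otimes>\<^sub>M bs))
     = (\<integral>\<^sup>+z. h z \<partial>distr (taus \<Otimes>\<^sub>M bs) (taus \<Otimes>\<^sub>M bs) (\<lambda>(t, b). (\<lambda>k. t (k + m), \<lambda>k. b (k + m))))"
    by (simp only: distr_shift_pair)
  also have "\<dots> = (\<integral>\<^sup>+z. h (\<lambda>k. fst z (k + m), \<lambda>k. snd z (k + m)) \<partial>(taus \<Otimes>\<^sub>M bs))"
    by (subst nn_integral_distr[OF measurable_shift_pair]) (simp_all add: h split_beta')
  finally show ?thesis ..
qed

lemma AE_pair_pos: "AE z in taus \<Otimes>\<^sub>M bs. \<forall>k. 0 < fst z k \<and> clip (snd z) k = snd z k"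
proof -
  interpret A: prob_space taus by (intro prob_space_PiM F)
  interpret B: prob_space bs by (intro prob_space_PiM G)
  interpret AB: pair_prob_space taus bs ..
  have "AE t in taus. \<forall>k. 0 < t k"
    by (subst AE_all_countable, rule allI, rule AE_PiM_component[where P="\<lambda>x. 0 < x"]) (use F in auto)
  moreover have "AE b in bs. \<forall>k. b k \<in> {0..1}"
    by (subst AE_all_countable, rule allI, rule AE_PiM_component[where P="\<lambda>x. x \<in> {0..1}"]) (use G in auto)
  ultimately have ae: "AE t in taus. AE b in bs. (\<forall>k. 0 < t k) \<and> (\<forall>k. b k \<in> {0..1})"
    by (auto elim!: eventually_mono)
  have "{z \<in> space (taus \<Otimes>\<^sub>M bs). (\<forall>k. 0 < fst z k) \<and> (\<forall>k. snd z k \<in> {0..1})} \<in> sets (taus \<Otimes>\<^sub>M bs)"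
  proof -
    have "(\<lambda>z. fst z k) \<in> borel_measurable (taus \<Otimes>\<^sub>M bs)" "(\<lambda>z. snd z k) \<in> borel_measurable (taus \<Otimes>\<^sub>M bs)" for k
      unfolding measurable_cong_sets[OF sets_pair_law refl]
      by (rule measurable_compose[OF measurable_fst measurable_seq_component]
               measurable_compose[OF measurable_snd measurable_seq_component])+
    note [measurable] = this
    show ?thesis by measurable
  qed
  from AB.AE_pair_measure[of "\<lambda>z. (\<forall>k. 0 < fst z k) \<and> (\<forall>k. snd z k \<in> {0..1})", OF this]
  have "AE z in taus \<Otimes>\<^sub>M bs. (\<forall>k. 0 < fst z k) \<and> (\<forall>k. snd z k \<in> {0..1})"
    using ae by simp
  then show ?thesis by eventually_elim (simp add: clip_def min_absorb2 max_absorb2)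
qed

end


text \<open>
  The division point of the interval to the left of the point \<open>k\<close>.
\<close>

definition division_point :: "(int \<Rightarrow> real) \<Rightarrow> (int \<Rightarrow> real) \<Rightarrow> int \<Rightarrow> real" where
  "division_point t b k = partial_sum t (k - 1) + clip b k * t k"

definition division_points :: "(int \<Rightarrow> real) \<times> (int \<Rightarrow> real) \<Rightarrow> real set" where
  "division_points z = division_point (fst z) (snd z) ` (if proper_gaps (fst z) then UNIV else {})"

lemma division_point_step:
  "division_point t b (k + 1) = division_point t b k + exchanged (t, clip b) k"
  using partial_sum_step[of t k] by (simp add: division_point_def exchanged_def algebra_simps)

lemma exchanged_nonneg: "(\<And>k. 0 \<le> t k) \<Longrightarrow> 0 \<le> exchanged (t, clip b) k"
  unfolding exchanged_def using clip_range by (auto intro!: add_nonneg_nonneg mult_nonneg_nonneg)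

lemma proper_gaps_nonneg: "proper_gaps t \<Longrightarrow> 0 \<le> t k" by (simp add: proper_gaps_def)

lemma division_point_bounds:
  assumes "proper_gaps t"
  shows "partial_sum t (k - 1) \<le> division_point t b k" "division_point t b k \<le> partial_sum t k"
  using partial_sum_step[of t k] proper_gaps_nonneg[OF assms, of k] clip_range[of b k]
    mult_left_le_one_le[of "t k" "clip b k"] by (auto simp: division_point_def)

lemma mono_division_point:
  assumes "proper_gaps t" shows "mono (division_point t b)"
proof (rule int_mono_if_steps)
  fix k
  have "0 \<le> exchanged (t, clip b) (k - 1)" by (rule exchanged_nonneg[OF proper_gaps_nonneg[OF assms]])
  then show "division_point t b (k - 1) \<le> division_point t b k"
    using division_point_step[of t b "k - 1"] by simp
qed

lemma two_sided_division_point: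
  assumes "proper_gaps t" shows "two_sided (division_point t b)"
  unfolding two_sided_def
proof (intro conjI allI)
  have ts: "two_sided (partial_sum t)" using assms by (simp add: proper_gaps_def)
  fix n :: nat
  obtain i j where ij: "real n < partial_sum t i" "partial_sum t j < - real n" using ts unfolding two_sided_def by blast
  show "\<exists>k. real n < division_point t b k"
    using division_point_bounds(1)[OF assms, of "i + 1" b] ij(1) by (intro exI[of _ "i + 1"]) simp
  show "\<exists>k. division_point t b k < - real n"
    using division_point_bounds(2)[OF assms, of b j] ij(2) by (intro exI[of _ j]) simp
qed

lemma measurable_division_points[measurable]: "division_points \<in> seq_space \<Otimes>\<^sub>M seq_space \<rightarrow>\<^sub>M configs"
  unfolding division_points_def[abs_def]
proof (rule measurable_configs_enumeration)
  fix k
  have c: "(\<lambda>z. fst z k) \<in> borel_measurable (seq_space \<Otimes>\<^sub>M seq_space)" "(\<lambda>z. snd z k) \<in> borel_measurable (seq_space \<Otimes>\<^sub>M seq_space)"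
    "(\<lambda>z. partial_sum (fst z) (k - 1)) \<in> borel_measurable (seq_space \<Otimes>\<^sub>M seq_space)"
    by (rule measurable_compose[OF measurable_fst measurable_seq_component]
             measurable_compose[OF measurable_snd measurable_seq_component]
             measurable_compose[OF measurable_fst measurable_partial_sum])+
  then show "(\<lambda>z. division_point (fst z) (snd z) k) \<in> borel_measurable (seq_space \<Otimes>\<^sub>M seq_space)"
    unfolding division_point_def clip_def by simp
  show "Measurable.pred (seq_space \<Otimes>\<^sub>M seq_space) (\<lambda>z. k \<in> (if proper_gaps (fst z) then UNIV else {}))" by simp
next
  fix z :: "(int \<Rightarrow> real) \<times> (int \<Rightarrow> real)" and n :: nat
  show "finite {k \<in> if proper_gaps (fst z) then UNIV else {}. \<bar>division_point (fst z) (snd z) k\<bar> \<le> real n}"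
    using finite_two_sided[OF mono_division_point two_sided_division_point, of "fst z" "snd z" "real n"] by auto
qed

text \<open>
  Between two consecutive division points lie the right part of one interval and the left part of the
  next one.
\<close>

lemma exchanged_points:
  assumes "proper_gaps t"
  shows "partial_sum (exchanged (t, clip b)) k = division_point t b (k + 1) - division_point t b 1"
    "proper_gaps (exchanged (t, clip b))"
    "renewal_points (exchanged (t, clip b)) = recentre (division_point t b 1) (division_points (t, b))"
proof -
  show partial_sum: "partial_sum (exchanged (t, clip b)) k = division_point t b (k + 1) - division_point t b 1" for k
  proof -
    have "(\<lambda>k. division_point t b (k + 1)) k = (\<lambda>k. division_point t b (k + 1)) 0 + partial_sum (exchanged (t, clip b)) k"
      by (rule partial_sum_unique) (use division_point_step[of t b] in simp)
    then show ?thesis by simp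
  qed
  have "two_sided (partial_sum (exchanged (t, clip b)))"
    unfolding two_sided_def partial_sum
  proof (intro conjI allI)
    fix n :: nat
    obtain m :: nat where m: "\<bar>division_point t b 1\<bar> \<le> real m" using real_arch_simple by blast
    obtain i j where ij: "real (n + m) < division_point t b i" "division_point t b j < - real (n + m)"
      using two_sided_division_point[OF assms, of b] unfolding two_sided_def by blast
    show "\<exists>k. real n < division_point t b (k + 1) - division_point t b 1"
      using ij(1) m by (intro exI[of _ "i - 1"]) simp
    show "\<exists>k. division_point t b (k + 1) - division_point t b 1 < - real n"
      using ij(2) m by (intro exI[of _ "j - 1"]) simp
  qed
  then show proper_gaps: "proper_gaps (exchanged (t, clip b))"
    using exchanged_nonneg[OF proper_gaps_nonneg[OF assms]] by (simp add: proper_gaps_def)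
  have "renewal_points (exchanged (t, clip b)) = range (\<lambda>k. division_point t b (k + 1) - division_point t b 1)"
    using proper_gaps by (auto simp: renewal_points_def partial_sum)
  also have "\<dots> = recentre (division_point t b 1) (range (division_point t b))"
  proof -
    have "division_point t b i - division_point t b 1 \<in> range (\<lambda>k. division_point t b (k + 1) - division_point t b 1)" for i
      by (rule range_eqI[of _ _ "i - 1"]) simp
    then show ?thesis by (auto simp: recentre_def)
  qed
  also have "range (division_point t b) = division_points (t, b)" using assms by (simp add: division_points_def)
  finally show "renewal_points (exchanged (t, clip b)) = recentre (division_point t b 1) (division_points (t, b))" .
qed

text \<open>
  Moving the index of gaps and marks by one moves the origin to the point 1, at the distance \<open>t 1\<close>.
\<close>

lemma shifted_sequences:
  "partial_sum (\<lambda>k. t (k + 1)) k = partial_sum t (k + 1) - t 1"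
  "proper_gaps (\<lambda>k. t (k + 1)) \<longleftrightarrow> proper_gaps t"
  "division_points (\<lambda>k. t (k + 1), \<lambda>k. b (k + 1)) = recentre (t 1) (division_points (t, b))"
proof -
  show partial_sum: "partial_sum (\<lambda>k. t (k + 1)) k = partial_sum t (k + 1) - t 1" for k
  proof -
    have "(\<lambda>k. partial_sum t (k + 1)) k = (\<lambda>k. partial_sum t (k + 1)) 0 + partial_sum (\<lambda>k. t (k + 1)) k"
    proof (rule partial_sum_unique)
      fix k show "partial_sum t (k + 1) = partial_sum t (k - 1 + 1) + t (k + 1)" using partial_sum_step[of t "k + 1"] by simp
    qed
    then show ?thesis by simp
  qed
  have nonneg: "(\<forall>k. 0 \<le> t (k + 1)) \<longleftrightarrow> (\<forall>k. 0 \<le> t k)" by (metis diff_add_cancel)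
  obtain m :: nat where m: "\<bar>t 1\<bar> \<le> real m" using real_arch_simple by blast
  have "two_sided (\<lambda>k. partial_sum t (k + 1) - t 1) \<longleftrightarrow> two_sided (partial_sum t)"
  proof
    assume *: "two_sided (\<lambda>k. partial_sum t (k + 1) - t 1)"
    show "two_sided (partial_sum t)"
      unfolding two_sided_def
    proof (intro conjI allI)
      fix n :: nat
      obtain i j where ij: "real (n + m) < partial_sum t (i + 1) - t 1" "partial_sum t (j + 1) - t 1 < - real (n + m)"
        using * unfolding two_sided_def by blast
      show "\<exists>k. real n < partial_sum t k" using ij(1) m by (intro exI[of _ "i + 1"]) simp
      show "\<exists>k. partial_sum t k < - real n" using ij(2) m by (intro exI[of _ "j + 1"]) simp
    qed
  next
    assume *: "two_sided (partial_sum t)"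
    show "two_sided (\<lambda>k. partial_sum t (k + 1) - t 1)"
      unfolding two_sided_def
    proof (intro conjI allI)
      fix n :: nat
      obtain i j where ij: "real (n + m) < partial_sum t i" "partial_sum t j < - real (n + m)"
        using * unfolding two_sided_def by blast
      show "\<exists>k. real n < partial_sum t (k + 1) - t 1" using ij(1) m by (intro exI[of _ "i - 1"]) simp
      show "\<exists>k. partial_sum t (k + 1) - t 1 < - real n" using ij(2) m by (intro exI[of _ "j - 1"]) simp
    qed
  qed
  then show proper_gaps: "proper_gaps (\<lambda>k. t (k + 1)) \<longleftrightarrow> proper_gaps t"
    unfolding proper_gaps_def partial_sum[abs_def] nonneg by simp
  have dp: "division_point (\<lambda>k. t (k + 1)) (\<lambda>k. b (k + 1)) k = division_point t b (k + 1) - t 1" for k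
    by (simp add: division_point_def partial_sum clip_def)
  have "division_point t b i - t 1 \<in> range (\<lambda>k. division_point t b (k + 1) - t 1)" for i
    by (rule range_eqI[of _ _ "i - 1"]) simp
  then show "division_points (\<lambda>k. t (k + 1), \<lambda>k. b (k + 1)) = recentre (t 1) (division_points (t, b))"
    by (auto simp: division_points_def proper_gaps recentre_def dp image_image)
qed

section \<open>The shifted process\<close>

lemma space_seq_space[simp]: "space seq_space = UNIV"
  by (simp add: seq_space_def space_PiM)

lemma renewal_points_in_configs: "renewal_points t \<in> space configs"
  by (rule measurable_space[OF measurable_renewal_points]) simp

lemma division_points_in_configs: "division_points z \<in> space configs"
  by (rule measurable_space[OF measurable_division_points]) (simp add: space_pair_measure)

lemma enumeration_recentred_renewal_points:
  assumes "proper_gaps t" "\<And>k. 0 < t k" "0 \<le> u" "u < t 1"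
  shows "nth_point (recentre u (renewal_points t)) k = partial_sum t k - u" "point_indices (recentre u (renewal_points t)) = UNIV"
    "interpoint k (recentre u (renewal_points t)) = t k"
proof -
  interpret config "recentre u (renewal_points t)" by unfold_locales (rule recentre_in_configs[OF renewal_points_in_configs])
  have "strict_mono (\<lambda>k. partial_sum t k - u)"
  proof (rule int_strict_mono_if_steps)
    fix k show "partial_sum t (k - 1) - u < partial_sum t k - u" using partial_sum_step[of t k] assms(2)[of k] by linarith
  qed
  moreover have "recentre u (renewal_points t) = range (\<lambda>k. partial_sum t k - u)"
    using assms(1) by (auto simp: renewal_points_def recentre_def)
  moreover have "partial_sum t 0 - u \<le> 0" "0 < partial_sum t 1 - u" using assms by simp_all
  ultimately show n: "nth_point (recentre u (renewal_points t)) k = partial_sum t k - u" "point_indices (recentre u (renewal_points t)) = UNIV" for k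
    by (rule nth_point_enumeration)+
  show "interpoint k (recentre u (renewal_points t)) = t k"
    using partial_sum_step[of t k] by (simp add: interpoint_def n)
qed

text \<open>
  As long as the new origin stays in the gap between the points 0 and 1, no point changes its index,
  so every interval keeps its mark.
\<close>

lemma neighbour_shift_recentred_renewal_points:
  assumes "proper_gaps t" "\<And>k. 0 < t k" "0 \<le> u" "u < t 1"
  shows "neighbour_shift (clip b) (recentre u (renewal_points t)) = recentre u (division_points (t, b))"
proof -
  interpret config "recentre u (renewal_points t)" by unfold_locales (rule recentre_in_configs[OF renewal_points_in_configs])
  have eq: "partial_sum t (k - 1) - u + clip b k * (partial_sum t k - u - (partial_sum t (k - 1) - u)) = division_point t b k - u" for k
    using partial_sum_step[of t k] by (simp add: division_point_def)
  show ?thesis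
    unfolding neighbour_shift_eq enumeration_recentred_renewal_points(1,2)[OF assms] eq
    using assms(1) by (simp add: division_points_def recentre_def image_image)
qed

lemma interpoint_1_recentred_renewal_points:
  assumes "proper_gaps t" "0 < t 1" "0 \<le> u" "u < t 1"
  shows "interpoint 1 (recentre u (renewal_points t)) = t 1"
proof -
  interpret config "recentre u (renewal_points t)" by unfold_locales (rule recentre_in_configs[OF renewal_points_in_configs])
  have S: "recentre u (renewal_points t) = range (\<lambda>k. partial_sum t k - u)"
    using assms(1) by (auto simp: renewal_points_def recentre_def)
  have mem: "- u \<in> recentre u (renewal_points t)" "t 1 - u \<in> recentre u (renewal_points t)"
    unfolding S by (rule range_eqI[of _ _ 0]; simp) (rule range_eqI[of _ _ 1]; simp)
  have mono: "mono (partial_sum t)" by (rule mono_partial_sum) (rule proper_gaps_nonneg[OF assms(1)])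
  have "\<not> (- u < partial_sum t k - u \<and> partial_sum t k - u < t 1 - u)" for k
  proof (cases "1 \<le> k")
    case True
    then show ?thesis using monoD[OF mono, of 1 k] by simp
  next
    case False
    then show ?thesis using monoD[OF mono, of k 0] by simp
  qed
  then have "recentre u (renewal_points t) \<inter> {- u<..<t 1 - u} = {}" unfolding S by auto
  with mem have "nth_point (recentre u (renewal_points t)) 0 = - u" "nth_point (recentre u (renewal_points t)) 1 = t 1 - u"
    using assms by (intro nth_around_0[of "- u" "t 1 - u"]; simp)+
  then show ?thesis by (simp add: interpoint_def)
qed

locale marked_renewal = renewal_process N T F + division F G
  for N :: "'b measure" and T :: "'b \<Rightarrow> real set" and F G :: "real measure" +
  fixes \<beta> :: "int \<Rightarrow> 'b \<Rightarrow> real"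
  assumes marks: "iid N \<beta> G" "independent_elements N configs T seq_space (trajectory \<beta>)"
    "\<And>k \<omega>. \<omega> \<in> space N \<Longrightarrow> \<beta> k \<omega> \<in> {0..1}"
begin

sublocale taus: prob_space taus by (intro prob_space_PiM F)
sublocale bs: prob_space bs by (intro prob_space_PiM G)
sublocale TB: pair_prob_space taus bs ..

abbreviation "shifted \<omega> \<equiv> neighbour_shift (\<lambda>k. \<beta> k \<omega>) (T \<omega>)"

lemma joint_law: "distr N (configs \<Otimes>\<^sub>M seq_space) (\<lambda>\<omega>. (T \<omega>, trajectory \<beta> \<omega>)) = distr N configs T \<Otimes>\<^sub>M bs"
  using distr_pair_if_independent[OF N.prob_space_axioms marks(2)] iid_trajectory_law(1)[OF N.prob_space_axioms marks(1)]
  by simp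

lemma trajectory_measurable[measurable]: "trajectory \<beta> \<in> N \<rightarrow>\<^sub>M seq_space"
  by (rule iid_trajectory_law(2)[OF N.prob_space_axioms marks(1)])

lemma shifted_eq: "\<omega> \<in> space N \<Longrightarrow> shifted \<omega> = neighbour_shift (clip (trajectory \<beta> \<omega>)) (T \<omega>)"
proof -
  assume "\<omega> \<in> space N"
  then have "(\<lambda>k. \<beta> k \<omega>) = clip (trajectory \<beta> \<omega>)"
    using marks(3) by (simp add: fun_eq_iff clip_def trajectory_def min_absorb2 max_absorb2)
  then show ?thesis by simp
qed

lemma shifted_measurable[measurable]: "shifted \<in> N \<rightarrow>\<^sub>M configs"
proof -
  have "(\<lambda>\<omega>. (trajectory \<beta> \<omega>, T \<omega>)) \<in> N \<rightarrow>\<^sub>M seq_space \<Otimes>\<^sub>M configs" by simp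
  from measurable_compose[OF this measurable_neighbour_shift]
  have "(\<lambda>\<omega>. neighbour_shift (clip (trajectory \<beta> \<omega>)) (T \<omega>)) \<in> N \<rightarrow>\<^sub>M configs" by simp
  then show ?thesis by (rule measurable_cong[THEN iffD1, rotated]) (simp add: shifted_eq)
qed

lemma AE_regular: "AE z in taus \<Otimes>\<^sub>M bs. proper_gaps (fst z) \<and> (\<forall>k. 0 < fst z k) \<and> clip (snd z) = snd z"
proof -
  have "AE t in distr (taus \<Otimes>\<^sub>M bs) taus fst. proper_gaps t"
    unfolding bs.distr_pair_fst by (rule AE_proper_gaps)
  then have "AE z in taus \<Otimes>\<^sub>M bs. proper_gaps (fst z)" by (rule AE_distrD[rotated]) simp
  with AE_pair_pos show ?thesis by eventually_elim auto
qed

context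
  fixes f :: "real set \<Rightarrow> ennreal"
  assumes f[measurable]: "f \<in> borel_measurable configs"
begin

text \<open>
  Conditionally on the marks, the shifted process is a measurable function of \<open>T\<close>, to which the
  inversion formula applies.
\<close>

lemma shifted_integral_division_points:
  "(\<integral>\<^sup>+\<omega>. f (shifted \<omega>) \<partial>N) = lam * (\<integral>\<^sup>+z. window_integral f (division_points z) 0 (fst z 1) \<partial>(taus \<Otimes>\<^sub>M bs))"
proof -
  interpret D: prob_space "distr N configs T" by (rule N.prob_space_distr) simp
  interpret DB: pair_prob_space "distr N configs T" bs ..
  have ns: "(\<lambda>(S, b). neighbour_shift (clip b) S) \<in> configs \<Otimes>\<^sub>M seq_space \<rightarrow>\<^sub>M configs"
  proof -
    have "(\<lambda>z. (snd z, fst z)) \<in> configs \<Otimes>\<^sub>M seq_space \<rightarrow>\<^sub>M seq_space \<Otimes>\<^sub>M configs" by simp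
    from measurable_compose[OF this measurable_neighbour_shift] show ?thesis by (simp add: split_beta')
  qed
  have fns: "(\<lambda>z. f (neighbour_shift (clip (snd z)) (fst z))) \<in> borel_measurable (configs \<Otimes>\<^sub>M seq_space)"
    using measurable_compose[OF ns f] by (simp add: split_beta')
  have fns_b: "(\<lambda>S. f (neighbour_shift (clip b) S)) \<in> borel_measurable configs" for b
    using measurable_compose[OF measurable_Pair1'[of b seq_space configs] measurable_compose[OF measurable_neighbour_shift f]] by simp
  have "(\<integral>\<^sup>+\<omega>. f (shifted \<omega>) \<partial>N) = (\<integral>\<^sup>+\<omega>. f (neighbour_shift (clip (trajectory \<beta> \<omega>)) (T \<omega>)) \<partial>N)"
    by (intro nn_integral_cong) (simp add: shifted_eq)
  also have "\<dots> = (\<integral>\<^sup>+z. f (neighbour_shift (clip (snd z)) (fst z)) \<partial>(distr N configs T \<Otimes>\<^sub>M bs))"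
    unfolding joint_law[symmetric] by (subst nn_integral_distr) (simp_all add: fns)
  also have "\<dots> = (\<integral>\<^sup>+b. \<integral>\<^sup>+S. f (neighbour_shift (clip b) S) \<partial>distr N configs T \<partial>bs)"
  proof -
    have m: "(\<lambda>z. f (neighbour_shift (clip (snd z)) (fst z))) \<in> borel_measurable (distr N configs T \<Otimes>\<^sub>M bs)"
      using fns by (simp add: measurable_cong_sets[OF sets_pair_measure_cong[OF sets_distr sets_bs] refl])
    show ?thesis using DB.nn_integral_snd[OF m] by simp
  qed
  also have "\<dots> = (\<integral>\<^sup>+b. lam * (\<integral>\<^sup>+t. window_integral (\<lambda>S. f (neighbour_shift (clip b) S)) (renewal_points t) 0 (t 1) \<partial>taus) \<partial>bs)"
    by (rule nn_integral_cong) (simp add: nn_integral_distr fns_b inversion_renewal[OF fns_b])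
  also have "\<dots> = (\<integral>\<^sup>+b. lam * (\<integral>\<^sup>+t. window_integral f (division_points (t, b)) 0 (t 1) \<partial>taus) \<partial>bs)"
  proof (rule nn_integral_cong)
    fix b
    have "AE t in taus. \<forall>k. 0 < t k"
      by (subst AE_all_countable, rule allI, rule AE_PiM_component[where P="\<lambda>x. 0 < x"]) (use F in auto)
    then have "AE t in taus. proper_gaps t \<and> (\<forall>k. 0 < t k)" using AE_proper_gaps by eventually_elim simp
    then have "(\<integral>\<^sup>+t. window_integral (\<lambda>S. f (neighbour_shift (clip b) S)) (renewal_points t) 0 (t 1) \<partial>taus)
        = (\<integral>\<^sup>+t. window_integral f (division_points (t, b)) 0 (t 1) \<partial>taus)"
      by (intro nn_integral_cong_AE, elim eventually_mono)
         (auto simp: window_integral_def neighbour_shift_recentred_renewal_points intro!: nn_integral_cong)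
    then show "lam * (\<integral>\<^sup>+t. window_integral (\<lambda>S. f (neighbour_shift (clip b) S)) (renewal_points t) 0 (t 1) \<partial>taus)
        = lam * (\<integral>\<^sup>+t. window_integral f (division_points (t, b)) 0 (t 1) \<partial>taus)" by simp
  qed
  also have "\<dots> = lam * (\<integral>\<^sup>+b. \<integral>\<^sup>+t. window_integral f (division_points (t, b)) 0 (t 1) \<partial>taus \<partial>bs)
     \<and> (\<integral>\<^sup>+b. \<integral>\<^sup>+t. window_integral f (division_points (t, b)) 0 (t 1) \<partial>taus \<partial>bs)
      = (\<integral>\<^sup>+z. window_integral f (division_points z) 0 (fst z 1) \<partial>(taus \<Otimes>\<^sub>M bs))"
    (is "?a = _ \<and> _")
  proof
    have "(\<lambda>z. fst z (1::int)) \<in> borel_measurable (seq_space \<Otimes>\<^sub>M seq_space)"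
      by (rule measurable_compose[OF measurable_fst measurable_seq_component])
    then have "(\<lambda>z. window_integral f (division_points z) 0 (fst z 1)) \<in> borel_measurable (seq_space \<Otimes>\<^sub>M seq_space)"
      by (intro measurable_window_integral f measurable_division_points) simp_all
    then have m: "(\<lambda>(t, b). window_integral f (division_points (t, b)) 0 (t 1)) \<in> borel_measurable (taus \<Otimes>\<^sub>M bs)"
      unfolding measurable_cong_sets[OF sets_pair_law refl] by (simp add: split_beta')
    show "(\<integral>\<^sup>+b. \<integral>\<^sup>+t. window_integral f (division_points (t, b)) 0 (t 1) \<partial>taus \<partial>bs)
      = (\<integral>\<^sup>+z. window_integral f (division_points z) 0 (fst z 1) \<partial>(taus \<Otimes>\<^sub>M bs))"
      using TB.nn_integral_snd[OF m] by (simp add: split_beta')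
    have "(\<lambda>b. \<integral>\<^sup>+t. window_integral f (division_points (t, b)) 0 (t 1) \<partial>taus) \<in> borel_measurable bs"
      using measurable_pair_swap[OF m] by (intro taus.borel_measurable_nn_integral) simp
    then show "?a = lam * (\<integral>\<^sup>+b. \<integral>\<^sup>+t. window_integral f (division_points (t, b)) 0 (t 1) \<partial>taus \<partial>bs)"
      by (rule nn_integral_cmult)
  qed
  finally show ?thesis by simp
qed

text \<open>
  Let \<open>c 1\<close> and \<open>c 2\<close> be the division points of the intervals to the left of the points 1 and 2, so that
  \<open>0 \<le> c 1 \<le> t 1 \<le> c 2\<close>. The window \<open>[0, t 1)\<close> splits at \<open>c 1\<close> into windows \<open>A\<close> and \<open>B\<close>. By invariance under
  a change of the index, \<open>A\<close> has the same expectation as the corresponding window \<open>C\<close>, which is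
  \<open>[t 1, c 2)\<close>. Together \<open>B\<close> and \<open>C\<close> make up \<open>[c 1, c 2)\<close>, the gap between consecutive division points.
\<close>

lemma shifted_integral:
  "(\<integral>\<^sup>+\<omega>. f (shifted \<omega>) \<partial>N)
    = lam * (\<integral>\<^sup>+t. window_integral f (renewal_points t) 0 (t 1) \<partial>distr (taus \<Otimes>\<^sub>M bs) seq_space exchanged)"
proof -
  let ?P = "taus \<Otimes>\<^sub>M bs"
  let ?c = "\<lambda>k z. division_point (fst z) (snd z) k"
  have comp: "(\<lambda>z. fst z k) \<in> borel_measurable (seq_space \<Otimes>\<^sub>M seq_space)" "(\<lambda>z. snd z k) \<in> borel_measurable (seq_space \<Otimes>\<^sub>M seq_space)"
    "(\<lambda>z. partial_sum (fst z) (k - 1)) \<in> borel_measurable (seq_space \<Otimes>\<^sub>M seq_space)" for k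
    by (rule measurable_compose[OF measurable_fst measurable_seq_component]
             measurable_compose[OF measurable_snd measurable_seq_component]
             measurable_compose[OF measurable_fst measurable_partial_sum])+
  then have c: "?c k \<in> borel_measurable (seq_space \<Otimes>\<^sub>M seq_space)" for k
    unfolding division_point_def clip_def by simp
  \<comment> \<open>From the point 0 to the division point 1, on to the point 1, and on to the division point 2.\<close>
  define A where "A z = window_integral f (division_points z) 0 (?c 1 z)" for z
  define B where "B z = window_integral f (division_points z) (?c 1 z) (fst z 1)" for z
  define C where "C z = window_integral f (division_points z) (fst z 1) (?c 2 z)" for z
  have ABC: "A \<in> borel_measurable (seq_space \<Otimes>\<^sub>M seq_space)" "B \<in> borel_measurable (seq_space \<Otimes>\<^sub>M seq_space)"
    "C \<in> borel_measurable (seq_space \<Otimes>\<^sub>M seq_space)"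
    unfolding A_def[abs_def] B_def[abs_def] C_def[abs_def]
    by (intro measurable_window_integral f measurable_division_points c comp measurable_const; simp)+
  then have ABC': "A \<in> borel_measurable ?P" "B \<in> borel_measurable ?P" "C \<in> borel_measurable ?P"
    unfolding measurable_cong_sets[OF sets_pair_law refl] .
  have order: "0 \<le> ?c 1 z" "?c 1 z \<le> fst z 1" "fst z 1 \<le> ?c 2 z" if "proper_gaps (fst z)" for z
    using division_point_bounds(1)[OF that, of 1 "snd z"] division_point_bounds(2)[OF that, of "snd z" 1] division_point_bounds(1)[OF that, of 2 "snd z"] by simp_all
  have "(\<integral>\<^sup>+z. window_integral f (division_points z) 0 (fst z 1) \<partial>?P) = (\<integral>\<^sup>+z. A z + B z \<partial>?P)"
    by (intro nn_integral_cong_AE eventually_mono[OF AE_regular])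
       (simp add: A_def B_def window_integral_add[OF f division_points_in_configs order(1,2)])
  also have "\<dots> = (\<integral>\<^sup>+z. A z \<partial>?P) + (\<integral>\<^sup>+z. B z \<partial>?P)" by (rule nn_integral_add[OF ABC'(1,2)])
  also have "(\<integral>\<^sup>+z. A z \<partial>?P) = (\<integral>\<^sup>+z. A (\<lambda>k. fst z (k + 1), \<lambda>k. snd z (k + 1)) \<partial>?P)"
    by (rule nn_integral_shift_pair[OF ABC(1), symmetric])
  also have "\<dots> = (\<integral>\<^sup>+z. C z \<partial>?P)"
  proof (rule nn_integral_cong)
    fix z
    have "?c 1 (\<lambda>k. fst z (k + 1), \<lambda>k. snd z (k + 1)) = ?c 2 z - fst z 1"
      using partial_sum_step[of "fst z" 2] by (simp add: division_point_def clip_def)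
    then show "A (\<lambda>k. fst z (k + 1), \<lambda>k. snd z (k + 1)) = C z"
      unfolding A_def C_def shifted_sequences(3) prod.collapse
      by (simp add: window_integral_recentre[OF f division_points_in_configs])
  qed
  also have "(\<integral>\<^sup>+z. C z \<partial>?P) + (\<integral>\<^sup>+z. B z \<partial>?P) = (\<integral>\<^sup>+z. C z + B z \<partial>?P)"
    by (rule nn_integral_add[OF ABC'(3,2), symmetric])
  also have "\<dots> = (\<integral>\<^sup>+z. window_integral f (renewal_points (exchanged z)) 0 (exchanged z 1) \<partial>?P)"
  proof (intro nn_integral_cong_AE eventually_mono[OF AE_regular])
    fix z assume z: "proper_gaps (fst z) \<and> (\<forall>k. 0 < fst z k) \<and> clip (snd z) = snd z"
    then have pts: "renewal_points (exchanged z) = recentre (?c 1 z) (division_points z)"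
      using exchanged_points(3)[of "fst z" "snd z"] by simp
    have gap: "exchanged z 1 = ?c 2 z - ?c 1 z"
      using division_point_step[of "fst z" "snd z" 1] z by simp
    have "C z + B z = window_integral f (division_points z) (?c 1 z) (?c 2 z)"
      using z by (simp add: C_def B_def add.commute window_integral_add[OF f division_points_in_configs order(2,3), symmetric])
    also have "\<dots> = window_integral f (recentre (?c 1 z) (division_points z)) 0 (?c 2 z - ?c 1 z)"
      by (simp add: window_integral_recentre[OF f division_points_in_configs])
    also have "\<dots> = window_integral f (renewal_points (exchanged z)) 0 (exchanged z 1)"
      by (simp only: pts gap)
    finally show "C z + B z = window_integral f (renewal_points (exchanged z)) 0 (exchanged z 1)" .
  qed
  also have "\<dots> = (\<integral>\<^sup>+t. window_integral f (renewal_points t) 0 (t 1) \<partial>distr ?P seq_space exchanged)"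
  proof (subst nn_integral_distr)
    show "exchanged \<in> ?P \<rightarrow>\<^sub>M seq_space"
      unfolding measurable_cong_sets[OF sets_pair_law refl] by (rule measurable_exchanged)
    show "(\<lambda>t. window_integral f (renewal_points t) 0 (t 1)) \<in> borel_measurable (distr ?P seq_space exchanged)"
      by (simp, intro measurable_window_integral f measurable_renewal_points measurable_const measurable_seq_component, simp)
  qed simp
  finally show ?thesis by (simp add: shifted_integral_division_points)
qed

end

lemma exchanged_measurable: "exchanged \<in> taus \<Otimes>\<^sub>M bs \<rightarrow>\<^sub>M seq_space"
  unfolding measurable_cong_sets[OF sets_pair_law refl] by (rule measurable_exchanged)

lemma AE_proper_gaps_exchanged: "AE t in distr (taus \<Otimes>\<^sub>M bs) seq_space exchanged. proper_gaps t"
proof (subst AE_distr_iff[OF exchanged_measurable])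
  show "AE z in taus \<Otimes>\<^sub>M bs. proper_gaps (exchanged z)"
    using AE_regular by eventually_elim (metis exchanged_points(2) prod.collapse)
qed (rule predE[OF pred_proper_gaps])

text \<open>
  The law of the exchanged gaps is invariant under a change of the index.
\<close>

lemma AE_all_exchanged_pos:
  assumes "AE t in distr (taus \<Otimes>\<^sub>M bs) seq_space exchanged. 0 < t 1"
  shows "AE t in distr (taus \<Otimes>\<^sub>M bs) seq_space exchanged. \<forall>k. 0 < t k"
proof -
  have p: "Measurable.pred seq_space (\<lambda>t. 0 < t k)" for k
    using measurable_seq_component[of k] by simp
  note [measurable] = p
  have p_all: "Measurable.pred seq_space (\<lambda>t. \<forall>k. 0 < t k)" by measurable
  have 1: "AE z in taus \<Otimes>\<^sub>M bs. 0 < exchanged z 1"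
    using assms by (rule AE_distrD[OF exchanged_measurable])
  have "AE z in taus \<Otimes>\<^sub>M bs. 0 < exchanged z k" for k
  proof -
    have "AE z in distr (taus \<Otimes>\<^sub>M bs) (taus \<Otimes>\<^sub>M bs) (\<lambda>(t, b). (\<lambda>i. t (i + (k - 1)), \<lambda>i. b (i + (k - 1)))). 0 < exchanged z 1"
      unfolding distr_shift_pair by (rule 1)
    from AE_distrD[OF measurable_shift_pair this] show ?thesis
      by eventually_elim (simp add: exchanged_def split_beta' add.commute)
  qed
  then have "AE z in taus \<Otimes>\<^sub>M bs. \<forall>k. 0 < exchanged z k" by (subst AE_all_countable) (rule allI)
  then show ?thesis
    by (subst AE_distr_iff[OF exchanged_measurable predE[OF p_all]])
qed

text \<open>
  Both processes obey the inversion formula with the same intensity factor, one with the exchanged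
  gaps and one with the original gaps. This gives one direction at once. In the other direction, the
  test function \<open>h / gap\<close>, where \<open>gap\<close> is the length of the gap around the origin and \<open>h\<close> a function of the
  gaps, integrates over this gap to \<open>h\<close> itself, so that equality of the process laws gives equality of
  the gap laws. This computation requires that the exchanged gaps are positive, because coinciding
  division points would merge; the choice \<open>h = 1\<close> shows it, since gaps of length 0 contribute nothing
  while the original gaps give the full mass 1.
\<close>

theorem shift_invariant_iff_exchange_invariant:
  "distr N configs shifted = distr N configs T \<longleftrightarrow> distr (taus \<Otimes>\<^sub>M bs) seq_space exchanged = taus"
proof
  let ?R' = "distr (taus \<Otimes>\<^sub>M bs) seq_space exchanged"
  assume inv: "?R' = taus"
  show "distr N configs shifted = distr N configs T"
  proof (rule measure_eqI)
    fix A assume "A \<in> sets (distr N configs shifted)"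
    then have A[measurable]: "A \<in> sets configs" by simp
    have "(\<integral>\<^sup>+\<omega>. indicator A (shifted \<omega>) \<partial>N) = (\<integral>\<^sup>+\<omega>. indicator A (T \<omega>) \<partial>N)"
      by (simp add: shifted_integral inversion_renewal inv)
    moreover have "emeasure (distr N configs X) A = (\<integral>\<^sup>+\<omega>. indicator A (X \<omega>) \<partial>N)"
      if X: "X \<in> N \<rightarrow>\<^sub>M configs" for X
    proof -
      have "emeasure (distr N configs X) A = (\<integral>\<^sup>+S. indicator A S \<partial>distr N configs X)"
        by (rule nn_integral_indicator[symmetric]) simp
      then show ?thesis by (subst (asm) nn_integral_distr[OF X]) simp_all
    qed
    ultimately show "emeasure (distr N configs shifted) A = emeasure (distr N configs T) A"
      by simp
  qed simp
next
  let ?R' = "distr (taus \<Otimes>\<^sub>M bs) seq_space exchanged"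
  assume inv: "distr N configs shifted = distr N configs T"
  have eq: "(\<integral>\<^sup>+t. window_integral f (renewal_points t) 0 (t 1) \<partial>?R') = (\<integral>\<^sup>+t. window_integral f (renewal_points t) 0 (t 1) \<partial>taus)"
    if f[measurable]: "f \<in> borel_measurable configs" for f
  proof -
    have "(\<integral>\<^sup>+\<omega>. f (shifted \<omega>) \<partial>N) = (\<integral>\<^sup>+S. f S \<partial>distr N configs shifted)" by (simp add: nn_integral_distr)
    also have "\<dots> = (\<integral>\<^sup>+\<omega>. f (T \<omega>) \<partial>N)" unfolding inv by (simp add: nn_integral_distr)
    finally show ?thesis
      using lam by (auto simp: shifted_integral[OF f] inversion_renewal[OF f] ennreal_mult_cancel_left)
  qed
  interpret R': prob_space ?R' by (rule TB.P.prob_space_distr[OF exchanged_measurable])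
  note [measurable] = measurable_interpoint
  have taus_regular: "AE t in taus. proper_gaps t \<and> (\<forall>k. 0 < t k)"
  proof -
    have "AE t in taus. \<forall>k. 0 < t k"
      by (subst AE_all_countable, rule allI, rule AE_PiM_component[where P="\<lambda>x. 0 < x"]) (use F in auto)
    then show ?thesis using AE_proper_gaps by eventually_elim simp
  qed
  have const: "(\<integral>\<^sup>+u. (if 0 \<le> u \<and> u < c then a * inverse (ennreal c) else 0) \<partial>lborel) = a" if "0 < c" for a :: ennreal and c :: real
  proof -
    have "(\<integral>\<^sup>+u. (if 0 \<le> u \<and> u < c then a * inverse (ennreal c) else 0) \<partial>lborel)
        = (\<integral>\<^sup>+u. a * inverse (ennreal c) * indicator {0..<c} u \<partial>lborel)"
      by (intro nn_integral_cong) (auto simp: indicator_def)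
    also have "\<dots> = a * (inverse (ennreal c) * ennreal c)"
      using that by (subst nn_integral_cmult_indicator) (auto simp: mult.assoc)
    also have "inverse (ennreal c) * ennreal c = 1"
      using that by (simp add: inverse_ennreal ennreal_mult'[symmetric])
    finally show ?thesis by simp
  qed
  have R'_pos: "AE t in ?R'. \<forall>k. 0 < t k"
  proof (rule AE_all_exchanged_pos)
    \<comment> \<open>The interpoint distance with index 1 is the length of the gap around the origin.\<close>
    define f where "f S = 1 * inverse (ennreal (interpoint 1 S))" for S
    have f: "f \<in> borel_measurable configs" unfolding f_def[abs_def] by measurable
    have w: "window_integral f (renewal_points t) 0 (t 1) = (if 0 < t 1 then 1 else 0)" if "proper_gaps t" for t
    proof (cases "0 < t 1")
      case True
      have "window_integral f (renewal_points t) 0 (t 1) = (\<integral>\<^sup>+u. (if 0 \<le> u \<and> u < t 1 then 1 * inverse (ennreal (t 1)) else 0) \<partial>lborel)"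
        unfolding window_integral_def by (intro nn_integral_cong) (simp add: f_def interpoint_1_recentred_renewal_points[OF that True])
      then show ?thesis using True by (simp only: const[OF True] if_True)
    next
      case False
      then have "(\<lambda>u. if 0 \<le> u \<and> u < t 1 then f (recentre u (renewal_points t)) else 0) = (\<lambda>_. 0)" by (intro ext) auto
      then show ?thesis using False by (simp add: window_integral_def)
    qed
    have "(\<integral>\<^sup>+t. (if 0 < t 1 then 1 else 0) \<partial>?R') = (\<integral>\<^sup>+t. window_integral f (renewal_points t) 0 (t 1) \<partial>?R')"
      by (intro nn_integral_cong_AE eventually_mono[OF AE_proper_gaps_exchanged]) (simp add: w)
    also have "\<dots> = (\<integral>\<^sup>+t. 1 \<partial>taus)"
      unfolding eq[OF f] by (intro nn_integral_cong_AE eventually_mono[OF taus_regular]) (simp add: w)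
    also have "\<dots> = 1" using taus.emeasure_space_1 by simp
    finally have one: "(\<integral>\<^sup>+t. (if 0 < t 1 then 1 else 0) \<partial>?R') = 1" .
    have "Measurable.pred seq_space (\<lambda>t. 0 < t 1)"
      using measurable_seq_component[of 1] by simp
    from predE[OF this] have set: "{t \<in> space ?R'. 0 < t 1} \<in> sets ?R'"
      by (simp only: space_distr sets_distr)
    have "emeasure ?R' {t \<in> space ?R'. 0 < t 1} = 1"
    proof -
      have "emeasure ?R' {t \<in> space ?R'. 0 < t 1} = (\<integral>\<^sup>+t. indicator {t \<in> space ?R'. 0 < t 1} t \<partial>?R')"
        by (rule nn_integral_indicator[OF set, symmetric])
      also have "\<dots> = (\<integral>\<^sup>+t. (if 0 < t 1 then 1 else 0) \<partial>?R')"
        by (intro nn_integral_cong) (simp add: indicator_def)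
      finally show ?thesis by (simp only: one)
    qed
    then have "R'.prob {t \<in> space ?R'. 0 < t 1} = 1" by (rule measure_eq_emeasure_eq_ennreal[of 1, simplified])
    then have "AE t in ?R'. t \<in> {t \<in> space ?R'. 0 < t 1}" by (simp only: R'.AE_in_set_eq_1[OF set])
    then show "AE t in ?R'. 0 < t 1" by (rule eventually_mono) simp
  qed
  have R'_regular: "AE t in ?R'. proper_gaps t \<and> (\<forall>k. 0 < t k)"
    using AE_proper_gaps_exchanged R'_pos by eventually_elim simp
  show "?R' = taus"
  proof (rule measure_eqI)
    show "sets ?R' = sets taus" by (simp add: sets_taus)
    fix A assume "A \<in> sets ?R'"
    then have A: "A \<in> sets seq_space" by simp
    define f where "f S = indicator A (\<lambda>k. interpoint k S) * inverse (ennreal (interpoint 1 S))" for S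
    have "(\<lambda>S k. interpoint k S) \<in> configs \<rightarrow>\<^sub>M seq_space"
      unfolding seq_space_def by (rule measurable_PiM_UNIV) simp
    from measurable_compose[OF this borel_measurable_indicator[OF A]]
    have [measurable]: "(\<lambda>S. indicator A (\<lambda>k. interpoint k S) :: ennreal) \<in> borel_measurable configs" .
    have f: "f \<in> borel_measurable configs" unfolding f_def[abs_def] by measurable
    have w: "window_integral f (renewal_points t) 0 (t 1) = indicator A t" if t: "proper_gaps t \<and> (\<forall>k. 0 < t k)" for t
    proof -
      have "window_integral f (renewal_points t) 0 (t 1) = (\<integral>\<^sup>+u. (if 0 \<le> u \<and> u < t 1 then indicator A t * inverse (ennreal (t 1)) else 0) \<partial>lborel)"
        unfolding window_integral_def using t by (intro nn_integral_cong) (simp add: f_def enumeration_recentred_renewal_points(3))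
      then show ?thesis using t by (simp only: const)
    qed
    have "emeasure ?R' A = (\<integral>\<^sup>+t. indicator A t \<partial>?R')" using A by simp
    also have "\<dots> = (\<integral>\<^sup>+t. window_integral f (renewal_points t) 0 (t 1) \<partial>?R')"
      by (intro nn_integral_cong_AE eventually_mono[OF R'_regular]) (simp add: w)
    also have "\<dots> = (\<integral>\<^sup>+t. window_integral f (renewal_points t) 0 (t 1) \<partial>taus)" by (rule eq[OF f])
    also have "\<dots> = (\<integral>\<^sup>+t. indicator A t \<partial>taus)"
      by (intro nn_integral_cong_AE eventually_mono[OF taus_regular]) (simp add: w)
    also have "\<dots> = emeasure taus A" using A by (simp add: sets_taus)
    finally show "emeasure ?R' A = emeasure taus A" .
  qed
qed

end

section \<open>The characterisation\<close>

lemma exchange_law: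
  assumes "prob_space M" "iid M \<tau> F" "iid M b G"
    and "independent_elements M seq_space (trajectory \<tau>) seq_space (trajectory b)"
  shows "distr M seq_space (trajectory (exchange b \<tau>))
    = distr (PiM UNIV (\<lambda>_. F) \<Otimes>\<^sub>M PiM UNIV (\<lambda>_. G)) seq_space exchanged"
proof -
  note \<tau> = iid_trajectory_law[OF assms(1,2)] and b = iid_trajectory_law[OF assms(1,3)]
  have pair: "(\<lambda>\<omega>. (trajectory \<tau> \<omega>, trajectory b \<omega>)) \<in> M \<rightarrow>\<^sub>M seq_space \<Otimes>\<^sub>M seq_space"
    by (rule measurable_Pair[OF \<tau>(2) b(2)])
  have "PiM UNIV (\<lambda>_. F) \<Otimes>\<^sub>M PiM UNIV (\<lambda>_. G)
      = distr M (seq_space \<Otimes>\<^sub>M seq_space) (\<lambda>\<omega>. (trajectory \<tau> \<omega>, trajectory b \<omega>))"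
    using distr_pair_if_independent[OF assms(1,4)] by (simp only: \<tau>(1) b(1))
  then have "distr (PiM UNIV (\<lambda>_. F) \<Otimes>\<^sub>M PiM UNIV (\<lambda>_. G)) seq_space exchanged
      = distr M seq_space (exchanged \<circ> (\<lambda>\<omega>. (trajectory \<tau> \<omega>, trajectory b \<omega>)))"
    by (simp only: distr_distr[OF measurable_exchanged pair])
  also have "exchanged \<circ> (\<lambda>\<omega>. (trajectory \<tau> \<omega>, trajectory b \<omega>)) = trajectory (exchange b \<tau>)"
    by (auto simp: fun_eq_iff exchanged_def trajectory_def exchange_def)
  finally show ?thesis ..
qed

theorem theorem1:
  fixes F G :: "real measure"
    and M :: "'a measure" and \<tau> b :: "int \<Rightarrow> 'a \<Rightarrow> real"
    and N :: "'b measure" and T :: "'b \<Rightarrow> real set" and \<beta> :: "int \<Rightarrow> 'b \<Rightarrow> real"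
  assumes G: "real_distribution G" "AE x in G. x \<in> {0..1}"
    and \<tau>: "prob_space M" "iid M \<tau> F" "\<And>k. AE \<omega> in M. 0 < \<tau> k \<omega>" "\<And>k. integrable M (\<tau> k)"
    and b: "iid M b G" "independent_elements M seq_space (trajectory \<tau>) seq_space (trajectory b)"
    and T: "prob_space N" "stationary_renewal_process N T F"
    and \<beta>: "iid N \<beta> G" "independent_elements N configs T seq_space (trajectory \<beta>)"
      "\<And>k \<omega>. \<omega> \<in> space N \<Longrightarrow> \<beta> k \<omega> \<in> {0..1}"
    and nontrivial: "(\<exists>s. F = return borel s) \<or> (G \<noteq> return borel 0 \<and> G \<noteq> return borel 1)"
  shows "(distr M seq_space (trajectory (exchange b \<tau>)) = distr M seq_space (trajectory \<tau>) \<longleftrightarrow>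
      (\<exists>\<alpha> \<gamma> r. \<alpha> > 0 \<and> \<gamma> > 0 \<and> 0 < r \<and> r < 1 \<and>
         F = gamma_distribution \<alpha> \<gamma> \<and> G = beta_distribution (r * \<alpha>) ((1 - r) * \<alpha>)) \<or>
      (\<exists>s b. 0 < s \<and> 0 \<le> b \<and> b \<le> 1 \<and> F = return borel s \<and> G = return borel b))
    \<and>
    (distr N configs (\<lambda>\<omega>. neighbour_shift (\<lambda>k. \<beta> k \<omega>) (T \<omega>)) = distr N configs T \<longleftrightarrow>
      (\<exists>\<alpha> \<gamma> r. \<alpha> > 0 \<and> \<gamma> > 0 \<and> 0 < r \<and> r < 1 \<and>
         F = gamma_distribution \<alpha> \<gamma> \<and> G = beta_distribution (r * \<alpha>) ((1 - r) * \<alpha>)) \<or>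
      (\<exists>s b. 0 < s \<and> 0 \<le> b \<and> b \<le> 1 \<and> F = return borel s \<and> G = return borel b))"
proof -
  have F: "prob_space F" "sets F = sets borel" "AE t in F. 0 < t"
  proof -
    have "prob_space.indep_vars M (\<lambda>_. borel) \<tau> UNIV" using \<tau>(2) by (simp add: iid_def)
    then have \<tau>0: "\<tau> 0 \<in> borel_measurable M" by (simp add: prob_space.indep_vars_def[OF \<tau>(1)])
    have law: "distr M borel (\<tau> 0) = F" using \<tau>(2) by (simp add: iid_def)
    show "prob_space F" unfolding law[symmetric] by (rule prob_space.prob_space_distr[OF \<tau>(1) \<tau>0])
    show "sets F = sets borel" unfolding law[symmetric] by simp
    have "AE t in distr M borel (\<tau> 0). 0 < t"
      by (subst AE_distr_iff[OF \<tau>0]) (simp, rule \<tau>(3))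
    then show "AE t in F. 0 < t" unfolding law .
  qed
  have "prob_space G" "sets G = sets borel"
    using G(1) by (auto simp: real_distribution_def real_distribution_axioms_def)
  then interpret division F G by (rule division.intro[OF F _ _ G(2)])
  interpret marked_renewal N T F G \<beta>
  proof (rule marked_renewal.intro)
    show "renewal_process N T F" by (intro renewal_process.intro renewal_process_axioms.intro T F)
    show "division F G" by (rule division_axioms)
    show "marked_renewal_axioms N T G \<beta>" by (rule marked_renewal_axioms.intro[OF \<beta>])
  qed
  have exchange: "distr M seq_space (trajectory (exchange b \<tau>)) = distr M seq_space (trajectory \<tau>)
      \<longleftrightarrow> distr (taus \<Otimes>\<^sub>M bs) seq_space exchanged = taus"
    unfolding exchange_law[OF \<tau>(1,2) b] iid_trajectory_law(1)[OF \<tau>(1,2)] ..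
  show ?thesis
    unfolding exchange shift_invariant_iff_exchange_invariant
    by (intro conjI exchange_invariant_iff[OF nontrivial])
qed

end
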